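(* Let $\mathcal{M}\subset\mathbb{R}^n$ be a locally symmetric $C^2$ submanifold of $\mathbb{R}^n$ of dimension $d$. Then $\lambda^{-1}(\mathcal{M})=\{X\in\mathbf{S}^n:\lambda(X)\in\mathcal{M}\}$ is a $C^2$ submanifold of $\mathbf{S}^n$, and its dimension is $$\dim\lambda^{-1}(\mathcal{M})=d+\sum_{1\le i<j\le \kappa_*+m_*}|I_i^*|\,|I_j^*|,$$ where $\sigma_*$ is a characteristic permutation of $\mathcal{M}$ and $P(\sigma_* )=\{I_1^*,\dots,I^*_{\kappa_*+m_*}\}$ is its orbit partition.
   Context: $\mathbf{S}^n$ is the space of real symmetric $n\times n$ matrices; $\lambda(X)\in\mathbb{R}^n$ is the vector of eigenvalues of $X$ with multiplicity, ordered nonincreasingly. $\Sigma^n$ is the group of permutations of $\mathbb{N}_n=\{1,\dots,n\}$, acting on $\mathbb{R}^n$ by $(\sigma x)_i=x_{\sigma^{-1}(i)}$. For $\sigma\in\Sigma^n$, $P(\sigma)$ is the partition of $\mathbb{N}_n$ into the orbits of $\sigma$ (the supports of the nontrivial cycles and the singletons of fixed points). For $x\in\mathbb{R}^n$, $P(x)$ is the partition of $\mathbb{N}_n$ in which $i,j$ lie in the same set iff $x_i=x_j$. $\Delta(\sigma)=\{x\in\mathbb{R}^n:P(x)=P(\sigma)\}$. $\mathbb{R}^n_{\ge}=\{x:x_1\ge\cdots\ge x_n\}$; $B(x,\delta)$ is the open Euclidean ball. A set $S\subset\mathbb{R}^n$ is locally symmetric if $S\cap\mathbb{R}^n_{\ge}\neq\emptyset$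 and for every $x\in S$ there is $\delta>0$ with $\sigma(S\cap B(x,\delta))=S\cap B(x,\delta)$ for all $y\in S\cap B(x,\delta)$ and all $\sigma\in\Sigma^n$ with $\sigma y=y$. A locally symmetric $C^2$ submanifold is a connected $C^2$ submanifold of $\mathbb{R}^n$ without boundary that is a locally symmetric set. A characteristic permutation of $\mathcal{M}$ is a $\sigma_*\in\Sigma^n$ such that there exist $\bar x\in\mathcal{M}$ and $\delta>0$ with $\mathcal{M}\cap B(\bar x,\delta)\subset\Delta(\sigma_* )$ (such a permutation exists and its partition $P(\sigma_* )$ is determined by $\mathcal{M}$); $\kappa_*$ is the number of singleton sets in $P(\sigma_* )$ and $m_*$ the number of sets with at least two elements. *)

theory Defs
  imports "HOL-Analysis.Analysis"
begin

text \<open>Coordinates of R^n are indexed by a finite linearly ordered type 'n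
  (the order plays the role of 1 < 2 < ... < n).\<close>

definition nonincr_cone :: "(real^'n::{finite,linorder}) set" where
  "nonincr_cone = {x. \<forall>i j. i \<le> j \<longrightarrow> x$j \<le> x$i}"

definition perm_act :: "('n::finite \<Rightarrow> 'n) \<Rightarrow> real^'n \<Rightarrow> real^'n" where
  "perm_act \<sigma> x = (\<chi> i. x $ (inv \<sigma> i))"

definition perm_partition :: "('n::finite \<Rightarrow> 'n) \<Rightarrow> 'n set set" where
  "perm_partition \<sigma> = {{(\<sigma> ^^ k) i | k. True} | i. True}"

definition vec_partition :: "real^'n::finite \<Rightarrow> 'n set set" where
  "vec_partition x = {{j. x$j = x$i} | i. True}"

definition Delta :: "('n::finite \<Rightarrow> 'n) \<Rightarrow> (real^'n) set" where
  "Delta \<sigma> = {x. vec_partition x = perm_partition \<sigma>}"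

definition locally_symmetric :: "(real^'n::{finite,linorder}) set \<Rightarrow> bool" where
  "locally_symmetric S \<longleftrightarrow> S \<inter> nonincr_cone \<noteq> {} \<and>
     (\<forall>x\<in>S. \<exists>\<delta>>0. \<forall>y\<in>S \<inter> ball x \<delta>. \<forall>\<sigma>.
        \<sigma> permutes UNIV \<and> perm_act \<sigma> y = y \<longrightarrow>
        perm_act \<sigma> ` (S \<inter> ball x \<delta>) = S \<inter> ball x \<delta>)"

definition C2_on :: "'a::euclidean_space set \<Rightarrow> ('a \<Rightarrow> 'b::euclidean_space) \<Rightarrow> bool" where
  "C2_on U f \<longleftrightarrow> (\<exists>f' f''.
     (\<forall>y\<in>U. (f has_derivative blinfun_apply (f' y)) (at y)) \<and>
     (\<forall>y\<in>U. (f' has_derivative blinfun_apply (f'' y)) (at y)) \<and>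
     continuous_on U f'')"

definition C2_submanifold_of :: "'a::euclidean_space set \<Rightarrow> 'a set \<Rightarrow> nat \<Rightarrow> bool" where
  "C2_submanifold_of V M d \<longleftrightarrow> subspace V \<and> M \<subseteq> V \<and> d \<le> dim V \<and>
     (\<forall>x\<in>M. \<exists>U (W::'a set) (F::'a\<Rightarrow>'a) F'. open U \<and> x \<in> U \<and> subspace W \<and> dim W = dim V - d \<and>
        C2_on U F \<and> (\<forall>y\<in>U. F y \<in> W) \<and> M \<inter> U = {y \<in> U \<inter> V. F y = 0} \<and>
        (F has_derivative F') (at x) \<and> F' ` V = W)"

definition locally_symmetric_C2_submanifold :: "(real^'n::{finite,linorder}) set \<Rightarrow> nat \<Rightarrow> bool" where
  "locally_symmetric_C2_submanifold M d \<longleftrightarrow>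
     connected M \<and> C2_submanifold_of UNIV M d \<and> locally_symmetric M"

definition characteristic_perm :: "(real^'n::finite) set \<Rightarrow> ('n \<Rightarrow> 'n) \<Rightarrow> bool" where
  "characteristic_perm M \<sigma> \<longleftrightarrow> \<sigma> permutes UNIV \<and>
     (\<exists>xb\<in>M. \<exists>\<delta>>0. M \<inter> ball xb \<delta> \<subseteq> Delta \<sigma>)"

definition Sym :: "(real^'n^'n::finite) set" where
  "Sym = {X. transpose X = X}"

definition eigvals :: "real^('n::{finite,linorder})^('n::{finite,linorder}) \<Rightarrow> real^('n::{finite,linorder})" where
  "eigvals X = (THE l. l \<in> nonincr_cone \<and>
     (\<forall>t. det (t *\<^sub>R mat 1 - X) = (\<Prod>i\<in>UNIV. t - l $ i)))"

definition spectral_preimage :: "(real^('n::{finite,linorder})) set \<Rightarrow> (real^('n::{finite,linorder})^('n::{finite,linorder})) set" where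
  "spectral_preimage M = {X \<in> Sym. eigvals X \<in> M}"

end

theory Submission
  imports Defs
begin

text \<open>
Near a point \<open>a\<close> of \<open>M\<close> with tangent space \<open>T\<close>, the stabilizer of \<open>a\<close> acts on \<open>T\<close>. Hence, for
each block of indices on which \<open>a\<close> is constant, either every vector of \<open>T\<close> is constant on the block or
\<open>T\<close> contains all differences of unit vectors of the block. Let \<open>C\<close> be the space of vectors that
are constant on the blocks of the first kind. Then \<open>M\<close> is locally the set of \<open>y \<in> C\<close> with \<open>\<Phi> y = 0\<close>,
where averaging over the stabilizer makes \<open>\<Phi>\<close> a C2 map invariant under it, with values in the
orthogonal complement of \<open>T\<close> in \<open>C\<close>. The index pairs identified by \<open>C\<close> do not depend on \<open>a\<close>, because
\<open>M\<close> is connected; they form the orbit partition of a characteristic permutation.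

An invariant C2 function composed with the ordered eigenvalues is again C2. Its derivatives are
computed along sequences of matrices whose diagonalizers converge, which compactness of the orthogonal
group provides. So \<open>\<Phi>\<close> lifts to symmetric matrices. That the eigenvalues in a block coincide is expressed
by the matrix \<open>q(X) (X - c(X))\<close>, where \<open>c(X)\<close> is the mean of the eigenvalues in the block and \<open>q(X)\<close> is a
polynomial in \<open>X\<close> which annihilates the other eigenspaces and whose coefficients are invariant functions
of the eigenvalues. Both conditions together form a submersion at \<open>X\<close>.
\<close>

section \<open>Functions of class C2 by directional derivatives\<close>

text \<open>The obstacle is that single eigenvalues are not differentiable where they coincide. Only
  functions invariant under the stabilizer of the eigenvalue vector pass to matrices, and an
  equality of two coordinates is not of this kind. As a matrix condition, a block of size
  \<open>k\<close> has to be a multiple of the identity: \<open>k(k+1)/2 - 1\<close> equations in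
  place of the \<open>k - 1\<close> that hold between coordinates. This is the origin of the count
  of pairs in the dimension formula. To obtain a submersion, \<open>q(X) (X - c(X))\<close> is not
  set to 0 as a whole. It is compressed to the block in a fixed eigenbasis of the central matrix and
  taken modulo scalars, the freed scalar being used for \<open>\<Phi>\<close>. The price is that a
  zero of the compressed map must be shown to force equal eigenvalues. A sign argument does this: if
  the compressed block were a nonzero scalar, all eigenvalues of the block would lie on the same
  side of their mean.\<close>

definition C1_dir :: "'a::euclidean_space set \<Rightarrow> ('a \<Rightarrow> 'b::euclidean_space) \<Rightarrow> bool" where
  "C1_dir U f \<longleftrightarrow> (\<exists>f'. (\<forall>y\<in>U. (f has_derivative f' y) (at y)) \<and> (\<forall>e. continuous_on U (\<lambda>y. f' y e)))"

text \<open>The regularity of the derivative is tested in each fixed direction, which avoids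
  operator-valued maps: products, polynomial coefficients and spectral functions can be handled
  through scalar formulas. In finite dimension nothing is lost.\<close>

definition C2_dir :: "'a::euclidean_space set \<Rightarrow> ('a \<Rightarrow> 'b::euclidean_space) \<Rightarrow> bool" where
  "C2_dir U f \<longleftrightarrow> (\<exists>f'. (\<forall>y\<in>U. (f has_derivative f' y) (at y)) \<and> (\<forall>e. C1_dir U (\<lambda>y. f' y e)))"

text \<open>An operator is a finite sum of rank-one operators \<open>K i v\<close>, each depending
  linearly on its value at one basis vector, so differentiating the values is enough. Linearity of
  \<open>D\<close> in the direction \<open>e\<close> comes from uniqueness of derivatives.\<close>

lemma has_derivative_BlinfunI:
  fixes f' :: "'a::euclidean_space \<Rightarrow> 'a \<Rightarrow> 'b::euclidean_space"
  assumes U: "open U" and y: "y \<in> U"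
    and lin: "\<And>y. y \<in> U \<Longrightarrow> bounded_linear (f' y)"
    and der: "\<And>e. ((\<lambda>y. f' y e) has_derivative D e) (at y)"
  shows "((\<lambda>y. Blinfun (f' y)) has_derivative (\<lambda>h. Blinfun (\<lambda>e. D e h))) (at y)"
    and "bounded_linear (\<lambda>e. D e h)"
proof -
  define K where "K i v = Blinfun (\<lambda>x::'a. (x \<bullet> i) *\<^sub>R (v::'b))" for i v
  have bl: "bounded_linear (\<lambda>x::'a. (x \<bullet> i) *\<^sub>R (v::'b))" for i v
    by (intro bounded_linear_intros)
  have K_apply: "blinfun_apply (K i v) x = (x \<bullet> i) *\<^sub>R v" for i v x
    unfolding K_def by (simp add: bl bounded_linear_Blinfun_apply)
  have Klin: "bounded_linear (K i)" for i
    unfolding linear_conv_bounded_linear[symmetric]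
    by (rule linearI; rule blinfun_eqI)
      (simp_all add: K_apply blinfun.bilinear_simps algebra_simps)
  have eq: "Blinfun g = (\<Sum>i\<in>Basis. K i (g i))" if "bounded_linear g" for g
  proof (rule blinfun_eqI)
    fix x
    have "g x = g (\<Sum>i\<in>Basis. (x \<bullet> i) *\<^sub>R i)" by (simp add: euclidean_representation)
    also have "\<dots> = (\<Sum>i\<in>Basis. (x \<bullet> i) *\<^sub>R g i)"
      using that by (simp add: linear_sum bounded_linear.linear linear_cmul)
    finally show "blinfun_apply (Blinfun g) x = blinfun_apply (\<Sum>i\<in>Basis. K i (g i)) x"
      by (simp add: that bounded_linear_Blinfun_apply blinfun.sum_left K_apply)
  qed
  have Dadd: "D (e1 + e2) = (\<lambda>h. D e1 h + D e2 h)" for e1 e2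
  proof -
    have "((\<lambda>y. f' y (e1 + e2)) has_derivative (\<lambda>h. D e1 h + D e2 h)) (at y)"
      by (rule has_derivative_transform_within_open[OF has_derivative_add[OF der der] U y])
        (simp add: lin linear_add bounded_linear.linear)
    then show ?thesis using der has_derivative_unique by blast
  qed
  have Dscale: "D (c *\<^sub>R e) = (\<lambda>h. c *\<^sub>R D e h)" for c e
  proof -
    have "((\<lambda>y. f' y (c *\<^sub>R e)) has_derivative (\<lambda>h. c *\<^sub>R D e h)) (at y)"
      by (rule has_derivative_transform_within_open[OF has_derivative_scaleR_right[OF der] U y])
        (simp add: lin linear_cmul bounded_linear.linear)
    then show ?thesis using der has_derivative_unique by blast
  qed
  show blD: "bounded_linear (\<lambda>e. D e h)" for h
    unfolding linear_conv_bounded_linear[symmetric]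
    by (rule linearI) (simp_all add: Dadd Dscale)
  have "((\<lambda>y. \<Sum>i\<in>Basis. K i (f' y i)) has_derivative (\<lambda>h. \<Sum>i\<in>Basis. K i (D i h))) (at y)"
    by (intro has_derivative_sum bounded_linear.has_derivative[OF Klin] der)
  then have "((\<lambda>y. Blinfun (f' y)) has_derivative (\<lambda>h. \<Sum>i\<in>Basis. K i (D i h))) (at y)"
    by (rule has_derivative_transform_within_open[OF _ U y]) (simp add: eq lin)
  then show "((\<lambda>y. Blinfun (f' y)) has_derivative (\<lambda>h. Blinfun (\<lambda>e. D e h))) (at y)"
    by (simp add: eq[OF blD])
qed

lemma C2_on_iff_C2_dir:
  assumes U: "open U"
  shows "C2_on U f \<longleftrightarrow> C2_dir U f"
proof
  assume "C2_on U f"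
  then obtain f' f'' where d1: "\<And>y. y \<in> U \<Longrightarrow> (f has_derivative blinfun_apply (f' y)) (at y)"
    and d2: "\<And>y. y \<in> U \<Longrightarrow> (f' has_derivative blinfun_apply (f'' y)) (at y)"
    and c: "continuous_on U f''" unfolding C2_on_def by blast
  have "C1_dir U (\<lambda>y. blinfun_apply (f' y) e)" for e
    unfolding C1_dir_def
  proof (intro exI[of _ "\<lambda>y h. blinfun_apply (blinfun_apply (f'' y) h) e"] conjI ballI allI)
    fix y assume "y \<in> U"
    then show "((\<lambda>y. blinfun_apply (f' y) e) has_derivative (\<lambda>h. f'' y h e)) (at y)"
      by (rule bounded_linear.has_derivative[OF blinfun.bounded_linear_left d2])
  next
    fix h show "continuous_on U (\<lambda>y. f'' y h e)" by (intro continuous_intros c)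
  qed
  with d1 show "C2_dir U f" unfolding C2_dir_def by (intro exI[of _ "\<lambda>y. blinfun_apply (f' y)"]) auto
next
  assume "C2_dir U f"
  then obtain f' where d1: "\<And>y. y \<in> U \<Longrightarrow> (f has_derivative f' y) (at y)"
    and c1: "\<And>e. C1_dir U (\<lambda>y. f' y e)" unfolding C2_dir_def by blast
  from c1 obtain D where D: "\<And>e y. y \<in> U \<Longrightarrow> ((\<lambda>y. f' y e) has_derivative D e y) (at y)"
    and cD: "\<And>e h. continuous_on U (\<lambda>y. D e y h)"
    unfolding C1_dir_def by metis
  have bl: "\<And>y. y \<in> U \<Longrightarrow> bounded_linear (f' y)" using d1 has_derivative_bounded_linear by blast
  have BD: "((\<lambda>y. Blinfun (f' y)) has_derivative (\<lambda>h. Blinfun (\<lambda>e. D e y h))) (at y)" if "y \<in> U" for y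
    using has_derivative_BlinfunI(1)[OF U that bl D[OF that]] .
  have bD: "bounded_linear (\<lambda>e. D e y h)" if "y \<in> U" for y h
    using has_derivative_BlinfunI(2)[OF U that bl D[OF that]] .
  define f1 where "f1 = (\<lambda>y. Blinfun (f' y))"
  define f2 where "f2 = (\<lambda>y. Blinfun (\<lambda>h. Blinfun (\<lambda>e. D e y h)))"
  have f2: "blinfun_apply (f2 y) = (\<lambda>h. Blinfun (\<lambda>e. D e y h))" if "y \<in> U" for y
    unfolding f2_def using has_derivative_bounded_linear[OF BD[OF that]]
    by (simp add: bounded_linear_Blinfun_apply)
  show "C2_on U f"
    unfolding C2_on_def
  proof (intro exI[of _ f1] exI[of _ f2] conjI ballI)
    fix y assume y: "y \<in> U"
    show "(f has_derivative blinfun_apply (f1 y)) (at y)"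
      using d1[OF y] by (simp add: f1_def bl[OF y] bounded_linear_Blinfun_apply)
    show "(f1 has_derivative blinfun_apply (f2 y)) (at y)"
      using BD[OF y] by (simp add: f2[OF y] f1_def)
  next
    show "continuous_on U f2"
    proof (intro continuous_on_blinfun_componentwise)
      fix h e :: 'a
      have "blinfun_apply (blinfun_apply (f2 y) h) e = D e y h" if "y \<in> U" for y
        using bD[OF that] by (simp add: f2[OF that] bounded_linear_Blinfun_apply)
      then show "continuous_on U (\<lambda>y. f2 y h e)" using cD[of e h] by (simp cong: continuous_on_cong)
    qed
  qed
qed

lemma C1_dir_const [intro]: "C1_dir U (\<lambda>y. c)"
  unfolding C1_dir_def by (intro exI[of _ "\<lambda>y h. 0"]) auto

lemma C2_dir_const [intro]: "C2_dir U (\<lambda>y. c)"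
  unfolding C2_dir_def by (intro exI[of _ "\<lambda>y h. 0"]) auto

lemma C2_dir_bounded_linear: "bounded_linear L \<Longrightarrow> C2_dir U L"
  unfolding C2_dir_def by (intro exI[of _ "\<lambda>y. L"]) (auto intro: bounded_linear_imp_has_derivative)

lemma C1_dir_linear_comp:
  assumes L: "bounded_linear L" and f: "C1_dir U f"
  shows "C1_dir U (\<lambda>y. L (f y))"
proof -
  from f obtain f' where "\<And>y. y \<in> U \<Longrightarrow> (f has_derivative f' y) (at y)"
    "\<And>e. continuous_on U (\<lambda>y. f' y e)" unfolding C1_dir_def by blast
  then show ?thesis unfolding C1_dir_def
    by (intro exI[of _ "\<lambda>y h. L (f' y h)"])
      (auto intro!: bounded_linear.has_derivative[OF L] bounded_linear.continuous_on[OF L])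
qed

lemma C2_dir_linear_comp:
  assumes L: "bounded_linear L" and f: "C2_dir U f"
  shows "C2_dir U (\<lambda>y. L (f y))"
proof -
  from f obtain f' where "\<And>y. y \<in> U \<Longrightarrow> (f has_derivative f' y) (at y)"
    "\<And>e. C1_dir U (\<lambda>y. f' y e)" unfolding C2_dir_def by blast
  then show ?thesis unfolding C2_dir_def
    by (intro exI[of _ "\<lambda>y h. L (f' y h)"])
      (auto intro!: bounded_linear.has_derivative[OF L] C1_dir_linear_comp[OF L])
qed

lemma C1_dir_add [intro]:
  assumes f: "C1_dir U f" and g: "C1_dir U g"
  shows "C1_dir U (\<lambda>y. f y + g y)"
proof -
  from f obtain f' where "\<And>y. y \<in> U \<Longrightarrow> (f has_derivative f' y) (at y)"
    "\<And>e. continuous_on U (\<lambda>y. f' y e)" unfolding C1_dir_def by blast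
  moreover from g obtain g' where "\<And>y. y \<in> U \<Longrightarrow> (g has_derivative g' y) (at y)"
    "\<And>e. continuous_on U (\<lambda>y. g' y e)" unfolding C1_dir_def by blast
  ultimately show ?thesis unfolding C1_dir_def
    by (intro exI[of _ "\<lambda>y h. f' y h + g' y h"])
      (auto intro!: has_derivative_add continuous_on_add)
qed

lemma C2_dir_add [intro]:
  assumes f: "C2_dir U f" and g: "C2_dir U g"
  shows "C2_dir U (\<lambda>y. f y + g y)"
proof -
  from f obtain f' where "\<And>y. y \<in> U \<Longrightarrow> (f has_derivative f' y) (at y)"
    "\<And>e. C1_dir U (\<lambda>y. f' y e)" unfolding C2_dir_def by blast
  moreover from g obtain g' where "\<And>y. y \<in> U \<Longrightarrow> (g has_derivative g' y) (at y)"
    "\<And>e. C1_dir U (\<lambda>y. g' y e)" unfolding C2_dir_def by blast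
  ultimately show ?thesis unfolding C2_dir_def
    by (intro exI[of _ "\<lambda>y h. f' y h + g' y h"])
      (auto intro!: has_derivative_add)
qed

lemma C1_dir_continuous_on: "C1_dir U f \<Longrightarrow> continuous_on U f"
  unfolding C1_dir_def
  by (meson continuous_at_imp_continuous_on has_derivative_continuous)

lemma C2_dir_imp_C1_dir: "C2_dir U f \<Longrightarrow> C1_dir U f"
  unfolding C2_dir_def C1_dir_def[of U f] using C1_dir_continuous_on by blast

lemma C1_dir_mult:
  fixes f g :: "'a::euclidean_space \<Rightarrow> real"
  assumes f: "C1_dir U f" and g: "C1_dir U g"
  shows "C1_dir U (\<lambda>y. f y * g y)"
proof -
  note cf = C1_dir_continuous_on[OF f] and cg = C1_dir_continuous_on[OF g]
  from f obtain f' where "\<And>y. y \<in> U \<Longrightarrow> (f has_derivative f' y) (at y)"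
    "\<And>e. continuous_on U (\<lambda>y. f' y e)" unfolding C1_dir_def by blast
  moreover from g obtain g' where "\<And>y. y \<in> U \<Longrightarrow> (g has_derivative g' y) (at y)"
    "\<And>e. continuous_on U (\<lambda>y. g' y e)" unfolding C1_dir_def by blast
  ultimately show ?thesis unfolding C1_dir_def
    by (intro exI[of _ "\<lambda>y h. f y * g' y h + f' y h * g y"])
      (auto intro!: has_derivative_mult continuous_intros cf cg)
qed

lemma C2_dir_mult:
  fixes f g :: "'a::euclidean_space \<Rightarrow> real"
  assumes f: "C2_dir U f" and g: "C2_dir U g"
  shows "C2_dir U (\<lambda>y. f y * g y)"
proof -
  note cf = C2_dir_imp_C1_dir[OF f] and cg = C2_dir_imp_C1_dir[OF g]
  from f obtain f' where "\<And>y. y \<in> U \<Longrightarrow> (f has_derivative f' y) (at y)"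
    "\<And>e. C1_dir U (\<lambda>y. f' y e)" unfolding C2_dir_def by blast
  moreover from g obtain g' where "\<And>y. y \<in> U \<Longrightarrow> (g has_derivative g' y) (at y)"
    "\<And>e. C1_dir U (\<lambda>y. g' y e)" unfolding C2_dir_def by blast
  ultimately show ?thesis unfolding C2_dir_def
    by (intro exI[of _ "\<lambda>y h. f y * g' y h + f' y h * g y"])
      (auto intro!: has_derivative_mult C1_dir_add C1_dir_mult cf cg)
qed

lemma C2_dir_sum: "(\<And>i. i \<in> I \<Longrightarrow> C2_dir U (f i)) \<Longrightarrow> C2_dir U (\<lambda>y. \<Sum>i\<in>I. f i y)"
  by (induction I rule: infinite_finite_induct) auto

lemma C2_dir_cmult:
  fixes f :: "'a::euclidean_space \<Rightarrow> real"
  shows "C2_dir U f \<Longrightarrow> C2_dir U (\<lambda>y. c * f y)"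
  by (intro C2_dir_mult C2_dir_const)

lemma C2_dir_diff:
  assumes "C2_dir U f" "C2_dir U g"
  shows "C2_dir U (\<lambda>y. f y - g y)"
  using C2_dir_add[OF assms(1) C2_dir_linear_comp[OF bounded_linear_minus[OF bounded_linear_ident] assms(2)]]
  by simp

lemma C1_dir_precomp_linear:
  assumes L: "bounded_linear L" and f: "C1_dir V f" and im: "L ` U \<subseteq> V"
  shows "C1_dir U (\<lambda>y. f (L y))"
proof -
  from f obtain f' where d: "\<And>y. y \<in> V \<Longrightarrow> (f has_derivative f' y) (at y)"
    and c: "\<And>e. continuous_on V (\<lambda>y. f' y e)" unfolding C1_dir_def by blast
  show ?thesis unfolding C1_dir_def
  proof (intro exI[of _ "\<lambda>y h. f' (L y) (L h)"] conjI ballI allI)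
    fix y assume "y \<in> U"
    then have "L y \<in> V" using im by auto
    from has_derivative_compose[OF bounded_linear_imp_has_derivative[OF L] d[OF this]]
    show "((\<lambda>y. f (L y)) has_derivative (\<lambda>h. f' (L y) (L h))) (at y)" .
  next
    fix e show "continuous_on U (\<lambda>y. f' (L y) (L e))"
      by (rule continuous_on_compose2[OF c linear_continuous_on[OF L] im])
  qed
qed

lemma C2_dir_precomp_linear:
  assumes L: "bounded_linear L" and f: "C2_dir V f" and im: "L ` U \<subseteq> V"
  shows "C2_dir U (\<lambda>y. f (L y))"
proof -
  from f obtain f' where d: "\<And>y. y \<in> V \<Longrightarrow> (f has_derivative f' y) (at y)"
    and c: "\<And>e. C1_dir V (\<lambda>y. f' y e)" unfolding C2_dir_def by blast
  show ?thesis unfolding C2_dir_def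
  proof (intro exI[of _ "\<lambda>y h. f' (L y) (L h)"] conjI ballI allI)
    fix y assume "y \<in> U"
    then have "L y \<in> V" using im by auto
    from has_derivative_compose[OF bounded_linear_imp_has_derivative[OF L] d[OF this]]
    show "((\<lambda>y. f (L y)) has_derivative (\<lambda>h. f' (L y) (L h))) (at y)" .
  next
    fix e show "C1_dir U (\<lambda>y. f' (L y) (L e))"
      by (rule C1_dir_precomp_linear[OF L c im])
  qed
qed

lemma C2_dir_subset: "C2_dir U f \<Longrightarrow> V \<subseteq> U \<Longrightarrow> C2_dir V f"
  using C2_dir_precomp_linear[OF bounded_linear_ident, of U f V] by simp

lemma C2_dir_vec:
  fixes f :: "'a::euclidean_space \<Rightarrow> 'b::euclidean_space^'n::finite"
  assumes "\<And>i. C2_dir U (\<lambda>y. f y $ i)"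
  shows "C2_dir U f"
proof -
  have bl: "bounded_linear (axis i :: 'b \<Rightarrow> 'b^'n)" for i
    unfolding linear_conv_bounded_linear[symmetric]
    by (rule linearI) (auto simp: vec_eq_iff axis_def)
  have "C2_dir U (\<lambda>y. \<Sum>i\<in>UNIV. axis i (f y $ i))"
    by (intro C2_dir_sum C2_dir_linear_comp[OF bl] assms)
  moreover have "(\<Sum>i\<in>UNIV. axis i (f y $ i)) = f y" for y
    by (simp add: vec_eq_iff axis_def if_distrib cong: if_cong)
  ultimately show ?thesis by simp
qed

text \<open>The inverse function theorem asks for a continuous operator-valued derivative; this
  supplies it.\<close>

lemma C2_dir_obtain_blinfun:
  assumes "open U" "C2_dir U f"
  obtains f' where "\<And>y. y \<in> U \<Longrightarrow> (f has_derivative blinfun_apply (f' y)) (at y)" "continuous_on U f'"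
proof -
  from assms obtain f' f'' where f': "\<And>y. y \<in> U \<Longrightarrow> (f has_derivative blinfun_apply (f' y)) (at y)"
    and f'': "\<And>y. y \<in> U \<Longrightarrow> (f' has_derivative blinfun_apply (f'' y)) (at y)"
    unfolding C2_on_iff_C2_dir[OF assms(1), symmetric] C2_on_def by blast
  have "continuous_on U f'"
    by (intro continuous_at_imp_continuous_on ballI has_derivative_continuous[OF f''])
  with f' that show ?thesis by blast
qed

section \<open>Eigenvalues of symmetric matrices\<close>

type_synonym 'n rvec = "(real, 'n) vec"
type_synonym 'n rmat = "((real, 'n) vec, 'n) vec"

definition diagm :: "real^'n::finite \<Rightarrow> real^'n^'n" where
  "diagm x = (\<chi> i j. if i = j then x $ i else 0)"

text \<open>The eigenvalue map of the definitions is only specified on symmetric matrices; composing with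
\<open>symm\<close> extends spectral functions to open sets of matrices.\<close>

definition symm :: "real^'n^'n::finite \<Rightarrow> real^'n^'n" where
  "symm X = (1/2) *\<^sub>R (X + transpose X)"

lemma diagm_component: "diagm x $ i $ j = (if i = j then x $ i else 0)"
  by (simp add: diagm_def)

lemma transpose_component: "transpose A $ i $ j = A $ j $ i"
  by (simp add: transpose_def)

lemma matrix_mult_component: "(A ** B) $ i $ j = (\<Sum>k\<in>UNIV. A $ i $ k * B $ k $ j)"
  by (simp add: matrix_matrix_mult_def)

lemma symm_component: "symm X $ i $ j = (X $ i $ j + X $ j $ i) / 2"
  by (simp add: symm_def transpose_component)

lemma symm_in_Sym: "symm X \<in> Sym"
  by (simp add: Sym_def vec_eq_iff transpose_component symm_component)

lemma symm_Sym: "X \<in> Sym \<Longrightarrow> symm X = X"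
  by (simp add: Sym_def vec_eq_iff transpose_component symm_component)

lemma bounded_linear_symm: "bounded_linear symm"
  unfolding linear_conv_bounded_linear[symmetric]
  by (rule linearI) (simp_all add: vec_eq_iff symm_component field_simps)

lemma mult_diagm_component: "(A ** diagm x) $ i $ j = A $ i $ j * x $ j"
  "(diagm x ** B) $ p $ q = x $ p * B $ p $ q"
  by (simp_all add: matrix_mult_component diagm_component if_distrib if_distribR cong: if_cong)

lemma conj_diagm_component:
  "(U ** diagm x ** transpose U) $ i $ j = (\<Sum>l\<in>UNIV. U $ i $ l * x $ l * U $ j $ l)"
  by (simp add: matrix_mult_component[of "U ** diagm x"] mult_diagm_component transpose_component)

section \<open>The spectral theorem with ordered eigenvalues\<close>

text \<open>Maximize the quadratic form on the unit sphere of \<open>S\<close>. At a maximizer the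
  residual \<open>X *v u - \<mu> *\<^sub>R u\<close> stays in \<open>S\<close> and has to vanish,
  since moving along it would increase the Rayleigh quotient to first order.\<close>

lemma symmetric_eigenvector_exists:
  fixes X :: "real^'n^'n"
  assumes X: "X \<in> Sym" and S: "subspace S" and inv: "\<And>v. v \<in> S \<Longrightarrow> X *v v \<in> S" and ne: "S \<noteq> {0}"
  obtains u \<mu> where "u \<in> S" "norm u = 1" "X *v u = \<mu> *\<^sub>R u"
proof -
  have sa: "v \<bullet> (X *v w) = (X *v v) \<bullet> w" for v w
    using X by (metis (mono_tags, lifting) Sym_def dot_lmul_matrix mem_Collect_eq transpose_matrix_vector)
  define K where "K = S \<inter> sphere 0 1"
  have "compact K" unfolding K_def by (simp add: S closed_subspace compact_Int_closed Int_commute closed_Int_compact)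
  moreover from ne S obtain v where "v \<in> S" "v \<noteq> 0" using subspace_0 by blast
  then have "(1 / norm v) *\<^sub>R v \<in> K" unfolding K_def using S by (simp add: subspace_scale)
  then have "K \<noteq> {}" by blast
  moreover have "continuous_on K (\<lambda>v. v \<bullet> (X *v v))"
    by (intro continuous_intros linear_continuous_on matrix_vector_mul_bounded_linear)
  ultimately obtain u where u: "u \<in> K" and max: "\<And>v. v \<in> K \<Longrightarrow> v \<bullet> (X *v v) \<le> u \<bullet> (X *v u)"
    using continuous_attains_sup[of K "\<lambda>v. v \<bullet> (X *v v)"] by metis
  define \<mu> where "\<mu> = u \<bullet> (X *v u)"
  have uS: "u \<in> S" and un: "norm u = 1" using u by (auto simp: K_def)
  have le: "v \<bullet> (X *v v) \<le> \<mu> * (v \<bullet> v)" if v: "v \<in> S" for v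
  proof (cases "v = 0")
    case False
    then have "(1 / norm v) *\<^sub>R v \<in> K" unfolding K_def using S v by (simp add: subspace_scale)
    from max[OF this] False show ?thesis
      by (simp add: \<mu>_def matrix_vector_mult_scaleR dot_square_norm field_simps power2_eq_square)
  qed simp
  define w where "w = X *v u - \<mu> *\<^sub>R u"
  have wS: "w \<in> S" unfolding w_def using uS inv S by (simp add: subspace_diff subspace_scale)
  define b c where "b = w \<bullet> w" and "c = w \<bullet> (X *v w) - \<mu> * (w \<bullet> w)"
  \<comment> \<open>On \<open>S\<close> the form
    \<open>v \<bullet> (X *v v) - \<mu> * (v \<bullet> v)\<close> has maximum 0, attained at
    \<open>u\<close>. Along \<open>u + e *\<^sub>R w\<close> its linear coefficient is
    \<open>2 * b\<close>, with \<open>b\<close> the squared norm of \<open>w\<close>.\<close>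
  have ineq: "2 * e * b + e^2 * c \<le> 0" for e
  proof -
    have "u + e *\<^sub>R w \<in> S" using uS wS S by (simp add: subspace_add subspace_scale)
    from le[OF this] have *: "u \<bullet> (X *v u) + 2 * e * (w \<bullet> (X *v u)) + e^2 * (w \<bullet> (X *v w))
       \<le> \<mu> * (u \<bullet> u + 2 * e * (w \<bullet> u) + e^2 * (w \<bullet> w))"
      by (simp add: matrix_vector_mult_scaleR matrix_vector_right_distrib inner_add_left inner_add_right
          sa[of u w] inner_commute[of w "X *v u"] inner_commute[of u w] power2_eq_square algebra_simps)
    have "u \<bullet> u = 1" using un by (simp add: norm_eq_1)
    moreover have bw: "w \<bullet> (X *v u) = b + \<mu> * (w \<bullet> u)"
      unfolding b_def by (subst (3) w_def) (simp add: inner_diff_right)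
    ultimately show ?thesis using * unfolding c_def bw \<mu>_def[symmetric] by (simp add: algebra_simps)
  qed
  have "b = 0"
  proof (rule ccontr)
    assume "b \<noteq> 0"
    then have b: "b > 0" unfolding b_def by simp
    \<comment> \<open>Small enough that \<open>e * \<bar>c\<bar> < b\<close>, so the quadratic term
      cannot offset the linear one; the \<open>+ 1\<close> covers \<open>c = 0\<close>.\<close>
    define e where "e = b / (\<bar>c\<bar> + 1)"
    have pos: "\<bar>c\<bar> + 1 > 0" by simp
    have e: "e > 0" using b pos by (simp add: e_def)
    have "e * (\<bar>c\<bar> + 1) = b" using pos by (simp add: e_def)
    then have ec: "e * \<bar>c\<bar> < b" using e by (simp add: algebra_simps)
    have "e * (2 * b + e * c) \<le> 0" using ineq[of e] by (simp add: algebra_simps power2_eq_square)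
    then have "2 * b + e * c \<le> 0" using e by (simp add: mult_le_0_iff)
    moreover have "- (e * c) \<le> e * \<bar>c\<bar>" using e
      by (metis abs_ge_minus_self abs_mult abs_of_pos)
    ultimately show False using ec b by linarith
  qed
  then have "X *v u = \<mu> *\<^sub>R u" by (simp add: b_def w_def)
  with uS un that show ?thesis by blast
qed

text \<open>The orthogonal complement in \<open>S\<close> of a unit eigenvector is again invariant
  because \<open>X\<close> is self-adjoint. Stating the result for invariant subspaces is what lets
  the induction on the dimension run.\<close>

lemma symmetric_eigenbasis_subspace:
  fixes X :: "real^'n^'n"
  assumes X: "X \<in> Sym"
  shows "subspace S \<Longrightarrow> (\<And>v. v \<in> S \<Longrightarrow> X *v v \<in> S) \<Longrightarrow>
    \<exists>B\<subseteq>S. finite B \<and> card B = dim S \<and> pairwise orthogonal B \<and> (\<forall>b\<in>B. norm b = 1 \<and> (\<exists>\<mu>. X *v b = \<mu> *\<^sub>R b))"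
proof (induction "dim S" arbitrary: S)
  case 0
  then show ?case by (intro exI[of _ "{}"]) auto
next
  case (Suc k)
  have sa: "v \<bullet> (X *v w) = (X *v v) \<bullet> w" for v w
    using X by (metis (mono_tags, lifting) Sym_def dot_lmul_matrix mem_Collect_eq transpose_matrix_vector)
  have "S \<noteq> {0}" using Suc(2) by auto
  then obtain u \<mu> where u: "u \<in> S" "norm u = 1" "X *v u = \<mu> *\<^sub>R u"
    using symmetric_eigenvector_exists[OF X Suc(3,4)] by metis
  define S' where "S' = {y \<in> S. \<forall>x\<in>span {u}. orthogonal x y}"
  have S'_eq: "S' = {y \<in> S. u \<bullet> y = 0}"
    unfolding S'_def span_singleton by (auto simp: orthogonal_def)
  have "dim S' + dim (span {u}) = dim S"
    unfolding S'_def using u Suc(3) by (intro dim_subspace_orthogonal_to_vectors) (auto simp: span_minimal)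
  moreover have "dim (span {u}) = 1" using u(2) by (auto simp: dim_singleton)
  ultimately have "k = dim S'" using Suc(2) by simp
  moreover have "subspace S'" unfolding S'_eq using Suc(3)
    by (auto simp: subspace_def inner_add_right)
  moreover have "X *v v \<in> S'" if "v \<in> S'" for v
    using that Suc(4) by (auto simp: S'_eq sa u(3))
  ultimately obtain B where B: "B \<subseteq> S'" "finite B" "card B = k" "pairwise orthogonal B"
    "\<forall>b\<in>B. norm b = 1 \<and> (\<exists>\<mu>. X *v b = \<mu> *\<^sub>R b)" using Suc(1) by metis
  have "u \<notin> B" using B(1) u(2) by (auto simp: S'_eq)
  then show ?case using B u Suc(2)
    by (intro exI[of _ "insert u B"])
      (auto simp: S'_eq pairwise_insert orthogonal_def inner_commute subset_iff)
qed

text \<open>The index type is ordered but not numbered, so positions are taken from the sorted list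
  of its elements and matched with \<open>B\<close> sorted by decreasing \<open>l\<close>.\<close>

lemma sorting_bijection_exists:
  fixes l :: "'b \<Rightarrow> real"
  assumes fin: "finite B" and card: "card B = CARD('n::{finite,linorder})"
  obtains f :: "'n::{finite,linorder} \<Rightarrow> 'b" where "bij_betw f UNIV B" "\<And>i j. i \<le> j \<Longrightarrow> l (f j) \<le> l (f i)"
proof -
  obtain xs0 where xs0: "set xs0 = B" "distinct xs0" using fin finite_distinct_list by blast
  define xs where "xs = sort_key (\<lambda>b. - l b) xs0"
  have xs: "set xs = B" "distinct xs" "sorted (map (\<lambda>b. - l b) xs)"
    using xs0 by (simp_all add: xs_def)
  define ns where "ns = sorted_list_of_set (UNIV :: 'n set)"
  have ns: "set ns = UNIV" "distinct ns" "sorted ns" by (simp_all add: ns_def)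
  have len: "length ns = length xs" using xs ns card by (metis distinct_card)
  have b1: "bij_betw ((!) ns) {..<length ns} UNIV" using ns by (intro bij_betw_nth) auto
  have b2: "bij_betw ((!) xs) {..<length ns} B" using xs len by (intro bij_betw_nth) auto
  define idx where "idx = inv_into {..<length ns} ((!) ns)"
  have b3: "bij_betw idx UNIV {..<length ns}" unfolding idx_def by (rule bij_betw_inv_into[OF b1])
  have nth_idx: "ns ! idx i = i" and idx_less: "idx i < length ns" for i
    using b1 b3 by (auto simp: idx_def bij_betw_inv_into_right dest: bij_betwE)
  have mono: "idx i \<le> idx j" if "i \<le> j" for i j
  proof (rule ccontr)
    assume "\<not> idx i \<le> idx j"
    then have "j \<le> i" using sorted_nth_mono[OF ns(3), of "idx j" "idx i"] idx_less nth_idx by simp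
    then have "i = j" using that by simp
    with \<open>\<not> idx i \<le> idx j\<close> show False by simp
  qed
  show ?thesis
  proof (rule that[of "\<lambda>i. xs ! idx i"])
    show "bij_betw (\<lambda>i. xs ! idx i) UNIV B"
      using bij_betw_trans[OF b3 b2] by (simp add: o_def)
    fix i j :: 'n assume "i \<le> j"
    from sorted_nth_mono[OF xs(3) mono[OF this]] idx_less[of i] idx_less[of j] len
    show "l (xs ! idx j) \<le> l (xs ! idx i)" by simp
  qed
qed

lemma Sym_sorted_diagonalization:
  fixes X :: "('n::{finite,linorder}) rmat"
  assumes X: "X \<in> Sym"
  obtains U l where "orthogonal_matrix U" "l \<in> nonincr_cone" "X = U ** diagm l ** transpose U"
proof -
  obtain B where B: "finite B" "card B = CARD('n)" "pairwise orthogonal B"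
    "\<forall>b\<in>B. norm b = 1 \<and> (\<exists>\<mu>. X *v b = \<mu> *\<^sub>R b)"
    using symmetric_eigenbasis_subspace[OF X, of UNIV] by auto
  then obtain \<mu> where \<mu>: "\<And>b. b \<in> B \<Longrightarrow> X *v b = \<mu> b *\<^sub>R b" by metis
  obtain f :: "'n \<Rightarrow> 'n rvec" where f: "bij_betw f UNIV B" "\<And>i j. i \<le> j \<Longrightarrow> \<mu> (f j) \<le> \<mu> (f i)"
    using sorting_bijection_exists[OF B(1,2), of \<mu>] by metis
  have fB: "f i \<in> B" for i using f(1) by (auto dest: bij_betwE)
  define U :: "'n rmat" where "U = (\<chi> i j. f j $ i)"
  have col: "column i U = f i" for i by (simp add: column_def U_def vec_eq_iff)
  have "orthogonal (f i) (f j)" if "i \<noteq> j" for i j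
    using that B(3) fB f(1) by (metis UNIV_I bij_betw_def inj_onD pairwiseD)
  then have orth: "orthogonal_matrix U"
    unfolding orthogonal_matrix_orthonormal_columns using B(4) fB by (auto simp: col)
  define l where "l = (\<chi> i. \<mu> (f i))"
  have "X ** U = U ** diagm l"
    unfolding vec_eq_iff
  proof (intro allI)
    fix i j
    have "(X ** U) $ i $ j = (X *v f j) $ i"
      by (simp add: matrix_mult_component matrix_vector_mult_def U_def)
    also have "\<dots> = \<mu> (f j) * f j $ i" by (simp add: \<mu>[OF fB])
    finally show "(X ** U) $ i $ j = (U ** diagm l) $ i $ j"
      by (simp add: mult_diagm_component l_def U_def)
  qed
  then have "X = U ** diagm l ** transpose U"
    using orth by (metis matrix_mul_assoc matrix_mul_rid orthogonal_matrix_def)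
  moreover have "l \<in> nonincr_cone" using f(2) by (simp add: nonincr_cone_def l_def)
  ultimately show ?thesis using orth that by blast
qed

text \<open>Equal polynomials have equal multisets of roots. For a nonincreasing vector each set
  \<open>{i. s \<le> l $ i}\<close> is an initial segment, hence determined by its cardinality,
  which the multiset fixes; these sets together recover the vector.\<close>

lemma nonincr_cone_unique:
  fixes l l' :: "('n::{finite,linorder}) rvec"
  assumes l: "l \<in> nonincr_cone" and l': "l' \<in> nonincr_cone"
    and eq: "\<And>t. (\<Prod>i\<in>UNIV. t - l $ i) = (\<Prod>i\<in>UNIV. t - l' $ i)"
  shows "l = l'"
proof -
  define p where "p x = (\<Prod>i\<in>UNIV. [: - (x $ i), 1:])" for x :: "'n rvec"
  have roots: "proots (p x) = image_mset (($) x) (mset_set UNIV)" for x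
  proof -
    have "proots (p x) = (\<Sum>i\<in>UNIV. {# x $ i #})"
      unfolding p_def by (subst proots_prod) auto
    also have "\<dots> = image_mset (($) x) (mset_set UNIV)"
      by (simp add: image_mset.comp sum_unfold_sum_mset)
    finally show ?thesis .
  qed
  have "poly (p l) = poly (p l')"
    using eq by (auto simp: p_def poly_prod)
  then have "p l = p l'" by (simp add: poly_eq_poly_eq_iff)
  then have ms: "image_mset (($) l) (mset_set UNIV) = image_mset (($) l') (mset_set UNIV)"
    using roots by metis
  have cnt: "card {i. s \<le> x $ i} = size {# t \<in># image_mset (($) x) (mset_set UNIV). s \<le> t #}" for s and x :: "'n rvec"
    by (simp add: filter_mset_image_mset)
  have card_eq: "card {i. s \<le> l $ i} = card {i. s \<le> l' $ i}" for s
    by (simp add: cnt ms)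
  have set_eq: "{i. s \<le> l $ i} = {i. s \<le> l' $ i}" for s
  proof -
    have "{i. s \<le> l $ i} \<subseteq> {i. s \<le> l' $ i} \<or> {i. s \<le> l' $ i} \<subseteq> {i. s \<le> l $ i}"
    proof (rule ccontr)
      assume "\<not> ?thesis"
      then obtain i j where "s \<le> l $ i" "\<not> s \<le> l' $ i" "s \<le> l' $ j" "\<not> s \<le> l $ j" by blast
      then show False using l l' unfolding nonincr_cone_def
        by (metis (mono_tags, lifting) linear mem_Collect_eq order_trans)
    qed
    then show ?thesis using card_eq[of s] by (metis card_subset_eq finite)
  qed
  then have "s \<le> l $ i \<longleftrightarrow> s \<le> l' $ i" for s i by blast
  then show ?thesis unfolding vec_eq_iff by (metis order_antisym order_refl)
qed

lemma char_poly_diagonalized: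
  fixes U :: "real^'n^'n"
  assumes U: "orthogonal_matrix U"
  shows "det (t *\<^sub>R mat 1 - U ** diagm l ** transpose U) = (\<Prod>i\<in>UNIV. t - l $ i)"
proof -
  have UU: "U ** transpose U = mat 1" using U by (simp add: orthogonal_matrix_def)
  have "t *\<^sub>R mat 1 - U ** diagm l ** transpose U = U ** diagm (\<chi> i. t - l $ i) ** transpose U"
  proof -
    have "(t *\<^sub>R mat 1) $ i $ j = (\<Sum>k\<in>UNIV. U $ i $ k * t * U $ j $ k)" for i j
    proof -
      have "(mat 1 :: real^'n^'n) $ i $ j = (\<Sum>k\<in>UNIV. U $ i $ k * U $ j $ k)"
        by (simp add: UU[symmetric] matrix_mult_component transpose_component)
      then show ?thesis by (simp add: sum_distrib_left algebra_simps)
    qed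
    then show ?thesis
      by (simp add: vec_eq_iff conj_diagm_component sum_subtractf[symmetric] algebra_simps)
  qed
  moreover have "det U * det (transpose U) = 1"
    by (metis UU det_I det_mul)
  ultimately have "det (t *\<^sub>R mat 1 - U ** diagm l ** transpose U) = det (diagm (\<chi> i. t - l $ i))"
    by (simp add: det_mul)
  also have "\<dots> = (\<Prod>i\<in>UNIV. t - l $ i)"
    by (subst det_diagonal) (auto simp: diagm_component)
  finally show ?thesis .
qed

text \<open>Makes the definite description in \<open>eigvals\<close> usable: any orthogonal
  diagonalization with ordered diagonal exhibits its value.\<close>

lemma eigvals_unique:
  fixes U :: "('n::{finite,linorder}) rmat"
  assumes U: "orthogonal_matrix U" and l: "l \<in> nonincr_cone"
  shows "eigvals (U ** diagm l ** transpose U) = l"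
  unfolding eigvals_def char_poly_diagonalized[OF U]
proof (rule the_equality)
  fix l' :: "'n rvec"
  assume "l' \<in> nonincr_cone \<and> (\<forall>t. (\<Prod>i\<in>UNIV. t - l $ i) = (\<Prod>i\<in>UNIV. t - l' $ i))"
  then show "l' = l" using nonincr_cone_unique[of l' l] l by simp
qed (use l in simp)

lemma eigvals_decomposition:
  fixes X :: "('n::{finite,linorder}) rmat"
  assumes X: "X \<in> Sym"
  obtains U where "orthogonal_matrix U" "X = U ** diagm (eigvals X) ** transpose U"
proof -
  obtain U l where "orthogonal_matrix U" "l \<in> nonincr_cone" "X = U ** diagm l ** transpose U"
    using Sym_sorted_diagonalization[OF X] .
  with eigvals_unique[of U l] that show ?thesis by simp
qed

lemma eigvals_in_cone:
  fixes X :: "('n::{finite,linorder}) rmat"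
  assumes X: "X \<in> Sym"
  shows "eigvals X \<in> nonincr_cone"
proof -
  obtain U l where "orthogonal_matrix U" "l \<in> nonincr_cone" "X = U ** diagm l ** transpose U"
    using Sym_sorted_diagonalization[OF X] .
  with eigvals_unique[of U l] show ?thesis by simp
qed

section \<open>Compactness of the orthogonal group and continuity of eigenvalues\<close>

lemma tendsto_matrix_mult:
  fixes A :: "'a \<Rightarrow> real^'n::finite^'m::finite" and B :: "'a \<Rightarrow> real^'p::finite^'n"
  assumes "(A \<longlongrightarrow> a) F" "(B \<longlongrightarrow> b) F"
  shows "((\<lambda>x. A x ** B x) \<longlongrightarrow> a ** b) F"
  by (intro vec_tendstoI) (simp add: matrix_mult_component, intro tendsto_intros assms)

lemma tendsto_transpose:
  fixes A :: "'a \<Rightarrow> real^'n::finite^'m::finite"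
  assumes "(A \<longlongrightarrow> a) F"
  shows "((\<lambda>x. transpose (A x)) \<longlongrightarrow> transpose a) F"
  by (intro vec_tendstoI) (simp add: transpose_component, intro tendsto_intros assms)

lemma orthogonal_matrix_limit:
  fixes U :: "nat \<Rightarrow> real^'n::finite^'n"
  assumes "\<And>m. orthogonal_matrix (U m)" "U \<longlonglongrightarrow> V"
  shows "orthogonal_matrix V"
proof -
  have "(\<lambda>m. transpose (U m) ** U m) \<longlonglongrightarrow> transpose V ** V"
    by (intro tendsto_matrix_mult tendsto_transpose assms)
  moreover have "transpose (U m) ** U m = mat 1" for m using assms(1) by (simp add: orthogonal_matrix_def)
  ultimately have "(\<lambda>m::nat. mat 1 :: real^'n^'n) \<longlonglongrightarrow> transpose V ** V" by simp
  then have "mat 1 = transpose V ** V" by (simp only: LIMSEQ_const_iff)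
  then show ?thesis by (simp add: orthogonal_matrix)
qed

lemma orthogonal_matrix_entry_le:
  assumes "orthogonal_matrix (U :: real^'n^'n)"
  shows "\<bar>U $ i $ j\<bar> \<le> 1"
proof -
  have "norm (row i U) = 1" using assms by (simp add: orthogonal_matrix_orthonormal_rows)
  moreover have "\<bar>U $ i $ j\<bar> \<le> norm (row i U)"
    using component_le_norm_cart[of "row i U" j] by (simp add: row_def)
  ultimately show ?thesis by simp
qed

lemma orthogonal_matrix_subseq:
  fixes U :: "nat \<Rightarrow> real^'n::finite^'n"
  assumes U: "\<And>m. orthogonal_matrix (U m)"
  obtains r V where "strict_mono r" "orthogonal_matrix V" "(\<lambda>m. U (r m)) \<longlonglongrightarrow> V"
proof -
  have "norm (U m) \<le> real CARD('n) * real CARD('n)" for m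
  proof -
    have "norm (U m) \<le> (\<Sum>i\<in>UNIV. norm (U m $ i))" unfolding norm_vec_def by (rule L2_set_le_sum) simp
    also have "\<dots> \<le> (\<Sum>i\<in>(UNIV::'n set). \<Sum>j\<in>(UNIV::'n set). \<bar>U m $ i $ j\<bar>)"
      by (intro sum_mono) (rule norm_le_l1_cart)
    also have "\<dots> \<le> (\<Sum>i\<in>(UNIV::'n set). \<Sum>j\<in>(UNIV::'n set). 1)"
      by (intro sum_mono orthogonal_matrix_entry_le U)
    finally show ?thesis by simp
  qed
  then have "bounded (range U)" by (auto simp: bounded_iff)
  then obtain V r where "strict_mono r" "(U \<circ> r) \<longlonglongrightarrow> V"
    using bounded_imp_convergent_subsequence by blast
  then show ?thesis using that orthogonal_matrix_limit[of "U \<circ> r" V] U by (auto simp: o_def)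
qed

lemma closed_nonincr_cone: "closed (nonincr_cone :: ('n::{finite,linorder}) rvec set)"
  unfolding nonincr_cone_def
  by (intro closed_Collect_all closed_Collect_imp open_Collect_const closed_Collect_le continuous_intros)

text \<open>Along a subsequence the diagonalizers converge, so \<open>transpose U ** X ** U\<close>
  does too. Its limit is diagonal, and ordered because the cone is closed, so by uniqueness it
  carries the eigenvalues of \<open>X0\<close>.\<close>

lemma eigvals_subseq:
  fixes X :: "nat \<Rightarrow> ('n::{finite,linorder}) rmat"
  assumes X: "X \<longlonglongrightarrow> X0" "\<And>m. X m \<in> Sym"
    and U: "\<And>m. orthogonal_matrix (U m)" "\<And>m. X m = U m ** diagm (eigvals (X m)) ** transpose (U m)"
  obtains r V where "strict_mono r" "orthogonal_matrix V" "(\<lambda>m. U (r m)) \<longlonglongrightarrow> V"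
    "(\<lambda>m. eigvals (X (r m))) \<longlonglongrightarrow> eigvals X0" "X0 = V ** diagm (eigvals X0) ** transpose V"
proof -
  obtain r V where r: "strict_mono r" and V: "orthogonal_matrix V" and lim: "(\<lambda>m. U (r m)) \<longlonglongrightarrow> V"
    using orthogonal_matrix_subseq[of U] U(1) by metis
  have Xr: "(\<lambda>m. X (r m)) \<longlonglongrightarrow> X0" using LIMSEQ_subseq_LIMSEQ[OF X(1) r] by (simp add: o_def)
  have dm: "diagm (eigvals (X m)) = transpose (U m) ** X m ** U m" for m
  proof -
    have "transpose (U m) ** X m ** U m =
      (transpose (U m) ** U m) ** diagm (eigvals (X m)) ** (transpose (U m) ** U m)"
      by (subst U(2)) (simp add: matrix_mul_assoc)
    then show ?thesis using U(1) by (simp add: orthogonal_matrix_def)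
  qed
  define Y where "Y = transpose V ** X0 ** V"
  have "(\<lambda>m. transpose (U (r m)) ** X (r m) ** U (r m)) \<longlonglongrightarrow> Y"
    unfolding Y_def by (intro tendsto_matrix_mult tendsto_transpose lim Xr)
  then have dlim: "(\<lambda>m. diagm (eigvals (X (r m)))) \<longlonglongrightarrow> Y" by (simp add: dm)
  have comp: "(\<lambda>m. diagm (eigvals (X (r m))) $ i $ j) \<longlonglongrightarrow> Y $ i $ j" for i j
    by (intro tendsto_vec_nth dlim)
  define l where "l = (\<chi> i. Y $ i $ i)"
  have llim: "(\<lambda>m. eigvals (X (r m))) \<longlonglongrightarrow> l"
  proof (rule vec_tendstoI)
    fix i show "(\<lambda>m. eigvals (X (r m)) $ i) \<longlonglongrightarrow> l $ i"
      using comp[of i i] by (simp add: diagm_component l_def)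
  qed
  have Yl: "Y = diagm l"
  proof -
    have "Y $ i $ j = 0" if "i \<noteq> j" for i j
      using comp[of i j] that by (simp add: diagm_component LIMSEQ_const_iff)
    then show ?thesis by (auto simp: vec_eq_iff diagm_component l_def)
  qed
  have lc: "l \<in> nonincr_cone"
    using closed_sequentially[OF closed_nonincr_cone _ llim] eigvals_in_cone X(2) by blast
  have "V ** Y ** transpose V = (V ** transpose V) ** X0 ** (V ** transpose V)"
    unfolding Y_def by (simp add: matrix_mul_assoc)
  then have X0: "X0 = V ** diagm l ** transpose V" using V by (simp add: Yl orthogonal_matrix_def)
  then have "eigvals X0 = l" using eigvals_unique[OF V lc] by simp
  then show ?thesis using that r V lim llim X0 by metis
qed

text \<open>Turns compactness arguments, which control only subsequences, into convergence of the
  whole sequence.\<close>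

lemma tendsto_if_subsubseq:
  fixes f :: "nat \<Rightarrow> 'a::metric_space"
  assumes "\<And>s::nat \<Rightarrow> nat. strict_mono s \<Longrightarrow> \<exists>r. strict_mono r \<and> (\<lambda>m. f (s (r m))) \<longlonglongrightarrow> L"
  shows "f \<longlonglongrightarrow> L"
proof (rule ccontr)
  assume "\<not> ?thesis"
  then obtain e where e: "e > 0" and inf: "\<forall>N. \<exists>m\<ge>N. \<not> dist (f m) L < e"
    unfolding lim_sequentially by blast
  then obtain s :: "nat \<Rightarrow> nat" where s: "strict_mono s" "\<And>m. \<not> dist (f (s m)) L < e"
    using infinite_enumerate[of "{m. \<not> dist (f m) L < e}"]
    by (auto simp: infinite_nat_iff_unbounded_le)
  from assms[OF s(1)] obtain r where "(\<lambda>m. f (s (r m))) \<longlonglongrightarrow> L" by blast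
  then obtain m where "dist (f (s (r m))) L < e"
    using e by (metis lim_sequentially order_refl)
  with s(2) show False by blast
qed

lemma tendsto_eigvals:
  fixes X :: "nat \<Rightarrow> ('n::{finite,linorder}) rmat"
  assumes X: "X \<longlonglongrightarrow> X0" "\<And>m. X m \<in> Sym"
  shows "(\<lambda>m. eigvals (X m)) \<longlonglongrightarrow> eigvals X0"
proof (rule tendsto_if_subsubseq)
  fix s :: "nat \<Rightarrow> nat" assume s: "strict_mono s"
  have "\<forall>m. \<exists>U. orthogonal_matrix U \<and> X m = U ** diagm (eigvals (X m)) ** transpose U"
    using eigvals_decomposition X(2) by metis
  then obtain U where U: "\<And>m. orthogonal_matrix (U m)" "\<And>m. X m = U m ** diagm (eigvals (X m)) ** transpose (U m)"
    by metis
  have "(\<lambda>m. X (s m)) \<longlonglongrightarrow> X0" using LIMSEQ_subseq_LIMSEQ[OF X(1) s] by (simp add: o_def)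
  then show "\<exists>r. strict_mono r \<and> (\<lambda>m. eigvals (X (s (r m)))) \<longlonglongrightarrow> eigvals X0"
    using eigvals_subseq[of "\<lambda>m. X (s m)" X0 "\<lambda>m. U (s m)"] U X(2) by metis
qed

lemma continuous_on_eigvals_symm:
  "continuous_on UNIV (\<lambda>X :: ('n::{finite,linorder}) rmat. eigvals (symm X))"
proof (rule continuous_at_imp_continuous_on, intro ballI)
  fix X :: "'n rmat"
  show "isCont (\<lambda>X. eigvals (symm X)) X"
  proof (unfold isCont_def, rule LIMSEQ_SEQ_conv[THEN iffD1])
    show "\<forall>S. (\<forall>n. S n \<noteq> X) \<and> S \<longlonglongrightarrow> X \<longrightarrow> (\<lambda>n. eigvals (symm (S n))) \<longlonglongrightarrow> eigvals (symm X)"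
    proof (intro allI impI)
      fix S assume "(\<forall>n. S n \<noteq> X) \<and> S \<longlonglongrightarrow> X"
      then have "(\<lambda>n. symm (S n)) \<longlonglongrightarrow> symm X"
        using bounded_linear.tendsto[OF bounded_linear_symm] by blast
      then show "(\<lambda>n. eigvals (symm (S n))) \<longlonglongrightarrow> eigvals (symm X)"
        by (intro tendsto_eigvals symm_in_Sym)
    qed
  qed
qed

section \<open>Transfer of smoothness to spectral functions\<close>

lemma has_derivative_along_seq:
  fixes f :: "'a::real_normed_vector \<Rightarrow> 'b::real_normed_vector" and x :: "nat \<Rightarrow> 'a" and t :: "nat \<Rightarrow> real"
  assumes f: "(f has_derivative D) (at x0)" and x: "x \<longlonglongrightarrow> x0"
    and w: "(\<lambda>m. (1 / t m) *\<^sub>R (x m - x0)) \<longlonglongrightarrow> w"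
  shows "(\<lambda>m. (1 / t m) *\<^sub>R (f (x m) - f x0)) \<longlonglongrightarrow> D w"
proof -
  have D: "bounded_linear D" using f by (rule has_derivative_bounded_linear)
  \<comment> \<open>Division by zero gives \<open>\<phi> x0 = 0\<close>, so the relative remainder
    is continuous at \<open>x0\<close> and the sequence may pass through \<open>x0\<close>.\<close>
  define \<phi> where "\<phi> y = (1 / norm (y - x0)) *\<^sub>R (f y - f x0 - D (y - x0))" for y
  have "(\<phi> \<longlongrightarrow> 0) (at x0)"
    using f unfolding has_derivative_within \<phi>_def
    by (simp add: diff_diff_eq)
  then have "isCont \<phi> x0" by (simp add: isCont_def \<phi>_def)
  then have \<phi>: "(\<lambda>m. \<phi> (x m)) \<longlonglongrightarrow> 0"
    using isCont_tendsto_compose[OF _ x, of \<phi>] by (simp add: \<phi>_def)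
  have "(\<lambda>m. D ((1 / t m) *\<^sub>R (x m - x0)) + (norm ((1 / t m) *\<^sub>R (x m - x0)) * sgn (t m)) *\<^sub>R \<phi> (x m)) \<longlonglongrightarrow> D w + 0"
  proof (rule tendsto_add)
    show "(\<lambda>m. D ((1 / t m) *\<^sub>R (x m - x0))) \<longlonglongrightarrow> D w" by (rule bounded_linear.tendsto[OF D w])
    have "(\<lambda>m. norm ((1 / t m) *\<^sub>R (x m - x0)) *\<^sub>R \<phi> (x m)) \<longlonglongrightarrow> norm w *\<^sub>R 0"
      by (intro tendsto_intros w \<phi>)
    then have *: "(\<lambda>m. norm ((1 / t m) *\<^sub>R (x m - x0)) *\<^sub>R \<phi> (x m)) \<longlonglongrightarrow> 0" by simp
    show "(\<lambda>m. (norm ((1 / t m) *\<^sub>R (x m - x0)) * sgn (t m)) *\<^sub>R \<phi> (x m)) \<longlonglongrightarrow> 0"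
      by (rule Lim_null_comparison[OF _ tendsto_norm_zero[OF *]])
        (auto simp: abs_mult abs_sgn_eq intro!: always_eventually mult_right_mono mult_left_le)
  qed
  moreover have "D ((1 / t m) *\<^sub>R (x m - x0)) + (norm ((1 / t m) *\<^sub>R (x m - x0)) * sgn (t m)) *\<^sub>R \<phi> (x m) = (1 / t m) *\<^sub>R (f (x m) - f x0)" for m
  proof (cases "x m = x0")
    case True
    then show ?thesis using D by (simp add: linear_simps)
  next
    case False
    have "norm ((1 / t m) *\<^sub>R (x m - x0)) * sgn (t m) = norm (x m - x0) / t m"
      by (simp add: sgn_if)
    then show ?thesis
      unfolding linear_cmul[OF bounded_linear.linear[OF D]] \<phi>_def
      using False by (simp add: scaleR_diff_right)
  qed
  ultimately show ?thesis by simp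
qed

text \<open>It suffices to test difference quotients along sequences with converging directions, and to pass
to subsequences there.\<close>

lemma has_derivative_subseqI:
  fixes f :: "'a::euclidean_space \<Rightarrow> 'b::real_normed_vector"
  assumes D: "bounded_linear D"
    and sub: "\<And>X E. X \<longlonglongrightarrow> x0 \<Longrightarrow> (\<And>m. X m \<noteq> x0) \<Longrightarrow>
      (\<lambda>m. (1 / norm (X m - x0)) *\<^sub>R (X m - x0)) \<longlonglongrightarrow> E \<Longrightarrow>
      \<exists>s::nat\<Rightarrow>nat. strict_mono s \<and> (\<lambda>m. (1 / norm (X (s m) - x0)) *\<^sub>R (f (X (s m)) - f x0)) \<longlonglongrightarrow> D E"
  shows "(f has_derivative D) (at x0)"
proof -
  have "((\<lambda>y. (1 / norm (y - x0)) *\<^sub>R (f y - f x0 - D (y - x0))) \<longlongrightarrow> 0) (at x0)"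
  proof (rule LIMSEQ_SEQ_conv[THEN iffD1], intro allI impI)
    fix X assume X: "(\<forall>m::nat. X m \<noteq> x0) \<and> X \<longlonglongrightarrow> x0"
    show "(\<lambda>m. (1 / norm (X m - x0)) *\<^sub>R (f (X m) - f x0 - D (X m - x0))) \<longlonglongrightarrow> 0"
    proof (rule tendsto_if_subsubseq)
      fix s :: "nat \<Rightarrow> nat" assume s: "strict_mono s"
      define e where "e m = (1 / norm (X (s m) - x0)) *\<^sub>R (X (s m) - x0)" for m
      have "bounded (range e)" using X by (auto simp: bounded_iff e_def)
      then obtain E r1 where r1: "strict_mono r1" "(e \<circ> r1) \<longlonglongrightarrow> E"
        using bounded_imp_convergent_subsequence by blast
      have "strict_mono (s \<circ> r1)" using s r1 strict_mono_o by blast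
      then have lim: "(\<lambda>m. X (s (r1 m))) \<longlonglongrightarrow> x0" using LIMSEQ_subseq_LIMSEQ[of X x0 "s \<circ> r1"] X by (simp add: o_def)
      obtain r2 :: "nat \<Rightarrow> nat" where r2: "strict_mono r2"
        "(\<lambda>m. (1 / norm (X (s (r1 (r2 m))) - x0)) *\<^sub>R (f (X (s (r1 (r2 m)))) - f x0)) \<longlonglongrightarrow> D E"
        using sub[OF lim, of E] r1 X by (auto simp: e_def o_def)
      have "(\<lambda>m. e (r1 (r2 m))) \<longlonglongrightarrow> E" using LIMSEQ_subseq_LIMSEQ[OF r1(2) r2(1)] by (simp add: o_def)
      from tendsto_diff[OF r2(2) bounded_linear.tendsto[OF D this]]
      have "(\<lambda>m. (1 / norm (X (s (r1 (r2 m))) - x0)) *\<^sub>R (f (X (s (r1 (r2 m)))) - f x0 - D (X (s (r1 (r2 m))) - x0))) \<longlonglongrightarrow> 0"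
        unfolding e_def linear_cmul[OF bounded_linear.linear[OF D]] scaleR_diff_right[symmetric] by simp
      then show "\<exists>r. strict_mono r \<and> (\<lambda>m. (1 / norm (X (s (r m)) - x0)) *\<^sub>R (f (X (s (r m))) - f x0 - D (X (s (r m)) - x0))) \<longlonglongrightarrow> 0"
        using r1 r2 by (intro exI[of _ "r1 \<circ> r2"]) (auto intro: strict_mono_o)
    qed
  qed
  then show ?thesis unfolding has_derivative_within using D by (simp add: diff_diff_eq)
qed

text \<open>An arbitrary choice, with no continuity to be expected where eigenvalues repeat. The
  gradient and Hessian built from it are shown below not to depend on the choice.\<close>

definition eigU :: "('n::{finite,linorder}) rmat \<Rightarrow> ('n::{finite,linorder}) rmat" where
  "eigU X = (SOME U. orthogonal_matrix U \<and> X = U ** diagm (eigvals X) ** transpose U)"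

lemma eigU:
  assumes "X \<in> Sym"
  shows "orthogonal_matrix (eigU X)" "X = eigU X ** diagm (eigvals X) ** transpose (eigU X)"
proof -
  have "\<exists>U. orthogonal_matrix U \<and> X = U ** diagm (eigvals X) ** transpose U"
    using eigvals_decomposition[OF assms] by metis
  from someI_ex[OF this] show "orthogonal_matrix (eigU X)" "X = eigU X ** diagm (eigvals X) ** transpose (eigU X)"
    by (simp_all add: eigU_def)
qed

lemma orthogonal_matrix_simps:
  assumes "orthogonal_matrix (U :: real^'n^'n)"
  shows "transpose U ** U = mat 1" "U ** transpose U = mat 1"
    "transpose U ** (U ** A) = A" "U ** (transpose U ** A) = A"
    "A ** transpose U ** U = A" "A ** U ** transpose U = A"
proof -
  show *: "transpose U ** U = mat 1" "U ** transpose U = mat 1"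
    using assms by (simp_all add: orthogonal_matrix_def)
  show "transpose U ** (U ** A) = A" "U ** (transpose U ** A) = A"
    unfolding matrix_mul_assoc * by simp_all
  show "A ** transpose U ** U = A" "A ** U ** transpose U = A"
    unfolding matrix_mul_assoc[symmetric] * by simp_all
qed

lemma matrix_diff_distrib:
  fixes A B C :: "real^'n^'n"
  shows "A ** (B - C) = A ** B - A ** C" "(A - B) ** C = A ** C - B ** C"
  by (simp_all add: vec_eq_iff matrix_mult_component sum_subtractf[symmetric] algebra_simps)

lemma matrix_scaleR_mult:
  fixes A B :: "real^'n^'n"
  shows "A ** (c *\<^sub>R B) = c *\<^sub>R (A ** B)" "(c *\<^sub>R A) ** B = c *\<^sub>R (A ** B)"
  by (simp_all add: vec_eq_iff matrix_mult_component sum_distrib_left algebra_simps)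

text \<open>The diagonalizer \<open>V\<close> of the limit matrix depends on the sequence: it is chosen as the limit of
the diagonalizers \<open>U\<close> of the nearby matrices, so that \<open>transpose V ** U\<close> tends to the identity
even when eigenvalues are repeated.\<close>

lemma eigen_perturbation_subseq:
  fixes X :: "nat \<Rightarrow> ('n::{finite,linorder}) rmat"
  assumes X: "X \<longlonglongrightarrow> X0" "\<And>m. X m \<noteq> X0"
    and E: "(\<lambda>m. (1 / norm (X m - X0)) *\<^sub>R (X m - X0)) \<longlonglongrightarrow> E"
    and x0_def: "x0 = eigvals (symm X0)"
  obtains s V where "strict_mono s" "orthogonal_matrix V" "symm X0 = V ** diagm x0 ** transpose V"
    "(\<lambda>m. eigU (symm (X (s m)))) \<longlonglongrightarrow> V" "(\<lambda>m. eigvals (symm (X (s m)))) \<longlonglongrightarrow> x0"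
    "\<And>i. (\<lambda>m. (1 / norm (X (s m) - X0)) * (eigvals (symm (X (s m))) $ i - x0 $ i)) \<longlonglongrightarrow> (transpose V ** symm E ** V) $ i $ i"
    "\<And>i j. i \<noteq> j \<Longrightarrow> x0 $ i = x0 $ j \<Longrightarrow> (transpose V ** symm E ** V) $ i $ j = 0"
    "\<And>i j. x0 $ i \<noteq> x0 $ j \<Longrightarrow> (\<lambda>m. (1 / norm (X (s m) - X0)) * (transpose V ** eigU (symm (X (s m)))) $ i $ j)
        \<longlonglongrightarrow> (transpose V ** symm E ** V) $ i $ j / (x0 $ j - x0 $ i)"
proof -
  have Slim: "(\<lambda>m. symm (X m)) \<longlonglongrightarrow> symm X0" using bounded_linear.tendsto[OF bounded_linear_symm X(1)] .
  obtain s V where s: "strict_mono s" and V: "orthogonal_matrix V" and Ulim: "(\<lambda>m. eigU (symm (X (s m)))) \<longlonglongrightarrow> V"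
    and xlim: "(\<lambda>m. eigvals (symm (X (s m)))) \<longlonglongrightarrow> x0" and X0: "symm X0 = V ** diagm x0 ** transpose V"
    using eigvals_subseq[OF Slim symm_in_Sym eigU(1)[OF symm_in_Sym] eigU(2)[OF symm_in_Sym]] x0_def by metis
  define t where "t m = 1 / norm (X (s m) - X0)" for m
  define U where "U m = eigU (symm (X (s m)))" for m
  define x where "x m = eigvals (symm (X (s m)))" for m
  define W where "W m = transpose V ** U m" for m
  define K where "K = transpose V ** symm E ** V"
  have U: "orthogonal_matrix (U m)" "symm (X (s m)) = U m ** diagm (x m) ** transpose (U m)" for m
    unfolding U_def x_def by (rule eigU[OF symm_in_Sym])+
  have Wlim: "W \<longlonglongrightarrow> mat 1"
    using tendsto_matrix_mult[OF tendsto_const[of "transpose V"] Ulim] V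
    unfolding W_def[abs_def] U_def by (simp add: orthogonal_matrix_def)
  have "(\<lambda>m. (1 / norm (X (s m) - X0)) *\<^sub>R (X (s m) - X0)) \<longlonglongrightarrow> E"
    using LIMSEQ_subseq_LIMSEQ[OF E s] by (simp add: o_def)
  from bounded_linear.tendsto[OF bounded_linear_symm this]
  have Elim: "(\<lambda>m. t m *\<^sub>R (symm (X (s m)) - symm X0)) \<longlonglongrightarrow> symm E"
    by (simp add: t_def linear_cmul linear_diff bounded_linear.linear[OF bounded_linear_symm])
  \<comment> \<open>All three limits come from this one identity: comparing the two
    diagonalizations, \<open>transpose V ** (symm (X (s m)) - symm X0) ** U m\<close> is
    \<open>W m ** diagm (x m) - diagm x0 ** W m\<close>, whose entries factor.\<close>
  have key: "t m * ((x m $ j - x0 $ i) * W m $ i $ j) = (transpose V ** (t m *\<^sub>R (symm (X (s m)) - symm X0)) ** U m) $ i $ j" for m i j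
  proof -
    have eq: "transpose V ** (symm (X (s m)) - symm X0) ** U m = W m ** diagm (x m) - diagm x0 ** W m"
      unfolding U(2) X0 W_def using U(1)[of m] V
      by (simp add: matrix_diff_distrib matrix_mul_assoc orthogonal_matrix_simps)
    show ?thesis unfolding matrix_scaleR_mult eq
      by (simp add: mult_diagm_component algebra_simps)
  qed
  have "(\<lambda>m. transpose V ** (t m *\<^sub>R (symm (X (s m)) - symm X0)) ** U m) \<longlonglongrightarrow> K"
    unfolding K_def by (intro tendsto_matrix_mult tendsto_const Elim) (use Ulim in \<open>simp add: U_def\<close>)
  then have Klim: "(\<lambda>m. t m * ((x m $ j - x0 $ i) * W m $ i $ j)) \<longlonglongrightarrow> K $ i $ j" for i j
    unfolding key by (intro tendsto_vec_nth)
  have Wc: "(\<lambda>m. W m $ i $ j) \<longlonglongrightarrow> (if i = j then 1 else 0)" for i j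
    using tendsto_vec_nth[OF tendsto_vec_nth[OF Wlim], of i j] by (simp add: mat_def)
  have 1: "(\<lambda>m. t m * (x m $ i - x0 $ i)) \<longlonglongrightarrow> K $ i $ i" for i
  proof -
    have "(\<lambda>m. t m * ((x m $ i - x0 $ i) * W m $ i $ i) / W m $ i $ i) \<longlonglongrightarrow> K $ i $ i / 1"
      by (rule tendsto_divide[OF Klim]) (use Wc[of i i] in auto)
    moreover have "\<forall>\<^sub>F m in sequentially. W m $ i $ i \<noteq> 0"
      using tendsto_imp_eventually_ne[OF Wc[of i i], of 0] by simp
    then have "\<forall>\<^sub>F m in sequentially. t m * ((x m $ i - x0 $ i) * W m $ i $ i) / W m $ i $ i = t m * (x m $ i - x0 $ i)"
      by eventually_elim simp
    ultimately show ?thesis by (simp add: tendsto_cong)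
  qed
  \<comment> \<open>Inside an eigenspace of the limit the eigenvalue quotient converges while the
    off-diagonal entry of \<open>W\<close> tends to 0. Thus this \<open>V\<close> also diagonalizes
    the compression of \<open>symm E\<close> to each eigenspace.\<close>
  have 2: "K $ i $ j = 0" if "i \<noteq> j" "x0 $ i = x0 $ j" for i j
  proof -
    have "(\<lambda>m. t m * (x m $ j - x0 $ j) * W m $ i $ j) \<longlonglongrightarrow> K $ j $ j * 0"
      by (rule tendsto_mult[OF 1]) (use Wc[of i j] that in auto)
    then have "(\<lambda>m. t m * ((x m $ j - x0 $ i) * W m $ i $ j)) \<longlonglongrightarrow> 0"
      using that(2) by (simp add: mult.assoc)
    then show ?thesis using Klim LIMSEQ_unique by blast
  qed
  have 3: "(\<lambda>m. t m * W m $ i $ j) \<longlonglongrightarrow> K $ i $ j / (x0 $ j - x0 $ i)" if "x0 $ i \<noteq> x0 $ j" for i j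
  proof -
    have d: "(\<lambda>m. x m $ j - x0 $ i) \<longlonglongrightarrow> x0 $ j - x0 $ i"
      by (intro tendsto_intros) (use xlim in \<open>simp add: x_def\<close>)
    have "(\<lambda>m. t m * ((x m $ j - x0 $ i) * W m $ i $ j) / (x m $ j - x0 $ i)) \<longlonglongrightarrow> K $ i $ j / (x0 $ j - x0 $ i)"
      by (rule tendsto_divide[OF Klim d]) (use that in auto)
    moreover have "\<forall>\<^sub>F m in sequentially. x m $ j - x0 $ i \<noteq> 0"
      using tendsto_imp_eventually_ne[OF d, of 0] that by auto
    then have "\<forall>\<^sub>F m in sequentially. t m * ((x m $ j - x0 $ i) * W m $ i $ j) / (x m $ j - x0 $ i) = t m * W m $ i $ j"
      by eventually_elim simp
    ultimately show ?thesis by (simp add: tendsto_cong)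
  qed
  show ?thesis
    by (rule that[OF s V X0 Ulim xlim])
      (use 1 2 3 in \<open>simp_all only: t_def x_def K_def W_def U_def\<close>)
qed

section \<open>Coordinate swaps and changes of the diagonalizer\<close>

text \<open>Invariance is formulated with transpositions, since those exchanging equal coordinates
  generate the stabilizer of a vector; being involutions, they need no inverse permutation.\<close>

definition swapv :: "'n \<Rightarrow> 'n \<Rightarrow> real^'n::finite \<Rightarrow> real^'n" where
  "swapv i j x = (\<chi> k. x $ Transposition.transpose i j k)"

lemma swapv_component: "swapv i j x $ k = x $ Transposition.transpose i j k"
  by (simp add: swapv_def)

lemma swapv_involutory [simp]: "swapv i j (swapv i j x) = x"
  by (simp add: vec_eq_iff swapv_component)

lemma inner_swapv: "swapv i j x \<bullet> swapv i j y = x \<bullet> y"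
  unfolding inner_vec_def swapv_component
  by (rule sum.reindex_bij_betw[of "Transposition.transpose i j" UNIV UNIV "\<lambda>k. x $ k \<bullet> y $ k"]) simp

lemma swapv_linear: "bounded_linear (swapv i j)"
  unfolding linear_conv_bounded_linear[symmetric]
  by (rule linearI) (simp_all add: vec_eq_iff swapv_component)

lemma dist_swapv: "dist (swapv i j x) (swapv i j y) = dist x y"
proof -
  have "swapv i j x - swapv i j y = swapv i j (x - y)" by (simp add: vec_eq_iff swapv_component)
  then show ?thesis by (simp add: dist_norm norm_eq_sqrt_inner inner_swapv)
qed

lemma swapv_fixed: "x $ i = x $ j \<Longrightarrow> swapv i j x = x"
  by (auto simp: vec_eq_iff swapv_component Transposition.transpose_def)

lemma swapv_ball: "a $ i = a $ j \<Longrightarrow> swapv i j x \<in> ball a r \<longleftrightarrow> x \<in> ball a r"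
  using dist_swapv[of i j a x] swapv_fixed[of a i j] by simp


lemma conj_commute:
  fixes Q :: "('n::{finite,linorder}) rmat"
  assumes "\<And>i j. Q $ i $ j \<noteq> 0 \<Longrightarrow> y $ i = y $ j"
  shows "Q ** diagm y = diagm y ** Q"
proof -
  have "Q $ i $ j * y $ j = y $ i * Q $ i $ j" for i j
    using assms[of i j] by (cases "Q $ i $ j = 0") auto
  then show ?thesis by (simp add: vec_eq_iff mult_diagm_component)
qed

text \<open>The change of basis \<open>transpose V ** V'\<close> commutes with
  \<open>diagm x\<close>, and such a matrix has no entry between different diagonal values.\<close>

lemma diagonalizers_block:
  fixes V V' :: "('n::{finite,linorder}) rmat"
  assumes V: "orthogonal_matrix V" "orthogonal_matrix V'"
    and eq: "V ** diagm x ** transpose V = V' ** diagm x ** transpose V'"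
  shows "(transpose V ** V') $ i $ j \<noteq> 0 \<Longrightarrow> x $ i = x $ j"
proof -
  have "transpose V ** (V ** diagm x ** transpose V) ** V' = transpose V ** (V' ** diagm x ** transpose V') ** V'"
    by (simp add: eq)
  then have "diagm x ** (transpose V ** V') = (transpose V ** V') ** diagm x"
    using V by (simp add: matrix_mul_assoc orthogonal_matrix_simps)
  then have "(diagm x ** (transpose V ** V')) $ i $ j = ((transpose V ** V') ** diagm x) $ i $ j" by simp
  then show "(transpose V ** V') $ i $ j \<noteq> 0 \<Longrightarrow> x $ i = x $ j"
    by (simp add: mult_diagm_component)
qed

text \<open>Taking the diagonal in the basis \<open>U\<close> is adjoint to conjugating a diagonal
  matrix by \<open>U\<close>. This rewrites the derivative of a spectral function as an inner
  product with a gradient matrix, whose independence of the diagonalizer can be treated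
  separately.\<close>

lemma inner_diag_conj:
  fixes U S :: "('n::{finite,linorder}) rmat"
  shows "y \<bullet> (\<chi> l. (transpose U ** S ** U) $ l $ l) = (U ** diagm y ** transpose U) \<bullet> S"
proof -
  have "y \<bullet> (\<chi> l. (transpose U ** S ** U) $ l $ l) = (\<Sum>l\<in>UNIV. \<Sum>k\<in>UNIV. \<Sum>i\<in>UNIV. U $ i $ l * y $ l * U $ k $ l * S $ i $ k)"
    by (simp add: inner_vec_def matrix_mult_component transpose_component sum_distrib_left sum_distrib_right mult_ac)
  also have "\<dots> = (\<Sum>l\<in>UNIV. \<Sum>i\<in>UNIV. \<Sum>k\<in>UNIV. U $ i $ l * y $ l * U $ k $ l * S $ i $ k)"
    by (intro sum.cong refl sum.swap)
  also have "\<dots> = (\<Sum>i\<in>UNIV. \<Sum>l\<in>UNIV. \<Sum>k\<in>UNIV. U $ i $ l * y $ l * U $ k $ l * S $ i $ k)"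
    by (rule sum.swap)
  also have "\<dots> = (\<Sum>i\<in>UNIV. \<Sum>k\<in>UNIV. \<Sum>l\<in>UNIV. U $ i $ l * y $ l * U $ k $ l * S $ i $ k)"
    by (intro sum.cong refl sum.swap)
  also have "\<dots> = (U ** diagm y ** transpose U) \<bullet> S"
    by (simp add: inner_vec_def conj_diagm_component sum_distrib_right)
  finally show ?thesis .
qed

text \<open>\<open>g\<close> and \<open>h\<close> are the gradient and the Hessian matrix of
  \<open>F\<close>. Invariance is assumed for swaps fixing \<open>a\<close>; by \<open>sep\<close>,
  coordinates that agree at a point of the ball already agree at \<open>a\<close>, so the
  stabilizers of all points of the ball are covered.\<close>

locale block_symmetric_function =
  fixes a :: "('n::{finite,linorder}) rvec" and r :: real
    and F :: "('n::{finite,linorder}) rvec \<Rightarrow> real"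
    and g :: "('n::{finite,linorder}) rvec \<Rightarrow> ('n::{finite,linorder}) rvec"
    and h :: "('n::{finite,linorder}) rvec \<Rightarrow> ('n::{finite,linorder}) rmat"
  assumes sep: "\<And>x i j. x \<in> ball a r \<Longrightarrow> x $ i = x $ j \<Longrightarrow> a $ i = a $ j"
    and F': "\<And>x. x \<in> ball a r \<Longrightarrow> (F has_derivative (\<lambda>v. g x \<bullet> v)) (at x)"
    and g': "\<And>x. x \<in> ball a r \<Longrightarrow> (g has_derivative (\<lambda>v. h x *v v)) (at x)"
    and hc: "continuous_on (ball a r) h"
    and F_swap: "\<And>i j x. a $ i = a $ j \<Longrightarrow> x \<in> ball a r \<Longrightarrow> F (swapv i j x) = F x"
begin

lemma g_swap:
  assumes "a $ i = a $ j" "x \<in> ball a r"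
  shows "g (swapv i j x) = swapv i j (g x)"
proof -
  have sx: "swapv i j x \<in> ball a r" using assms swapv_ball by blast
  have "((\<lambda>y. F (swapv i j y)) has_derivative (\<lambda>v. g (swapv i j x) \<bullet> swapv i j v)) (at x)"
    using has_derivative_compose[OF bounded_linear_imp_has_derivative[OF swapv_linear[of i j]] F'[OF sx]] .
  then have "(F has_derivative (\<lambda>v. g (swapv i j x) \<bullet> swapv i j v)) (at x)"
    by (rule has_derivative_transform_within_open[OF _ open_ball assms(2)]) (use F_swap assms in auto)
  then have "(\<lambda>v. g (swapv i j x) \<bullet> swapv i j v) = (\<lambda>v. g x \<bullet> v)"
    using F'[OF assms(2)] has_derivative_unique by blast
  then have "g (swapv i j x) \<bullet> swapv i j v = swapv i j (g x) \<bullet> swapv i j v" for v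
    by (metis inner_swapv)
  then have "g (swapv i j x) \<bullet> v = swapv i j (g x) \<bullet> v" for v
    by (metis swapv_involutory)
  then show ?thesis by (metis vector_eq_rdot)
qed

lemma g_eq:
  assumes "x \<in> ball a r" "x $ i = x $ j"
  shows "g x $ i = g x $ j"
proof -
  have "g x = swapv i j (g x)" using g_swap[of i j x] sep[OF assms] assms swapv_fixed by metis
  then have "g x $ i = swapv i j (g x) $ i" by simp
  then show ?thesis by (simp add: swapv_component)
qed

lemma h_swap:
  assumes x: "x \<in> ball a r" "x $ i = x $ j"
  shows "h x $ Transposition.transpose i j p $ Transposition.transpose i j q = h x $ p $ q"
proof -
  have sx: "swapv i j x = x" using x swapv_fixed by blast
  have "((\<lambda>y. g (swapv i j y)) has_derivative (\<lambda>v. h x *v swapv i j v)) (at x)"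
    using has_derivative_compose[OF bounded_linear_imp_has_derivative[OF swapv_linear[of i j]], of g "(*v) (h x)" x UNIV] g'[OF x(1)]
    by (simp add: sx)
  then have "((\<lambda>y. swapv i j (g y)) has_derivative (\<lambda>v. h x *v swapv i j v)) (at x)"
    by (rule has_derivative_transform_within_open[OF _ open_ball x(1)]) (use g_swap sep[OF x] in auto)
  moreover have "((\<lambda>y. swapv i j (g y)) has_derivative (\<lambda>v. swapv i j (h x *v v))) (at x)"
    by (rule bounded_linear.has_derivative[OF swapv_linear g'[OF x(1)]])
  ultimately have "(\<lambda>v. h x *v swapv i j v) = (\<lambda>v. swapv i j (h x *v v))"
    using has_derivative_unique by blast
  then have eq: "(h x *v swapv i j v) $ p = (swapv i j (h x *v v)) $ p" for v p by metis
  have ax: "swapv i j (axis q 1) = axis (Transposition.transpose i j q) 1"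
    by (auto simp: vec_eq_iff swapv_component axis_def Transposition.transpose_def)
  have mv: "(A *v axis q 1) $ p = A $ p $ q" for A :: "'n rmat" and p q
    by (simp add: matrix_vector_mult_def axis_def if_distrib cong: if_cong)
  show ?thesis
    using eq[of "axis q 1" "Transposition.transpose i j p"] by (simp add: ax mv swapv_component)
qed

text \<open>Divided differences of the gradient, continued to coinciding coordinates by their limit.
  They are the off-diagonal coefficients in the second-derivative formula for spectral
  functions.\<close>

definition slope :: "'n rvec \<Rightarrow> 'n \<Rightarrow> 'n \<Rightarrow> real" where
  "slope x i j = (if x $ i = x $ j then h x $ i $ i - h x $ i $ j else (g x $ i - g x $ j) / (x $ i - x $ j))"

text \<open>The derivative of the gradient matrix in an eigenbasis: diagonal entries of the
  direction move the eigenvalues, off-diagonal entries rotate the eigenvectors.\<close>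

definition Theta :: "'n rvec \<Rightarrow> 'n rmat \<Rightarrow> 'n rmat" where
  "Theta x K = (\<chi> i j. if i = j then \<Sum>l\<in>UNIV. h x $ i $ l * K $ l $ l else slope x i j * K $ i $ j)"

definition Hess :: "'n rmat \<Rightarrow> 'n rvec \<Rightarrow> 'n rmat \<Rightarrow> 'n rmat" where
  "Hess U x E = U ** Theta x (transpose U ** symm E ** U) ** transpose U"

lemma Hess_linear: "bounded_linear (Hess U x)"
proof -
  have 1: "linear (\<lambda>E. transpose U ** symm E ** U)"
    using bounded_linear.linear[OF bounded_linear_symm]
    by (intro linearI) (simp_all add: vec_eq_iff matrix_mult_component symm_component
        sum.distrib sum_distrib_left sum_distrib_right algebra_simps add_divide_distrib)
  have 2: "linear (Theta x)"
    by (intro linearI) (auto simp: vec_eq_iff Theta_def sum.distrib sum_distrib_left algebra_simps)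
  have 3: "linear (\<lambda>K. U ** K ** transpose U)"
    by (intro linearI) (simp_all add: vec_eq_iff matrix_mult_component
        sum.distrib sum_distrib_left sum_distrib_right algebra_simps)
  show ?thesis unfolding linear_conv_bounded_linear[symmetric] Hess_def
    using linear_compose[OF 1 linear_compose[OF 2 3]] by (simp add: o_def)
qed

text \<open>On an eigenspace, the Hessian is a multiple of the identity plus a multiple of the trace; this makes
it independent of the choice of the diagonalizer.\<close>

lemma Theta_block_form:
  assumes x: "x \<in> ball a r"
  obtains A \<beta> where "\<And>K i j. Theta x K $ i $ j = A i j * K $ i $ j + (if i = j then \<Sum>l\<in>UNIV. \<beta> i l * K $ l $ l else 0)"
    "\<And>i i' j. x $ i = x $ i' \<Longrightarrow> A i j = A i' j" "\<And>i j j'. x $ j = x $ j' \<Longrightarrow> A i j = A i j'"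
    "\<And>i i' l. x $ i = x $ i' \<Longrightarrow> \<beta> i l = \<beta> i' l" "\<And>i l l'. x $ l = x $ l' \<Longrightarrow> \<beta> i l = \<beta> i l'"
proof -
  note hs = h_swap[OF x]
  \<comment> \<open>The partner picked by \<open>SOME\<close> does not matter, by invariance of the
    Hessian under swaps. Without a partner the value 0 leaves all of \<open>h x $ i $ i\<close> to
    \<open>\<beta> i i\<close>.\<close>
  define \<alpha> where "\<alpha> i = (if \<exists>j. j \<noteq> i \<and> x $ j = x $ i then h x $ i $ i - h x $ i $ (SOME j. j \<noteq> i \<and> x $ j = x $ i) else 0)" for i
  have b1: "\<alpha> i = h x $ i $ i - h x $ i $ j" if "x $ i = x $ j" "i \<noteq> j" for i j
  proof -
    have ex: "\<exists>j. j \<noteq> i \<and> x $ j = x $ i" using that by metis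
    define k where "k = (SOME j. j \<noteq> i \<and> x $ j = x $ i)"
    have k: "k \<noteq> i" "x $ k = x $ i" using someI_ex[OF ex] by (auto simp: k_def)
    have "h x $ i $ k = h x $ i $ j"
      using hs[of k j i k] k that by (simp add: Transposition.transpose_def)
    then show ?thesis unfolding \<alpha>_def k_def using ex by simp
  qed
  have hsym: "h x $ i $ j = h x $ j $ i" "h x $ i $ i = h x $ j $ j" if "x $ i = x $ j" for i j
    using hs[OF that, of i j] hs[OF that, of i i] by simp_all
  have b2: "\<alpha> i = \<alpha> j" if "x $ i = x $ j" for i j
    using b1[OF that] b1[OF that[symmetric]] hsym[OF that] by (cases "i = j") auto
  define \<beta> where "\<beta> i l = h x $ i $ l - (if l = i then \<alpha> i else 0)" for i l
  define A where "A i j = (if x $ i = x $ j then \<alpha> i else (g x $ i - g x $ j) / (x $ i - x $ j))" for i j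
  have b3: "\<beta> i l = \<beta> j l" if "x $ i = x $ j" for i j l
  proof (cases "i = j \<or> l = i \<or> l = j")
    case True
    then consider "i = j" | "i \<noteq> j" "l = i" | "i \<noteq> j" "l = j" by blast
    then show ?thesis
    proof cases
      case 2
      then show ?thesis using b1[OF that] hsym[OF that] by (simp add: \<beta>_def)
    next
      case 3
      then show ?thesis using b1[OF that[symmetric]] hsym[OF that] by (simp add: \<beta>_def)
    qed simp
  next
    case False
    then show ?thesis using hs[OF that, of i l] by (auto simp: \<beta>_def Transposition.transpose_def)
  qed
  have b4: "\<beta> i l = \<beta> i m" if "x $ l = x $ m" for i l m
  proof (cases "l = m \<or> i = l \<or> i = m")
    case True
    then consider "l = m" | "l \<noteq> m" "i = l" | "l \<noteq> m" "i = m" by blast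
    then show ?thesis
    proof cases
      case 2
      then show ?thesis using b1[OF that] by (simp add: \<beta>_def)
    next
      case 3
      then show ?thesis using b1[OF that[symmetric]] by (simp add: \<beta>_def)
    qed simp
  next
    case False
    then show ?thesis using hs[OF that, of i l] by (auto simp: \<beta>_def Transposition.transpose_def)
  qed
  show ?thesis
  proof (rule that[of A \<beta>])
    fix K :: "'n rmat" and i j
    show "Theta x K $ i $ j = A i j * K $ i $ j + (if i = j then \<Sum>l\<in>UNIV. \<beta> i l * K $ l $ l else 0)"
    proof (cases "i = j")
      case True
      have "(\<Sum>l\<in>UNIV. \<beta> i l * K $ l $ l) = (\<Sum>l\<in>UNIV. h x $ i $ l * K $ l $ l) - (\<Sum>l\<in>UNIV. (if l = i then \<alpha> i * K $ l $ l else 0))"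
        unfolding \<beta>_def sum_subtractf[symmetric] by (rule sum.cong) (auto simp: algebra_simps)
      then show ?thesis using True by (simp add: Theta_def A_def)
    next
      case False
      then show ?thesis using b1[of i j] by (simp add: Theta_def A_def slope_def)
    qed
  next
    show "A i j = A i' j" if "x $ i = x $ i'" for i i' j
      using b2[OF that] g_eq[OF x that] that by (simp add: A_def)
    show "A i j = A i j'" if "x $ j = x $ j'" for i j j'
      using g_eq[OF x that] that by (simp add: A_def)
  qed (erule b3, erule b4)
qed

text \<open>The gradient is constant on the level sets of \<open>x\<close>, and the change of basis
  acts within them; so it commutes with \<open>diagm (g x)\<close>.\<close>

lemma grad_independent:
  fixes V V' :: "'n rmat"
  assumes V: "orthogonal_matrix V" "orthogonal_matrix V'"
    and eq: "V ** diagm x ** transpose V = V' ** diagm x ** transpose V'"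
    and x: "x \<in> ball a r"
  shows "V ** diagm (g x) ** transpose V = V' ** diagm (g x) ** transpose V'"
proof -
  define Q where "Q = transpose V ** V'"
  have V': "V' = V ** Q" unfolding Q_def using V by (simp add: orthogonal_matrix_simps)
  have Q: "orthogonal_matrix Q" unfolding Q_def using V by (simp add: orthogonal_matrix_mul)
  have comm: "Q ** diagm (g x) = diagm (g x) ** Q"
    by (rule conj_commute) (rule g_eq[OF x], rule diagonalizers_block[OF V eq], simp add: Q_def)
  have "V' ** diagm (g x) ** transpose V' = V ** (Q ** diagm (g x)) ** transpose Q ** transpose V"
    unfolding V' by (simp add: matrix_transpose_mul matrix_mul_assoc)
  also have "\<dots> = V ** diagm (g x) ** (Q ** transpose Q) ** transpose V"
    unfolding comm by (simp add: matrix_mul_assoc)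
  also have "\<dots> = V ** diagm (g x) ** transpose V" using Q by (simp add: orthogonal_matrix_simps)
  finally show ?thesis by simp
qed

text \<open>\<open>Q\<close> mixes only indices with equal \<open>x\<close>, where the coefficients
  \<open>A\<close> and \<open>\<beta>\<close> are constant. Hence the entrywise multiplication
  commutes with \<open>Q\<close>, and the diagonal part consists of weighted traces invariant under
  conjugation.\<close>

lemma Theta_equivariant:
  fixes Q K :: "'n rmat"
  assumes x: "x \<in> ball a r" and Q: "orthogonal_matrix Q"
    and blk: "\<And>i j. Q $ i $ j \<noteq> 0 \<Longrightarrow> x $ i = x $ j"
  shows "Q ** Theta x (transpose Q ** K ** Q) = Theta x K ** Q"
proof -
  obtain A \<beta> where Th: "\<And>K i j. Theta x K $ i $ j = A i j * K $ i $ j + (if i = j then \<Sum>l\<in>UNIV. \<beta> i l * K $ l $ l else 0)"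
    and A: "\<And>i i' j. x $ i = x $ i' \<Longrightarrow> A i j = A i' j" "\<And>i j j'. x $ j = x $ j' \<Longrightarrow> A i j = A i j'"
    and \<beta>: "\<And>i i' l. x $ i = x $ i' \<Longrightarrow> \<beta> i l = \<beta> i' l" "\<And>i l l'. x $ l = x $ l' \<Longrightarrow> \<beta> i l = \<beta> i l'"
    by (rule Theta_block_form[OF x]) blast
  define K' where "K' = transpose Q ** K ** Q"
  have KQ: "Q ** K' = K ** Q" unfolding K'_def using Q by (simp add: matrix_mul_assoc orthogonal_matrix_simps)
  \<comment> \<open>The weights form a diagonal matrix commuting with \<open>Q\<close>, so cyclicity
    of the trace applies.\<close>
  have tr: "(\<Sum>l\<in>UNIV. \<beta> i l * K' $ l $ l) = (\<Sum>l\<in>UNIV. \<beta> i l * K $ l $ l)" for i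
  proof -
    define y where "y = (\<chi> l. \<beta> i l)"
    have comm: "Q ** diagm y = diagm y ** Q"
      by (rule conj_commute) (simp add: y_def, rule \<beta>(2), rule blk)
    have t: "(\<Sum>l\<in>UNIV. \<beta> i l * M $ l $ l) = trace (diagm y ** M)" for M :: "'n rmat"
      by (simp add: trace_def mult_diagm_component y_def)
    have "trace (diagm y ** K') = trace ((diagm y ** transpose Q ** K) ** Q)"
      unfolding K'_def by (simp add: matrix_mul_assoc)
    also have "\<dots> = trace (Q ** (diagm y ** transpose Q ** K))" by (rule trace_mul_sym)
    also have "Q ** (diagm y ** transpose Q ** K) = diagm y ** K"
      using Q by (simp add: matrix_mul_assoc comm orthogonal_matrix_simps)
    finally show ?thesis unfolding t .
  qed
  have "(Q ** Theta x K') $ i $ j = (Theta x K ** Q) $ i $ j" for i j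
  proof -
    define s where "s k = (\<Sum>l\<in>UNIV. \<beta> k l * K $ l $ l)" for k
    have "(Q ** Theta x K') $ i $ j = (\<Sum>p\<in>UNIV. Q $ i $ p * (A p j * K' $ p $ j)) + Q $ i $ j * s j"
    proof -
      have "(Q ** Theta x K') $ i $ j = (\<Sum>p\<in>UNIV. Q $ i $ p * (A p j * K' $ p $ j) + (if p = j then Q $ i $ p * s j else 0))"
        unfolding matrix_mult_component Th tr s_def by (rule sum.cong) (auto simp: algebra_simps)
      then show ?thesis by (simp add: sum.distrib)
    qed
    also have "(\<Sum>p\<in>UNIV. Q $ i $ p * (A p j * K' $ p $ j)) = A i j * (Q ** K') $ i $ j"
      unfolding matrix_mult_component sum_distrib_left
    proof (rule sum.cong[OF refl])
      fix p show "Q $ i $ p * (A p j * K' $ p $ j) = A i j * (Q $ i $ p * K' $ p $ j)"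
        using A(1)[of i p j] blk[of i p] by (cases "Q $ i $ p = 0") auto
    qed
    also have "Q $ i $ j * s j = Q $ i $ j * s i"
      using \<beta>(1)[of i j] blk[of i j] by (cases "Q $ i $ j = 0") (auto simp: s_def)
    also have "A i j * (Q ** K') $ i $ j = (\<Sum>p\<in>UNIV. A i p * K $ i $ p * Q $ p $ j)"
      unfolding KQ matrix_mult_component sum_distrib_left
    proof (rule sum.cong[OF refl])
      fix p show "A i j * (K $ i $ p * Q $ p $ j) = A i p * K $ i $ p * Q $ p $ j"
        using A(2)[of p j i] blk[of p j] by (cases "Q $ p $ j = 0") auto
    qed
    also have "\<dots> + Q $ i $ j * s i = (Theta x K ** Q) $ i $ j"
    proof -
      have "(Theta x K ** Q) $ i $ j = (\<Sum>p\<in>UNIV. A i p * K $ i $ p * Q $ p $ j + (if i = p then s i * Q $ p $ j else 0))"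
        unfolding matrix_mult_component Th s_def by (rule sum.cong) (auto simp: algebra_simps)
      then show ?thesis by (simp add: sum.distrib)
    qed
    finally show ?thesis .
  qed
  then show ?thesis by (simp add: vec_eq_iff K'_def)
qed

lemma Hess_independent:
  fixes V V' :: "'n rmat"
  assumes V: "orthogonal_matrix V" "orthogonal_matrix V'"
    and eq: "V ** diagm x ** transpose V = V' ** diagm x ** transpose V'"
    and x: "x \<in> ball a r"
  shows "Hess V x E = Hess V' x E"
proof -
  define Q where "Q = transpose V ** V'"
  define K where "K = transpose V ** symm E ** V"
  have V': "V' = V ** Q" unfolding Q_def using V by (simp add: orthogonal_matrix_simps)
  have Q: "orthogonal_matrix Q" unfolding Q_def using V by (simp add: orthogonal_matrix_mul)
  have K': "transpose V' ** symm E ** V' = transpose Q ** K ** Q"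
    unfolding V' K_def by (simp add: matrix_transpose_mul matrix_mul_assoc)
  have "Q ** Theta x (transpose Q ** K ** Q) = Theta x K ** Q"
    by (rule Theta_equivariant[OF x Q]) (rule diagonalizers_block[OF V eq], simp add: Q_def)
  then have "V ** (Q ** Theta x (transpose Q ** K ** Q)) ** transpose Q ** transpose V = V ** Theta x K ** (Q ** transpose Q) ** transpose V"
    by (simp add: matrix_mul_assoc)
  then show ?thesis unfolding Hess_def K' unfolding V' using Q
    by (simp add: matrix_transpose_mul matrix_mul_assoc orthogonal_matrix_simps K_def)
qed

text \<open>By equivariance \<open>g x $ j\<close> is the \<open>i\<close>-th gradient entry at the
  swapped point, so the divided difference is a mean value along the segment from the swapped point
  to \<open>x\<close>. The swap fixes \<open>x0\<close>, hence both ends, and with them the segment,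
  lie within \<open>dist x x0\<close> of \<open>x0\<close>.\<close>

lemma slope_mean_value:
  assumes x: "x \<in> ball a r" and x0: "x0 \<in> ball a r" and ij: "x0 $ i = x0 $ j"
  obtains \<xi> where "\<xi> \<in> ball a r" "dist \<xi> x0 \<le> dist x x0" "slope x i j = h \<xi> $ i $ i - h \<xi> $ i $ j"
proof (cases "x $ i = x $ j")
  case True
  show ?thesis by (rule that[of x]) (use x True in \<open>simp_all add: slope_def\<close>)
next
  case False
  have aij: "a $ i = a $ j" using sep[OF x0 ij] .
  define y where "y = swapv i j x"
  have y: "y \<in> ball a r" using swapv_ball[OF aij] x by (simp add: y_def)
  have dy: "dist y x0 = dist x x0" using dist_swapv[of i j x x0] swapv_fixed[OF ij] by (simp add: y_def)
  define p where "p s = y + s *\<^sub>R (x - y)" for s :: real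
  have p_eq: "p s = (1 - s) *\<^sub>R y + s *\<^sub>R x" for s by (simp add: p_def algebra_simps)
  have pb: "p s \<in> ball a r" if "0 \<le> s" "s \<le> 1" for s
    unfolding p_eq using convexD[OF convex_ball y x, of "1 - s" s] that by simp
  have pd: "dist (p s) x0 \<le> dist x x0" if "0 \<le> s" "s \<le> 1" for s
  proof -
    have "p s \<in> cball x0 (dist x x0)"
      unfolding p_eq using convexD[OF convex_cball, of y x0 "dist x x0" x "1 - s" s] that dy by (simp add: dist_commute)
    then show ?thesis by (simp add: dist_commute)
  qed
  have xy: "(h z *v (x - y)) $ i = (x $ i - x $ j) * (h z $ i $ i - h z $ i $ j)" for z
  proof -
    have eq: "x - y = (x $ i - x $ j) *\<^sub>R (axis i 1 - axis j 1)"
      using False by (auto simp: vec_eq_iff y_def swapv_component axis_def Transposition.transpose_def)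
    show ?thesis unfolding eq
      by (simp add: matrix_vector_mult_scaleR matrix_vector_mult_diff_distrib matrix_vector_mult_basis column_def)
  qed
  have der: "((\<lambda>s. g (p s) $ i) has_real_derivative (h (p s) *v (x - y)) $ i) (at s)" if "0 \<le> s" "s \<le> 1" for s
  proof -
    have "(p has_derivative (\<lambda>c. c *\<^sub>R (x - y))) (at s)" unfolding p_def by (auto intro!: derivative_eq_intros)
    from has_derivative_compose[OF this g'[OF pb[OF that]]]
    have "((\<lambda>s. g (p s)) has_derivative (\<lambda>c. h (p s) *v (c *\<^sub>R (x - y)))) (at s)" .
    from bounded_linear.has_derivative[OF bounded_linear_vec_nth[of i] this]
    have "((\<lambda>s. g (p s) $ i) has_derivative (\<lambda>c. (h (p s) *v (c *\<^sub>R (x - y))) $ i)) (at s)" .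
    moreover have "(\<lambda>c. (h (p s) *v (c *\<^sub>R (x - y))) $ i) = (*) ((h (p s) *v (x - y)) $ i)"
      by (auto simp: matrix_vector_mult_scaleR mult.commute)
    ultimately show ?thesis by (simp add: has_field_derivative_def)
  qed
  have "\<exists>s>0. s < 1 \<and> g (p 1) $ i - g (p 0) $ i = (1 - 0) * (h (p s) *v (x - y)) $ i"
    by (rule MVT2) (use der in auto)
  then obtain s where s: "0 < s" "s < 1" and eq: "g (p 1) $ i - g (p 0) $ i = (h (p s) *v (x - y)) $ i" by auto
  have "g y $ i = g x $ j" using g_swap[OF aij x] by (simp add: y_def swapv_component)
  then have "g x $ i - g x $ j = (x $ i - x $ j) * (h (p s) $ i $ i - h (p s) $ i $ j)"
    using eq by (simp add: p_def xy)
  then have "slope x i j = h (p s) $ i $ i - h (p s) $ i $ j"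
    using False by (simp add: slope_def)
  then show ?thesis by (intro that[of "p s"] pb pd) (use s in simp_all)
qed

lemma tendsto_slope:
  assumes x: "\<And>m. x m \<in> ball a r" "x \<longlonglongrightarrow> x0" "x0 \<in> ball a r"
  shows "(\<lambda>m. slope (x m) i j) \<longlonglongrightarrow> slope x0 i j"
proof (cases "x0 $ i = x0 $ j")
  case True
  have "\<forall>m. \<exists>\<xi>. \<xi> \<in> ball a r \<and> dist \<xi> x0 \<le> dist (x m) x0 \<and> slope (x m) i j = h \<xi> $ i $ i - h \<xi> $ i $ j"
    using slope_mean_value[OF x(1) x(3) True] by metis
  then obtain \<xi> where \<xi>: "\<And>m. \<xi> m \<in> ball a r" "\<And>m. dist (\<xi> m) x0 \<le> dist (x m) x0"
    "\<And>m. slope (x m) i j = h (\<xi> m) $ i $ i - h (\<xi> m) $ i $ j" by metis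
  have "(\<lambda>m. dist (x m) x0) \<longlonglongrightarrow> 0" using x(2) tendsto_dist_iff by blast
  then have "(\<lambda>m. dist (\<xi> m) x0) \<longlonglongrightarrow> 0"
    by (rule Lim_null_comparison[rotated]) (use \<xi>(2) in auto)
  then have "\<xi> \<longlonglongrightarrow> x0" using tendsto_dist_iff by blast
  then have "(\<lambda>m. h (\<xi> m)) \<longlonglongrightarrow> h x0"
    using hc \<xi>(1) x(3) unfolding continuous_on_sequentially by (auto simp: o_def)
  then have "(\<lambda>m. h (\<xi> m) $ i $ i - h (\<xi> m) $ i $ j) \<longlonglongrightarrow> h x0 $ i $ i - h x0 $ i $ j"
    by (intro tendsto_intros)
  then show ?thesis unfolding \<xi>(3) using True by (simp add: slope_def)
next
  case False
  have gl: "(\<lambda>m. g (x m)) \<longlonglongrightarrow> g x0"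
    using isCont_tendsto_compose[OF has_derivative_continuous[OF g'[OF x(3)]] x(2)] .
  have d: "(\<lambda>m. x m $ i - x m $ j) \<longlonglongrightarrow> x0 $ i - x0 $ j" by (intro tendsto_intros x)
  have "(\<lambda>m. (g (x m) $ i - g (x m) $ j) / (x m $ i - x m $ j)) \<longlonglongrightarrow> (g x0 $ i - g x0 $ j) / (x0 $ i - x0 $ j)"
    by (intro tendsto_intros gl x) (use False in auto)
  moreover have "\<forall>\<^sub>F m in sequentially. x m $ i - x m $ j \<noteq> 0"
    using tendsto_imp_eventually_ne[OF d, of 0] False by auto
  then have "\<forall>\<^sub>F m in sequentially. (g (x m) $ i - g (x m) $ j) / (x m $ i - x m $ j) = slope (x m) i j"
    by eventually_elim (auto simp: slope_def)
  ultimately show ?thesis using False by (simp add: tendsto_cong slope_def)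
qed

text \<open>The perturbation argument yields a diagonalizer \<open>V1\<close> that depends on the
  sequence; independence of the gradient matrix brings the limit back to the given
  \<open>V\<close>.\<close>

lemma spectral_has_derivative:
  assumes x0_def: "x0 = eigvals (symm X0)" and x0: "x0 \<in> ball a r"
    and V: "orthogonal_matrix V" "symm X0 = V ** diagm x0 ** transpose V"
  shows "((\<lambda>X. F (eigvals (symm X))) has_derivative (\<lambda>E. g x0 \<bullet> (\<chi> l. (transpose V ** symm E ** V) $ l $ l))) (at X0)"
proof (rule has_derivative_subseqI)
  show "bounded_linear (\<lambda>E. g x0 \<bullet> (\<chi> l. (transpose V ** symm E ** V) $ l $ l))"
    unfolding inner_diag_conj
    by (rule bounded_linear_compose[OF bounded_linear_inner_right bounded_linear_symm])
  fix X E assume X: "X \<longlonglongrightarrow> X0" "\<And>m. X m \<noteq> X0" and E: "(\<lambda>m. (1 / norm (X m - X0)) *\<^sub>R (X m - X0)) \<longlonglongrightarrow> E"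
  obtain s V1 where s: "strict_mono s" and V1: "orthogonal_matrix V1" "symm X0 = V1 ** diagm x0 ** transpose V1"
    and xlim: "(\<lambda>m. eigvals (symm (X (s m)))) \<longlonglongrightarrow> x0"
    and k: "\<And>i. (\<lambda>m. (1 / norm (X (s m) - X0)) * (eigvals (symm (X (s m))) $ i - x0 $ i)) \<longlonglongrightarrow> (transpose V1 ** symm E ** V1) $ i $ i"
    by (rule eigen_perturbation_subseq[OF X E x0_def]) blast
  have "(\<lambda>m. (1 / norm (X (s m) - X0)) *\<^sub>R (eigvals (symm (X (s m))) - x0)) \<longlonglongrightarrow> (\<chi> l. (transpose V1 ** symm E ** V1) $ l $ l)"
    by (rule vec_tendstoI) (use k in simp)
  from has_derivative_along_seq[OF F'[OF x0] xlim this]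
  have "(\<lambda>m. (1 / norm (X (s m) - X0)) *\<^sub>R (F (eigvals (symm (X (s m)))) - F x0)) \<longlonglongrightarrow> g x0 \<bullet> (\<chi> l. (transpose V1 ** symm E ** V1) $ l $ l)" .
  also have "g x0 \<bullet> (\<chi> l. (transpose V1 ** symm E ** V1) $ l $ l) = g x0 \<bullet> (\<chi> l. (transpose V ** symm E ** V) $ l $ l)"
    unfolding inner_diag_conj using grad_independent[OF V(1) V1(1) _ x0] V V1 by simp
  finally show "\<exists>s. strict_mono s \<and> (\<lambda>m. (1 / norm (X (s m) - X0)) *\<^sub>R (F (eigvals (symm (X (s m)))) - F (eigvals (symm X0)))) \<longlonglongrightarrow> g x0 \<bullet> (\<chi> l. (transpose V ** symm E ** V) $ l $ l)"
    using s x0_def by auto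
qed

definition grad :: "'n rmat \<Rightarrow> 'n rmat" where
  "grad X = eigU (symm X) ** diagm (g (eigvals (symm X))) ** transpose (eigU (symm X))"

lemma grad_has_derivative:
  assumes x0_def: "x0 = eigvals (symm X0)" and x0: "x0 \<in> ball a r"
  shows "(grad has_derivative Hess (eigU (symm X0)) x0) (at X0)"
proof (rule has_derivative_subseqI)
  show "bounded_linear (Hess (eigU (symm X0)) x0)" by (rule Hess_linear)
  fix X E assume X: "X \<longlonglongrightarrow> X0" "\<And>m. X m \<noteq> X0" and E: "(\<lambda>m. (1 / norm (X m - X0)) *\<^sub>R (X m - X0)) \<longlonglongrightarrow> E"
  obtain s V where s: "strict_mono s" and V: "orthogonal_matrix V" "symm X0 = V ** diagm x0 ** transpose V"
    and Ulim: "(\<lambda>m. eigU (symm (X (s m)))) \<longlonglongrightarrow> V"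
    and xlim: "(\<lambda>m. eigvals (symm (X (s m)))) \<longlonglongrightarrow> x0"
    and k1: "\<And>i. (\<lambda>m. (1 / norm (X (s m) - X0)) * (eigvals (symm (X (s m))) $ i - x0 $ i)) \<longlonglongrightarrow> (transpose V ** symm E ** V) $ i $ i"
    and k2: "\<And>i j. i \<noteq> j \<Longrightarrow> x0 $ i = x0 $ j \<Longrightarrow> (transpose V ** symm E ** V) $ i $ j = 0"
    and k3: "\<And>i j. x0 $ i \<noteq> x0 $ j \<Longrightarrow> (\<lambda>m. (1 / norm (X (s m) - X0)) * (transpose V ** eigU (symm (X (s m)))) $ i $ j)
        \<longlonglongrightarrow> (transpose V ** symm E ** V) $ i $ j / (x0 $ j - x0 $ i)"
    by (rule eigen_perturbation_subseq[OF X E x0_def]) blast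
  define t where "t m = 1 / norm (X (s m) - X0)" for m
  define U where "U m = eigU (symm (X (s m)))" for m
  define x where "x m = eigvals (symm (X (s m)))" for m
  define W where "W m = transpose V ** U m" for m
  define K where "K = transpose V ** symm E ** V"
  have Ul: "U \<longlonglongrightarrow> V" using Ulim by (simp add: U_def[abs_def])
  have xl: "x \<longlonglongrightarrow> x0" using xlim by (simp add: x_def[abs_def])
  note k = k1[folded t_def x_def K_def] k2[folded K_def] k3[folded t_def U_def W_def K_def]
  have U: "orthogonal_matrix (U m)" for m unfolding U_def by (rule eigU[OF symm_in_Sym])
  have Wl: "W \<longlonglongrightarrow> mat 1"
    using tendsto_matrix_mult[OF tendsto_const[of "transpose V"] Ul] V
    unfolding W_def[abs_def] by (simp add: orthogonal_matrix_def)
  have Wc: "(\<lambda>m. W m $ i $ j) \<longlonglongrightarrow> (if i = j then 1 else 0)" for i j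
    using tendsto_vec_nth[OF tendsto_vec_nth[OF Wl], of i j] by (simp add: mat_def)
  have gl: "(\<lambda>m. g (x m)) \<longlonglongrightarrow> g x0"
    using isCont_tendsto_compose[OF has_derivative_continuous[OF g'[OF x0]] xl] .
  have "(\<lambda>m. t m *\<^sub>R (x m - x0)) \<longlonglongrightarrow> (\<chi> l. K $ l $ l)"
    by (rule vec_tendstoI) (use k(1) in simp)
  then have "(\<lambda>m. t m *\<^sub>R (g (x m) - g x0)) \<longlonglongrightarrow> h x0 *v (\<chi> l. K $ l $ l)"
    using has_derivative_along_seq[OF g'[OF x0] xl, of "\<lambda>m. norm (X (s m) - X0)"] by (simp add: t_def)
  then have gd: "(\<lambda>m. t m * (g (x m) $ i - g x0 $ i)) \<longlonglongrightarrow> (\<Sum>l\<in>UNIV. h x0 $ i $ l * K $ l $ l)" for i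
    using tendsto_vec_nth[of _ "h x0 *v (\<chi> l. K $ l $ l)" sequentially i] by (fastforce simp: matrix_vector_mult_def)
  \<comment> \<open>The difference quotient of the gradients, read with \<open>V\<close> on the left
    and \<open>U m\<close> on the right. In these mixed bases it is again a difference of two
    diagonal scalings of \<open>W m\<close>, so its limit can be found entry by entry.\<close>
  define N where "N m = t m *\<^sub>R (W m ** diagm (g (x m)) - diagm (g x0) ** W m)" for m
  have Nc: "N m $ i $ j = t m * (g (x m) $ j - g x0 $ i) * W m $ i $ j" for m i j
    by (simp add: N_def mult_diagm_component algebra_simps)
  have Nl: "N \<longlonglongrightarrow> Theta x0 K"
  proof (intro vec_tendstoI)
    fix i j
    have "(\<lambda>m. t m * (g (x m) $ j - g x0 $ i) * W m $ i $ j) \<longlonglongrightarrow> Theta x0 K $ i $ j"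
    proof (cases "i = j")
      case True
      have "(\<lambda>m. t m * (g (x m) $ i - g x0 $ i) * W m $ i $ i) \<longlonglongrightarrow> (\<Sum>l\<in>UNIV. h x0 $ i $ l * K $ l $ l) * 1"
        by (rule tendsto_mult[OF gd]) (use Wc[of i i] in simp)
      then show ?thesis using True by (simp add: Theta_def)
    next
      case ij: False
      show ?thesis
      proof (cases "x0 $ i = x0 $ j")
        case True
        \<comment> \<open>Within a block the limit is 0, which is the entry of
          \<open>Theta x0 K\<close> because \<open>K $ i $ j = 0\<close> for the diagonalizer
          adapted to the sequence.\<close>
        have "(\<lambda>m. t m * (g (x m) $ j - g x0 $ j) * W m $ i $ j) \<longlonglongrightarrow> (\<Sum>l\<in>UNIV. h x0 $ j $ l * K $ l $ l) * 0"
          by (rule tendsto_mult[OF gd]) (use Wc[of i j] ij in simp)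
        then show ?thesis using ij True k(2)[OF ij True] g_eq[OF x0 True] by (simp add: Theta_def)
      next
        case False
        have "(\<lambda>m. (g (x m) $ j - g x0 $ i) * (t m * W m $ i $ j)) \<longlonglongrightarrow> (g x0 $ j - g x0 $ i) * (K $ i $ j / (x0 $ j - x0 $ i))"
          by (intro tendsto_mult k(3)[OF False] tendsto_intros gl)
        moreover have "(g x0 $ j - g x0 $ i) * (K $ i $ j / (x0 $ j - x0 $ i)) = Theta x0 K $ i $ j"
        proof -
          have "(g x0 $ j - g x0 $ i) * (K $ i $ j / (x0 $ j - x0 $ i)) = (g x0 $ j - g x0 $ i) / (x0 $ j - x0 $ i) * K $ i $ j"
            by simp
          also have "(g x0 $ j - g x0 $ i) / (x0 $ j - x0 $ i) = (g x0 $ i - g x0 $ j) / (x0 $ i - x0 $ j)"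
            by (metis minus_diff_eq minus_divide_divide)
          finally show ?thesis using False ij by (simp add: Theta_def slope_def)
        qed
        ultimately show ?thesis by (simp add: mult_ac)
      qed
    qed
    then show "(\<lambda>m. N m $ i $ j) \<longlonglongrightarrow> Theta x0 K $ i $ j" unfolding Nc .
  qed
  have g0: "grad X0 = V ** diagm (g x0) ** transpose V"
    unfolding grad_def x0_def[symmetric]
    by (rule grad_independent[OF eigU(1)[OF symm_in_Sym] V(1) _ x0]) (metis V(2) eigU(2) symm_in_Sym x0_def)
  have diff: "t m *\<^sub>R (grad (X (s m)) - grad X0) = V ** N m ** transpose (U m)" for m
  proof -
    have "V ** (W m ** diagm (g (x m)) - diagm (g x0) ** W m) ** transpose (U m) = grad (X (s m)) - grad X0"
      unfolding g0 unfolding grad_def x_def[symmetric] U_def[symmetric] W_def using V U[of m]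
      by (simp add: matrix_diff_distrib matrix_mul_assoc orthogonal_matrix_simps)
    then show ?thesis unfolding N_def by (simp add: matrix_scaleR_mult)
  qed
  have "(\<lambda>m. V ** N m ** transpose (U m)) \<longlonglongrightarrow> V ** Theta x0 K ** transpose V"
    by (intro tendsto_matrix_mult tendsto_transpose tendsto_const Nl Ul)
  also have "V ** Theta x0 K ** transpose V = Hess V x0 E" by (simp add: Hess_def K_def)
  also have "\<dots> = Hess (eigU (symm X0)) x0 E"
    by (rule Hess_independent[OF V(1) eigU(1)[OF symm_in_Sym] _ x0]) (metis V(2) eigU(2) symm_in_Sym x0_def)
  finally show "\<exists>s. strict_mono s \<and> (\<lambda>m. (1 / norm (X (s m) - X0)) *\<^sub>R (grad (X (s m)) - grad X0)) \<longlonglongrightarrow> Hess (eigU (symm X0)) x0 E"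
    unfolding diff[symmetric] t_def using s by blast
qed

text \<open>Since \<open>eigU\<close> may be discontinuous, convergence is proved on subsequences
  along which the diagonalizers converge; \<open>Hess_independent\<close> then replaces their limit
  by the chosen diagonalizer of \<open>X0\<close>.\<close>

lemma continuous_on_Hess:
  "continuous_on {X. eigvals (symm X) \<in> ball a r} (\<lambda>X. Hess (eigU (symm X)) (eigvals (symm X)) E)"
  unfolding continuous_on_sequentially o_def
proof (intro allI impI ballI)
  fix X X0 assume "X0 \<in> {X. eigvals (symm X) \<in> ball a r}" "(\<forall>m. X m \<in> {X. eigvals (symm X) \<in> ball a r}) \<and> X \<longlonglongrightarrow> X0"
  then have x0: "eigvals (symm X0) \<in> ball a r" and xm: "\<And>m. eigvals (symm (X m)) \<in> ball a r" and X: "X \<longlonglongrightarrow> X0" by auto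
  show "(\<lambda>m. Hess (eigU (symm (X m))) (eigvals (symm (X m))) E) \<longlonglongrightarrow> Hess (eigU (symm X0)) (eigvals (symm X0)) E"
  proof (rule tendsto_if_subsubseq)
    fix s :: "nat \<Rightarrow> nat" assume s: "strict_mono s"
    have "(\<lambda>m. X (s m)) \<longlonglongrightarrow> X0" using LIMSEQ_subseq_LIMSEQ[OF X s] by (simp add: o_def)
    then have Sl: "(\<lambda>m. symm (X (s m))) \<longlonglongrightarrow> symm X0" by (rule bounded_linear.tendsto[OF bounded_linear_symm])
    obtain p V where p: "strict_mono p" and V: "orthogonal_matrix V" and Ul: "(\<lambda>m. eigU (symm (X (s (p m))))) \<longlonglongrightarrow> V"
      and xl: "(\<lambda>m. eigvals (symm (X (s (p m))))) \<longlonglongrightarrow> eigvals (symm X0)" and X0: "symm X0 = V ** diagm (eigvals (symm X0)) ** transpose V"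
      using eigvals_subseq[OF Sl symm_in_Sym eigU(1)[OF symm_in_Sym] eigU(2)[OF symm_in_Sym]] by metis
    define U where "U m = eigU (symm (X (s (p m))))" for m
    define x where "x m = eigvals (symm (X (s (p m))))" for m
    define K where "K m = transpose (U m) ** symm E ** U m" for m
    define K0 where "K0 = transpose V ** symm E ** V"
    have Ul: "U \<longlonglongrightarrow> V" using Ul by (simp add: U_def[abs_def])
    have xl: "x \<longlonglongrightarrow> eigvals (symm X0)" using xl by (simp add: x_def[abs_def])
    have xb: "x m \<in> ball a r" for m using xm by (simp add: x_def)
    have "K \<longlonglongrightarrow> K0" unfolding K_def[abs_def] K0_def by (intro tendsto_matrix_mult tendsto_transpose tendsto_const Ul)
    then have Kc: "(\<lambda>m. K m $ i $ j) \<longlonglongrightarrow> K0 $ i $ j" for i j by (intro tendsto_vec_nth)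
    have "(\<lambda>m. h (x m)) \<longlonglongrightarrow> h (eigvals (symm X0))"
      using hc xb xl x0 unfolding continuous_on_sequentially by (auto simp: o_def)
    then have hcl: "(\<lambda>m. h (x m) $ i $ j) \<longlonglongrightarrow> h (eigvals (symm X0)) $ i $ j" for i j by (intro tendsto_vec_nth)
    have "(\<lambda>m. Theta (x m) (K m)) \<longlonglongrightarrow> Theta (eigvals (symm X0)) K0"
    proof (intro vec_tendstoI)
      fix i j show "(\<lambda>m. Theta (x m) (K m) $ i $ j) \<longlonglongrightarrow> Theta (eigvals (symm X0)) K0 $ i $ j"
        unfolding Theta_def
        by (cases "i = j") (simp_all, (intro tendsto_intros Kc hcl tendsto_slope[OF xb xl x0])+)
    qed
    then have "(\<lambda>m. Hess (U m) (x m) E) \<longlonglongrightarrow> Hess V (eigvals (symm X0)) E"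
      unfolding Hess_def K_def K0_def by (intro tendsto_matrix_mult tendsto_transpose Ul)
    also have "Hess V (eigvals (symm X0)) E = Hess (eigU (symm X0)) (eigvals (symm X0)) E"
      by (rule Hess_independent[OF V eigU(1)[OF symm_in_Sym] _ x0]) (metis X0 eigU(2) symm_in_Sym)
    finally show "\<exists>r. strict_mono r \<and> (\<lambda>m. Hess (eigU (symm (X (s (r m))))) (eigvals (symm (X (s (r m))))) E) \<longlonglongrightarrow> Hess (eigU (symm X0)) (eigvals (symm X0)) E"
      using p unfolding U_def x_def by blast
  qed
qed

lemma spectral_C2: "C2_dir {X. eigvals (symm X) \<in> ball a r} (\<lambda>X. F (eigvals (symm X)))"
  unfolding C2_dir_def
proof (intro exI[of _ "\<lambda>X E. grad X \<bullet> symm E"] conjI ballI allI)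
  fix X assume "X \<in> {X. eigvals (symm X) \<in> ball a r}"
  then show "((\<lambda>X. F (eigvals (symm X))) has_derivative (\<lambda>E. grad X \<bullet> symm E)) (at X)"
    using spectral_has_derivative[OF refl _ eigU(1)[OF symm_in_Sym] eigU(2)[OF symm_in_Sym]]
    unfolding inner_diag_conj grad_def by simp
next
  fix E
  show "C1_dir {X. eigvals (symm X) \<in> ball a r} (\<lambda>X. grad X \<bullet> symm E)"
    unfolding C1_dir_def
  proof (intro exI[of _ "\<lambda>X H. Hess (eigU (symm X)) (eigvals (symm X)) H \<bullet> symm E"] conjI ballI allI)
    fix X assume "X \<in> {X. eigvals (symm X) \<in> ball a r}"
    then show "((\<lambda>X. grad X \<bullet> symm E) has_derivative (\<lambda>H. Hess (eigU (symm X)) (eigvals (symm X)) H \<bullet> symm E)) (at X)"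
      by (intro bounded_linear.has_derivative[OF bounded_linear_inner_left] grad_has_derivative) auto
  next
    fix H show "continuous_on {X. eigvals (symm X) \<in> ball a r} (\<lambda>X. Hess (eigU (symm X)) (eigvals (symm X)) H \<bullet> symm E)"
      by (intro continuous_intros continuous_on_Hess)
  qed
qed

end

text \<open>The second part admits any diagonalizer \<open>V\<close> and any form \<open>D\<close>
  of the derivative, so that derivatives of all spectral functions can later be expressed in one
  fixed eigenbasis.\<close>

theorem spectral_transfer:
  fixes a :: "('n::{finite,linorder}) rvec" and F :: "('n::{finite,linorder}) rvec \<Rightarrow> real"
  assumes sep: "\<And>x i j. x \<in> ball a r \<Longrightarrow> x $ i = x $ j \<Longrightarrow> a $ i = a $ j"
    and C2: "C2_dir (ball a r) F"
    and inv: "\<And>i j x. a $ i = a $ j \<Longrightarrow> x \<in> ball a r \<Longrightarrow> F (swapv i j x) = F x"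
  shows "C2_dir {X. eigvals (symm X) \<in> ball a r} (\<lambda>X. F (eigvals (symm X)))"
    and "\<And>X V D. eigvals (symm X) \<in> ball a r \<Longrightarrow> orthogonal_matrix V \<Longrightarrow> symm X = V ** diagm (eigvals (symm X)) ** transpose V \<Longrightarrow>
      (F has_derivative D) (at (eigvals (symm X))) \<Longrightarrow>
      ((\<lambda>X. F (eigvals (symm X))) has_derivative (\<lambda>E. D (\<chi> l. (transpose V ** symm E ** V) $ l $ l))) (at X)"
proof -
  from C2 obtain F' where F': "\<And>y. y \<in> ball a r \<Longrightarrow> (F has_derivative F' y) (at y)"
    and C1: "\<And>e. C1_dir (ball a r) (\<lambda>y. F' y e)" unfolding C2_dir_def by blast
  from C1 obtain D where D: "\<And>e y. y \<in> ball a r \<Longrightarrow> ((\<lambda>y. F' y e) has_derivative D e y) (at y)"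
    and cD: "\<And>e k. continuous_on (ball a r) (\<lambda>y. D e y k)"
    unfolding C1_dir_def by metis
  define g where "g y = (\<chi> i. F' y (axis i 1))" for y
  define h where "h y = (\<chi> i j. D (axis i 1) y (axis j 1))" for y
  have rep: "v = (\<Sum>i\<in>UNIV. v $ i *\<^sub>R axis i 1)" for v :: "'n rvec"
    by (simp add: vec_eq_iff axis_def if_distrib cong: if_cong)
  have lin: "L v = (\<Sum>i\<in>UNIV. v $ i * L (axis i 1))" if "bounded_linear L" for L :: "'n rvec \<Rightarrow> real" and v
    by (subst rep) (simp add: linear_sum linear_cmul bounded_linear.linear[OF that] linear_sum[OF bounded_linear.linear[OF that]] linear_cmul[OF bounded_linear.linear[OF that]])
  have Fg: "F' y = (\<lambda>v. g y \<bullet> v)" if "y \<in> ball a r" for y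
  proof
    fix v show "F' y v = g y \<bullet> v"
      by (subst lin[OF has_derivative_bounded_linear[OF F'[OF that]]]) (simp add: g_def inner_vec_def mult.commute)
  qed
  have gh: "(g has_derivative (\<lambda>v. h y *v v)) (at y)" if "y \<in> ball a r" for y
  proof -
    have e1: "((\<lambda>y. \<Sum>i\<in>UNIV. F' y (axis i 1) *\<^sub>R axis i (1::real)) has_derivative (\<lambda>v. \<Sum>i\<in>UNIV. D (axis i 1) y v *\<^sub>R axis i (1::real))) (at y)"
      by (intro has_derivative_sum has_derivative_scaleR_left D that)
    have e2: "(\<lambda>y. \<Sum>i\<in>UNIV. F' y (axis i 1) *\<^sub>R axis i 1) = g"
      unfolding g_def by (rule ext) (simp add: vec_eq_iff axis_def if_distrib cong: if_cong)
    have e3: "(\<lambda>v. \<Sum>i\<in>UNIV. D (axis i 1) y v *\<^sub>R axis i 1) = (\<lambda>v. h y *v v)"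
    proof
      fix v
      have "D e y v = (\<Sum>i\<in>UNIV. v $ i * D e y (axis i 1))" for e
        by (rule lin[OF has_derivative_bounded_linear[OF D[OF that]]])
      then show "(\<Sum>i\<in>UNIV. D (axis i 1) y v *\<^sub>R axis i 1) = h y *v v"
        unfolding h_def matrix_vector_mult_def
        by (simp only: vec_eq_iff sum_component vector_scaleR_component) (simp add: axis_def if_distrib mult.commute cong: if_cong)
    qed
    show ?thesis using e1 unfolding e2 e3 .
  qed
  have hc: "continuous_on (ball a r) h"
    unfolding h_def by (rule continuous_on_vec_lambda, rule continuous_on_vec_lambda, rule cD)
  interpret block_symmetric_function a r F g h
  proof
    show "a $ i = a $ j" if "x \<in> ball a r" "x $ i = x $ j" for x i j using sep that .
    show "(F has_derivative (\<lambda>v. g x \<bullet> v)) (at x)" if "x \<in> ball a r" for x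
      using F'[OF that] unfolding Fg[OF that] .
    show "(g has_derivative (*v) (h x)) (at x)" if "x \<in> ball a r" for x using gh[OF that] .
    show "F (swapv i j x) = F x" if "a $ i = a $ j" "x \<in> ball a r" for i j x using inv that .
  qed (rule hc)
  show "C2_dir {X. eigvals (symm X) \<in> ball a r} (\<lambda>X. F (eigvals (symm X)))" by (rule spectral_C2)
  fix X V D assume x: "eigvals (symm X) \<in> ball a r" and V: "orthogonal_matrix V" "symm X = V ** diagm (eigvals (symm X)) ** transpose V"
    and D: "(F has_derivative D) (at (eigvals (symm X)))"
  have "D = (\<lambda>v. g (eigvals (symm X)) \<bullet> v)"
    using has_derivative_unique[OF D F'[OF x]] .
  then show "((\<lambda>X. F (eigvals (symm X))) has_derivative (\<lambda>E. D (\<chi> l. (transpose V ** symm E ** V) $ l $ l))) (at X)"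
    using spectral_has_derivative[OF refl x V] by (simp only:)
qed

section \<open>Normal form of a locally symmetric manifold\<close>

lemma orthogonal_projection_exists:
  fixes S :: "'a::euclidean_space set"
  assumes S: "subspace S"
  obtains P where "bounded_linear P" "\<And>v. P v \<in> S" "\<And>v w. w \<in> S \<Longrightarrow> P v \<bullet> w = v \<bullet> w"
proof -
  obtain B where B: "B \<subseteq> S" "pairwise orthogonal B" "\<And>x. x \<in> B \<Longrightarrow> norm x = 1"
    "independent B" "span B = S" using orthonormal_basis_subspace[OF S] by metis
  have fin: "finite B" using B(4) by (rule independent_imp_finite)
  define P where "P v = (\<Sum>b\<in>B. (v \<bullet> b) *\<^sub>R b)" for v
  have "P v \<in> S" for v unfolding P_def using B(1) S by (intro subspace_sum subspace_scale) auto
  moreover have "bounded_linear P" unfolding P_def by (intro bounded_linear_intros)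
  moreover have "P v \<bullet> w = v \<bullet> w" if "w \<in> S" for v w
  proof -
    have "P v \<bullet> b = v \<bullet> b" if b: "b \<in> B" for b
    proof -
      have "P v \<bullet> b = (\<Sum>c\<in>B. if c = b then v \<bullet> b else 0)"
        unfolding P_def inner_sum_left
        by (rule sum.cong) (use B(2) B(3)[OF b] b in \<open>auto simp: pairwise_def orthogonal_def norm_eq_1\<close>)
      then show ?thesis using b fin by simp
    qed
    then have "orthogonal (P v - v) b" if "b \<in> B" for b using that by (simp add: orthogonal_def inner_diff_left)
    then have "orthogonal (P v - v) w" using orthogonal_to_span[of w B "P v - v"] \<open>w \<in> S\<close> B(5) by blast
    then show ?thesis by (simp add: orthogonal_def inner_diff_left)
  qed
  ultimately show ?thesis using that by blast
qed

lemma orthogonal_projection_eqI: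
  assumes "subspace S" "\<And>v. P v \<in> S" "\<And>v w. w \<in> S \<Longrightarrow> P v \<bullet> w = v \<bullet> w"
    and "u \<in> S" "\<And>w. w \<in> S \<Longrightarrow> u \<bullet> w = v \<bullet> w"
  shows "P v = u"
proof -
  have "P v - u \<in> S" using assms by (simp add: subspace_diff)
  then have "(P v - u) \<bullet> (P v - u) = 0" using assms(3,5) by (metis inner_diff_left right_minus_eq)
  then show ?thesis by simp
qed

text \<open>Composing the defining map with a left inverse of its derivative on the normal space
  turns that derivative into the projection along \<open>T\<close>. Adding the tangential coordinate
  gives a map with derivative the identity; its local inverse \<open>\<zeta>\<close> parametrizes
  \<open>M\<close> by tangent vectors.\<close>

lemma submanifold_chart:
  fixes M :: "'a::euclidean_space set"
  assumes M: "C2_submanifold_of UNIV M d" and a: "a \<in> M"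
  obtains T PT F0 U U' V \<zeta> where
    "subspace T" "dim T = d" "bounded_linear PT" "\<And>v. PT v \<in> T" "\<And>v w. w \<in> T \<Longrightarrow> PT v \<bullet> w = v \<bullet> w"
    "open U" "a \<in> U" "C2_dir U F0" "M \<inter> U = {y \<in> U. F0 y = 0}" "(F0 has_derivative (\<lambda>v. v - PT v)) (at a)"
    "open U'" "a \<in> U'" "U' \<subseteq> U" "open V" "0 \<in> V" "continuous_on V \<zeta>" "\<zeta> 0 = a" "(\<zeta> has_derivative (\<lambda>h. h)) (at 0)"
    "\<And>t. t \<in> T \<Longrightarrow> t \<in> V \<Longrightarrow> \<zeta> t \<in> M \<inter> U' \<and> PT (\<zeta> t - a) = t"
    "\<And>y. y \<in> M \<Longrightarrow> y \<in> U' \<Longrightarrow> PT (y - a) \<in> V \<and> \<zeta> (PT (y - a)) = y"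
proof -
  have "\<exists>U (W::'a set) (F::'a\<Rightarrow>'a) F'. open U \<and> a \<in> U \<and> subspace W \<and> dim W = dim (UNIV::'a set) - d \<and>
        C2_on U F \<and> (\<forall>y\<in>U. F y \<in> W) \<and> M \<inter> U = {y \<in> U \<inter> UNIV. F y = 0} \<and>
        (F has_derivative F') (at a) \<and> F' ` UNIV = W"
    using bspec[OF conjunct2[OF conjunct2[OF conjunct2[OF M[unfolded C2_submanifold_of_def]]]] a] .
  then obtain U and W :: "'a set" and F F' :: "'a \<Rightarrow> 'a" where *: "open U \<and> a \<in> U \<and> subspace W \<and> dim W = dim (UNIV::'a set) - d \<and>
        C2_on U F \<and> (\<forall>y\<in>U. F y \<in> W) \<and> M \<inter> U = {y \<in> U \<inter> UNIV. F y = 0} \<and>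
        (F has_derivative F') (at a) \<and> F' ` UNIV = W"
    by (elim exE) (rule that, assumption)
  then have U: "open U" "a \<in> U" and W: "subspace W" "dim W = DIM('a) - d"
    and F: "C2_on U F" "\<forall>y\<in>U. F y \<in> W" "M \<inter> U = {y \<in> U. F y = 0}"
    and F': "(F has_derivative F') (at a)" "range F' = W"
    by (simp_all add: dim_UNIV)
  have d: "d \<le> DIM('a)" using M unfolding C2_submanifold_of_def by (simp add: dim_UNIV)
  have blF': "bounded_linear F'" using F'(1) by (rule has_derivative_bounded_linear)
  then have linF': "linear F'" by (rule bounded_linear.linear)
  define T where "T = {v. F' v = 0}"
  have T: "subspace T" unfolding T_def using linF' by (rule linear_subspace_kernel)
  obtain PT where PT: "bounded_linear PT" "\<And>v. PT v \<in> T" "\<And>v w. w \<in> T \<Longrightarrow> PT v \<bullet> w = v \<bullet> w"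
    using orthogonal_projection_exists[OF T] by metis
  define N where "N = {v. \<forall>t\<in>T. t \<bullet> v = 0}"
  have N: "subspace N" unfolding N_def by (auto simp: subspace_def inner_add_right)
  have dec: "v - PT v \<in> N" for v
    unfolding N_def using PT(3) by (auto simp: inner_diff_right inner_commute)
  have inj: "inj_on F' N"
    unfolding linear_inj_on_iff_eq_0[OF linF' N]
  proof (intro ballI impI)
    fix v assume "v \<in> N" "F' v = 0"
    then have "v \<bullet> v = 0" unfolding N_def T_def by auto
    then show "v = 0" by simp
  qed
  obtain L where L: "range L \<subseteq> N" "linear L" "\<And>v. v \<in> N \<Longrightarrow> L (F' v) = v"
    using linear_exists_left_inverse_on[OF linF' N inj] by blast
  have LF': "L (F' v) = v - PT v" for v
  proof -
    have "F' (PT v) = 0" using PT(2)[of v] by (simp add: T_def)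
    then have "F' v = F' (v - PT v)" by (simp add: linear_diff[OF linF'])
    then show ?thesis using L(3)[OF dec] by simp
  qed
  have L0: "w = 0" if w: "w \<in> W" and 0: "L w = 0" for w
  proof -
    from w F'(2) obtain v where v: "w = F' v" by auto
    then have "v = PT v" using 0 LF'[of v] by simp
    then have "v \<in> T" using PT(2) by metis
    then show "w = 0" using v by (simp add: T_def)
  qed
  have "F' ` N = W"
  proof -
    have "F' v = F' (v - PT v)" for v
      using PT(2)[of v] linear_diff[OF linF', of v "PT v"] by (simp add: T_def)
    then have "range F' \<subseteq> F' ` N" using dec by blast
    then show ?thesis using F'(2) by blast
  qed
  then have "dim W = dim N"
    using dim_image_eq[OF linF', of N] inj N by (metis span_eq_iff)
  moreover have "dim N + dim T = DIM('a)"
    using dim_subspace_orthogonal_to_vectors[OF T subspace_UNIV] by (simp add: N_def orthogonal_def dim_UNIV)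
  ultimately have dT: "dim T = d" using W(2) d by simp
  define F0 where "F0 y = L (F y)" for y
  have blL: "bounded_linear L" using L(2) by (simp add: linear_conv_bounded_linear)
  have F0N: "F0 y \<in> N" for y using L(1) by (auto simp: F0_def)
  have C2: "C2_dir U F0" unfolding F0_def
    by (rule C2_dir_linear_comp[OF blL]) (use F(1) C2_on_iff_C2_dir[OF U(1)] in blast)
  have MU: "M \<inter> U = {y \<in> U. F0 y = 0}"
    using F(2,3) L0 linear_0[OF L(2)] by (auto simp: F0_def)
  have dF0: "(F0 has_derivative (\<lambda>v. v - PT v)) (at a)"
    unfolding F0_def using bounded_linear.has_derivative[OF blL F'(1)] by (simp add: LF')
  define \<Psi> where "\<Psi> y = PT (y - a) + F0 y" for y
  have lPT: "linear PT" using PT(1) by (rule bounded_linear.linear)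
  have "C2_dir U (\<lambda>y. PT y - PT a + F0 y)"
    by (intro C2_dir_add C2_dir_diff C2_dir_bounded_linear PT(1) C2 C2_dir_const)
  then have C2\<Psi>: "C2_dir U \<Psi>" by (simp add: \<Psi>_def[abs_def] linear_diff[OF lPT])
  obtain \<Psi>' where \<Psi>': "\<And>y. y \<in> U \<Longrightarrow> (\<Psi> has_derivative blinfun_apply (\<Psi>' y)) (at y)" "continuous_on U \<Psi>'"
    using C2_dir_obtain_blinfun[OF U(1) C2\<Psi>] by metis
  have "(\<Psi> has_derivative (\<lambda>v. PT (v - 0) + (v - PT v))) (at a)"
    unfolding \<Psi>_def by (intro has_derivative_add bounded_linear.has_derivative[OF PT(1)] has_derivative_diff has_derivative_ident has_derivative_const dF0)
  then have "(\<Psi> has_derivative (\<lambda>v. v)) (at a)" by simp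
  then have "blinfun_apply (\<Psi>' a) = (\<lambda>v. v)" using \<Psi>'(1)[OF U(2)] has_derivative_unique by blast
  then have id: "\<Psi>' a = id_blinfun" by (intro blinfun_eqI) simp
  have a0: "\<Psi> a = 0" using a U(2) MU linear_0[OF lPT] by (auto simp: \<Psi>_def)
  obtain U' V \<zeta> \<zeta>' where U': "open U'" "U' \<subseteq> U" "a \<in> U'" and V: "open V" "\<Psi> a \<in> V" and hom: "homeomorphism U' V \<Psi> \<zeta>"
    and d\<zeta>: "\<And>y. y \<in> V \<Longrightarrow> (\<zeta> has_derivative (\<zeta>' y)) (at y)" "\<And>y. y \<in> V \<Longrightarrow> \<zeta>' y = inv (blinfun_apply (\<Psi>' (\<zeta> y)))"
    by (rule inverse_function_theorem[OF U(1) \<Psi>' U(2), of id_blinfun]) (auto simp: id intro!: blinfun_eqI)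
  have \<zeta>0: "\<zeta> 0 = a" using hom U'(3) a0 unfolding homeomorphism_def by metis
  have V0: "0 \<in> V" using V a0 by simp
  have d\<zeta>0: "(\<zeta> has_derivative (\<lambda>h. h)) (at 0)"
  proof -
    have "\<zeta>' 0 = inv (\<lambda>v. v)" using d\<zeta>(2)[OF V0] by (simp add: \<zeta>0 id)
    also have "\<dots> = (\<lambda>v. v)" using inv_id by (simp add: id_def)
    finally show ?thesis using d\<zeta>(1)[OF V0] by simp
  qed
  \<comment> \<open>\<open>F0 (\<zeta> t)\<close> is normal, but it is also a difference of two
    tangent vectors; being orthogonal to itself, it vanishes.\<close>
  have c1: "\<zeta> t \<in> M \<inter> U' \<and> PT (\<zeta> t - a) = t" if "t \<in> T" "t \<in> V" for t
  proof -
    have z: "\<zeta> t \<in> U'" "\<Psi> (\<zeta> t) = t" using hom that(2) unfolding homeomorphism_def by auto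
    have "F0 (\<zeta> t) = t - PT (\<zeta> t - a)" using z(2) by (simp add: \<Psi>_def algebra_simps)
    then have "F0 (\<zeta> t) \<bullet> F0 (\<zeta> t) = (t - PT (\<zeta> t - a)) \<bullet> F0 (\<zeta> t)" by (rule arg_cong)
    also have "\<dots> = 0" using F0N[of "\<zeta> t"] subspace_diff[OF T that(1) PT(2)] by (auto simp: N_def)
    finally have "F0 (\<zeta> t) = 0" by simp
    then show ?thesis using z U'(2) MU by (auto simp: \<Psi>_def)
  qed
  have c2: "PT (y - a) \<in> V \<and> \<zeta> (PT (y - a)) = y" if "y \<in> M" "y \<in> U'" for y
  proof -
    have "F0 y = 0" using that U'(2) MU by blast
    then have "\<Psi> y = PT (y - a)" by (simp add: \<Psi>_def)
    then show ?thesis using hom that(2) unfolding homeomorphism_def by (metis imageI)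
  qed
  have "continuous_on V \<zeta>" using hom unfolding homeomorphism_def by blast
  then show ?thesis
    using that[OF T dT PT U C2 MU dF0 U'(1,3,2) V(1) V0 _ \<zeta>0 d\<zeta>0 c1 c2] by blast
qed

section \<open>The permutation action and coincidences of coordinates\<close>

lemma perm_act_linear: "bounded_linear (perm_act \<sigma>)"
  unfolding linear_conv_bounded_linear[symmetric]
  by (rule linearI) (simp_all add: vec_eq_iff perm_act_def)

lemma inner_perm_act:
  assumes "\<sigma> permutes UNIV"
  shows "perm_act \<sigma> x \<bullet> perm_act \<sigma> y = x \<bullet> y"
  unfolding inner_vec_def perm_act_def
  using sum.reindex_bij_betw[OF permutes_bij[OF permutes_inv[OF assms]], of "\<lambda>k. x $ k \<bullet> y $ k"] by simp

lemma dist_perm_act: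
  assumes "\<sigma> permutes UNIV"
  shows "dist (perm_act \<sigma> x) (perm_act \<sigma> y) = dist x y"
proof -
  have "perm_act \<sigma> x - perm_act \<sigma> y = perm_act \<sigma> (x - y)" by (simp add: vec_eq_iff perm_act_def)
  then show ?thesis by (simp add: dist_norm norm_eq_sqrt_inner inner_perm_act[OF assms])
qed

lemma perm_act_compose:
  assumes "\<sigma> permutes UNIV" "\<tau> permutes UNIV"
  shows "perm_act \<sigma> (perm_act \<tau> x) = perm_act (\<sigma> \<circ> \<tau>) x"
  using assms by (simp add: perm_act_def vec_eq_iff o_inv_distrib permutes_bij)

lemma swapv_eq_perm_act: "swapv i j x = perm_act (Transposition.transpose i j) x"
  by (simp add: swapv_def perm_act_def inv_transpose_eq)

text \<open>Coincidences that persist along \<open>M\<close> near \<open>y\<close>. Unlike the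
  coincidences at the single point \<open>y\<close>, they will turn out to be locally constant along
  a locally symmetric manifold.\<close>

definition coincide :: "(real^'n::finite) set \<Rightarrow> real^'n \<Rightarrow> ('n \<times> 'n) set" where
  "coincide M y = {(i, j). \<exists>\<epsilon>>0. \<forall>z\<in>M \<inter> ball y \<epsilon>. z $ i = z $ j}"

lemma separating_radius_exists:
  fixes a :: "real^'n::finite"
  obtains r where "r > 0" "\<And>x i j. x \<in> ball a r \<Longrightarrow> x $ i = x $ j \<Longrightarrow> a $ i = a $ j"
proof -
  \<comment> \<open>Half of the smallest gap between distinct coordinates, so two of them cannot
    meet in the ball; the inserted 1 keeps \<open>Min\<close> meaningful when all coordinates are
    equal.\<close>
  define D where "D = insert 1 ((\<lambda>(i, j). \<bar>a $ i - a $ j\<bar> / 2) ` {(i, j). a $ i \<noteq> a $ j})"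
  have fin: "finite D" unfolding D_def by simp
  have pos: "Min D > 0" using fin by (subst Min_gr_iff) (auto simp: D_def)
  show ?thesis
  proof (rule that[OF pos])
    fix x i j assume x: "x \<in> ball a (Min D)" and xij: "x $ i = x $ j"
    show "a $ i = a $ j"
    proof (rule ccontr)
      assume ne: "a $ i \<noteq> a $ j"
      then have m: "Min D \<le> \<bar>a $ i - a $ j\<bar> / 2" using fin by (intro Min_le) (auto simp: D_def image_iff)
      have b: "\<bar>a $ k - x $ k\<bar> < Min D" for k
        using x component_le_norm_cart[of "a - x" k] by (simp add: dist_norm)
      have "\<bar>a $ i - a $ j\<bar> < Min D + Min D"
        using xij b[of i] b[of j] by (simp add: abs_if split: if_splits)
      then show False using m by simp
    qed
  qed
qed


text \<open>\<open>R\<close> is read off from the tangent space at \<open>a\<close>, while the last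
  conclusion identifies it with coincidences seen from every nearby point of \<open>M\<close>; that
  is what allows comparison between different base points. The remaining conclusions are the data
  needed for the lift to matrices.\<close>

lemma local_normal_form:
  fixes M :: "('n::{finite,linorder}) rvec set"
  assumes M: "C2_submanifold_of UNIV M d" and sym: "locally_symmetric M" and a: "a \<in> M"
  obtains T R S P \<Phi> \<delta> where "\<delta> > 0" "subspace T" "dim T = d"
    "R = {(i, j). a $ i = a $ j \<and> (\<forall>t\<in>T. t $ i = t $ j)}"
    "S = {w. (\<forall>i j. (i, j) \<in> R \<longrightarrow> w $ i = w $ j) \<and> (\<forall>t\<in>T. t \<bullet> w = 0)}"
    "\<And>i j p. (i, j) \<in> R \<Longrightarrow> i \<noteq> j \<Longrightarrow> a $ p = a $ i \<Longrightarrow> (p, i) \<in> R"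
    "\<And>x i j. x \<in> ball a \<delta> \<Longrightarrow> x $ i = x $ j \<Longrightarrow> a $ i = a $ j"
    "bounded_linear P" "\<And>v. P v \<in> S" "\<And>v w. w \<in> S \<Longrightarrow> P v \<bullet> w = v \<bullet> w"
    "C2_dir (ball a \<delta>) \<Phi>" "\<And>y. \<Phi> y \<in> S" "(\<Phi> has_derivative P) (at a)"
    "\<And>i j y. a $ i = a $ j \<Longrightarrow> \<Phi> (swapv i j y) = \<Phi> y"
    "M \<inter> ball a \<delta> = {y \<in> ball a \<delta>. (\<forall>i j. (i, j) \<in> R \<longrightarrow> y $ i = y $ j) \<and> \<Phi> y = 0}"
    "\<And>y. y \<in> M \<Longrightarrow> y \<in> ball a \<delta> \<Longrightarrow> coincide M y = R"
proof -
  obtain T PT F0 U U' V \<zeta> where T: "subspace T" "dim T = d"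
    and PT: "bounded_linear PT" "\<And>v. PT v \<in> T" "\<And>v w. w \<in> T \<Longrightarrow> PT v \<bullet> w = v \<bullet> w"
    and U: "open U" "a \<in> U" and C2F0: "C2_dir U F0" and MU: "M \<inter> U = {y \<in> U. F0 y = 0}"
    and dF0: "(F0 has_derivative (\<lambda>v. v - PT v)) (at a)"
    and U': "open U'" "a \<in> U'" "U' \<subseteq> U" and V: "open V" "0 \<in> V"
    and \<zeta>: "continuous_on V \<zeta>" "\<zeta> 0 = a" "(\<zeta> has_derivative (\<lambda>h. h)) (at 0)"
    and c1: "\<And>t. t \<in> T \<Longrightarrow> t \<in> V \<Longrightarrow> \<zeta> t \<in> M \<inter> U' \<and> PT (\<zeta> t - a) = t"
    and c2: "\<And>y. y \<in> M \<Longrightarrow> y \<in> U' \<Longrightarrow> PT (y - a) \<in> V \<and> \<zeta> (PT (y - a)) = y"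
    by (rule submanifold_chart[OF M a]) blast
  note lPT = bounded_linear.linear[OF PT(1)]
  have PT_eqI: "PT v = u" if "u \<in> T" "\<And>w. w \<in> T \<Longrightarrow> u \<bullet> w = v \<bullet> w" for u v
    by (rule orthogonal_projection_eqI[OF T(1), of PT]) (fact PT that)+
  define G where "G = {\<sigma>. \<sigma> permutes (UNIV :: 'n set) \<and> perm_act \<sigma> a = a}"
  have finG: "finite G" unfolding G_def by (rule finite_subset[OF _ finite_permutations[of UNIV]]) auto
  have idG: "id \<in> G" unfolding G_def by (simp add: permutes_id perm_act_def vec_eq_iff)
  then have cardG: "card G > 0" using finG by (auto simp: card_gt_0_iff)
  obtain \<delta>1 where \<delta>1: "\<delta>1 > 0" "\<And>\<sigma>. \<sigma> \<in> G \<Longrightarrow> perm_act \<sigma> ` (M \<inter> ball a \<delta>1) = M \<inter> ball a \<delta>1"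
  proof -
    obtain e where e: "e > 0" "\<forall>y\<in>M \<inter> ball a e. \<forall>\<sigma>. \<sigma> permutes UNIV \<and> perm_act \<sigma> y = y \<longrightarrow>
        perm_act \<sigma> ` (M \<inter> ball a e) = M \<inter> ball a e"
      using sym a unfolding locally_symmetric_def by meson
    have "a \<in> M \<inter> ball a e" using a e(1) by simp
    with e(2) have "perm_act \<sigma> ` (M \<inter> ball a e) = M \<inter> ball a e" if "\<sigma> \<in> G" for \<sigma>
      using that unfolding G_def by blast
    with e(1) that show ?thesis by blast
  qed
  have swapG: "Transposition.transpose i j \<in> G" if "a $ i = a $ j" for i j
    using swapv_fixed[OF that] unfolding G_def swapv_eq_perm_act by (simp add: permutes_swap_id)
  have ballG: "perm_act \<sigma> y \<in> ball a r" if "\<sigma> \<in> G" "y \<in> ball a r" for \<sigma> y r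
    using that dist_perm_act[of \<sigma> a y] by (auto simp: G_def)
  have MG: "perm_act \<sigma> y \<in> M" if "\<sigma> \<in> G" "y \<in> M" "y \<in> ball a \<delta>1" for \<sigma> y
    using \<delta>1(2)[OF that(1)] that(2,3) by blast
  have Mswap: "swapv i j y \<in> M" if "a $ i = a $ j" "y \<in> M" "y \<in> ball a \<delta>1" for i j y
    using MG[OF swapG[OF that(1)] that(2,3)] by (simp add: swapv_eq_perm_act)

  \<comment> \<open>Take a curve in \<open>M\<close> through \<open>a\<close> with velocity
    \<open>t\<close>. Its swapped image stays in \<open>M\<close>, so \<open>F0\<close> vanishes
    along it, and differentiating at 0 shows that \<open>swapv i j t\<close> has no normal
    part.\<close>
  have Tswap: "swapv i j t \<in> T" if aij: "a $ i = a $ j" and t: "t \<in> T" for i j t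
  proof -
    define c where "c s = \<zeta> (s *\<^sub>R t)" for s :: real
    have dc: "(c has_derivative (\<lambda>s. s *\<^sub>R t)) (at 0)"
    proof -
      have "((\<lambda>s. s *\<^sub>R t) has_derivative (\<lambda>s. s *\<^sub>R t)) (at 0)"
        by (rule bounded_linear_imp_has_derivative) (rule bounded_linear_scaleR_left)
      from has_derivative_compose[OF this, of \<zeta> "\<lambda>h. h"] \<zeta>(3) show ?thesis by (simp add: c_def[abs_def])
    qed
    have c0: "c 0 = a" by (simp add: c_def \<zeta>(2))
    have sa: "swapv i j a = a" by (rule swapv_fixed[OF aij])
    from bounded_linear.has_derivative[OF swapv_linear dc]
    have "((\<lambda>s. swapv i j (c s)) has_derivative (\<lambda>s. swapv i j (s *\<^sub>R t))) (at 0)" .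
    from has_derivative_compose[OF this, of F0 "\<lambda>v. v - PT v"] dF0
    have d1: "((\<lambda>s. F0 (swapv i j (c s))) has_derivative (\<lambda>s. swapv i j (s *\<^sub>R t) - PT (swapv i j (s *\<^sub>R t)))) (at 0)"
      by (simp add: c0 sa)
    have contc: "isCont c 0" using dc by (rule has_derivative_continuous)
    have conts: "isCont (\<lambda>s. swapv i j (c s)) 0"
      using contc by (rule bounded_linear.isCont[OF swapv_linear])
    have "eventually (\<lambda>s. s *\<^sub>R t \<in> V) (nhds 0)"
    proof -
      have "((\<lambda>s::real. s *\<^sub>R t) \<longlongrightarrow> 0 *\<^sub>R t) (nhds 0)" by (intro tendsto_intros filterlim_ident)
      then show ?thesis by (rule topological_tendstoD) (use V in auto)
    qed
    moreover have "eventually (\<lambda>s. c s \<in> ball a \<delta>1) (nhds 0)"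
    proof -
      have "(c \<longlongrightarrow> c 0) (nhds 0)" using contc by (simp add: isCont_def tendsto_nhds_iff)
      then show ?thesis by (rule topological_tendstoD) (use \<delta>1 c0 in auto)
    qed
    moreover have "eventually (\<lambda>s. swapv i j (c s) \<in> U) (nhds 0)"
    proof -
      have "((\<lambda>s. swapv i j (c s)) \<longlongrightarrow> swapv i j (c 0)) (nhds 0)" using conts by (simp add: isCont_def tendsto_nhds_iff)
      then show ?thesis by (rule topological_tendstoD) (use U c0 sa in auto)
    qed
    ultimately have "eventually (\<lambda>s. F0 (swapv i j (c s)) = 0) (nhds 0)"
    proof eventually_elim
      case (elim s)
      have "c s \<in> M" using c1[of "s *\<^sub>R t"] subspace_scale[OF T(1) t] elim(1) by (simp add: c_def)
      then have "swapv i j (c s) \<in> M" using Mswap[OF aij] elim(2) by blast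
      then show ?case using elim(3) MU by blast
    qed
    then obtain Z where Z: "open Z" "0 \<in> Z" "\<And>s. s \<in> Z \<Longrightarrow> F0 (swapv i j (c s)) = 0"
      unfolding eventually_nhds by blast
    have "((\<lambda>s. F0 (swapv i j (c s))) has_derivative (\<lambda>s. 0)) (at 0)"
      by (rule has_derivative_transform_within_open[OF has_derivative_const Z(1,2)]) (use Z(3) in auto)
    from has_derivative_unique[OF d1 this]
    have "swapv i j (1 *\<^sub>R t) - PT (swapv i j (1 *\<^sub>R t)) = 0" by metis
    then show ?thesis using PT(2) by (metis right_minus_eq scaleR_one)
  qed
  \<comment> \<open>A tangent vector minus its swap is a multiple of this difference of unit
    vectors.\<close>
  have Taxis: "axis i 1 - axis j 1 \<in> T" if "a $ i = a $ j" "t \<in> T" "t $ i \<noteq> t $ j" for i j t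
  proof -
    have "t - swapv i j t = (t $ i - t $ j) *\<^sub>R (axis i 1 - axis j 1)"
      using that(3) by (auto simp: vec_eq_iff swapv_component axis_def Transposition.transpose_def)
    then have "axis i 1 - axis j 1 = (1 / (t $ i - t $ j)) *\<^sub>R (t - swapv i j t)" using that(3) by simp
    also have "\<dots> \<in> T" using Tswap[OF that(1,2)] that(2) T(1) by (simp add: subspace_scale subspace_diff)
    finally show ?thesis .
  qed
  define R where "R = {(i, j). a $ i = a $ j \<and> (\<forall>t\<in>T. t $ i = t $ j)}"
  have Raxis: "axis i 1 - axis j 1 \<in> T" if "a $ i = a $ j" "(i, j) \<notin> R" for i j
    using that Taxis[OF that(1)] by (auto simp: R_def)
  \<comment> \<open>Otherwise \<open>axis p 1 - axis i 1\<close> is tangent. Swapping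
    \<open>p\<close> with \<open>j\<close> makes \<open>axis j 1 - axis i 1\<close> tangent, which
    contradicts \<open>(i, j) \<in> R\<close>.\<close>
  have block: "(p, i) \<in> R" if "(i, j) \<in> R" "i \<noteq> j" "a $ p = a $ i" for i j p
  proof (rule ccontr)
    assume n: "(p, i) \<notin> R"
    then have "p \<noteq> i" by (auto simp: R_def)
    have "p \<noteq> j" using n that(1) by (auto simp: R_def)
    have "a $ p = a $ j" using that by (auto simp: R_def)
    from Tswap[OF this Raxis[OF that(3) n]]
    have "axis j 1 - axis i 1 \<in> T"
    proof -
      have "swapv p j (axis p 1 - axis i 1) = axis j 1 - axis i 1"
        using \<open>p \<noteq> i\<close> \<open>p \<noteq> j\<close> that(2) by (auto simp: vec_eq_iff swapv_component axis_def Transposition.transpose_def)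
      with \<open>swapv p j (axis p 1 - axis i 1) \<in> T\<close> show ?thesis by simp
    qed
    then have "(axis j 1 - axis i 1 :: 'n rvec) $ i = (axis j 1 - axis i 1) $ j"
      using that(1) by (auto simp: R_def)
    then show False using that(2) by (simp add: axis_def)
  qed
  define S where "S = {w. (\<forall>i j. (i, j) \<in> R \<longrightarrow> w $ i = w $ j) \<and> (\<forall>t\<in>T. t \<bullet> w = 0)}"
  have S: "subspace S" unfolding S_def by (auto simp: subspace_def inner_add_right)
  \<comment> \<open>Pairs outside \<open>R\<close> are covered too: there
    \<open>axis i 1 - axis j 1\<close> is tangent and hence orthogonal to \<open>w\<close>. So every
    vector of \<open>S\<close> is fixed by the stabilizer of \<open>a\<close>.\<close>
  have Sconst: "w $ i = w $ j" if "w \<in> S" "a $ i = a $ j" for w i j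
  proof (cases "(i, j) \<in> R")
    case False
    then have "(axis i 1 - axis j 1) \<bullet> w = 0" using Raxis that by (auto simp: S_def)
    then show ?thesis by (simp add: inner_diff_left inner_axis_axis inner_axis' )
  qed (use that in \<open>auto simp: S_def\<close>)
  have SG: "perm_act \<sigma> w = w" if "w \<in> S" "\<sigma> \<in> G" for w \<sigma>
  proof -
    have "w $ inv \<sigma> k = w $ k" for k
    proof (rule Sconst[OF that(1)])
      have "perm_act \<sigma> a $ k = a $ k" using that(2) by (simp add: G_def)
      then show "a $ inv \<sigma> k = a $ k" by (simp add: perm_act_def)
    qed
    then show ?thesis by (simp add: perm_act_def vec_eq_iff)
  qed
  obtain P where P: "bounded_linear P" "\<And>v. P v \<in> S" "\<And>v w. w \<in> S \<Longrightarrow> P v \<bullet> w = v \<bullet> w"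
    using orthogonal_projection_exists[OF S] by metis
  note lP = bounded_linear.linear[OF P(1)]
  have P_eqI: "P v = u" if "u \<in> S" "\<And>w. w \<in> S \<Longrightarrow> u \<bullet> w = v \<bullet> w" for u v
    by (rule orthogonal_projection_eqI[OF S, of P]) (fact P that)+
  have PG: "P (perm_act \<sigma> v) = P v" if "\<sigma> \<in> G" for \<sigma> v
  proof (rule P_eqI)
    fix w assume w: "w \<in> S"
    have "perm_act \<sigma> v \<bullet> w = perm_act \<sigma> v \<bullet> perm_act \<sigma> w" using SG[OF w that] by simp
    also have "\<dots> = v \<bullet> w" using that inner_perm_act by (auto simp: G_def)
    finally show "P v \<bullet> w = perm_act \<sigma> v \<bullet> w" using P(3)[OF w] by simp
  qed (rule P(2))
  have PPT: "P (PT v) = 0" for v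
    by (rule P_eqI) (use subspace_0[OF S] PT(2)[of v] in \<open>auto simp: S_def\<close>)
  have P_id: "P w = w" if "w \<in> S" for w by (rule P_eqI) (use that in auto)

  \<comment> \<open>The projection to \<open>S\<close> discards what the equalities in
    \<open>R\<close> already express. Since \<open>G\<close> fixes the vectors of \<open>S\<close>,
    averaging makes the map invariant without changing its derivative \<open>P\<close> at
    \<open>a\<close>.\<close>
  define \<Phi> where "\<Phi> y = (1 / real (card G)) *\<^sub>R (\<Sum>\<sigma>\<in>G. P (F0 (perm_act \<sigma> y)))" for y
  have \<Phi>S: "\<Phi> y \<in> S" for y unfolding \<Phi>_def using S P(2) by (intro subspace_scale subspace_sum) auto
  have \<Phi>swap: "\<Phi> (swapv i j y) = \<Phi> y" if aij: "a $ i = a $ j" for i j y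
  proof -
    let ?\<tau> = "Transposition.transpose i j"
    have \<tau>: "?\<tau> permutes UNIV" by (simp add: permutes_swap_id)
    have closed: "\<sigma> \<circ> ?\<tau> \<in> G" if "\<sigma> \<in> G" for \<sigma>
    proof -
      have \<sigma>: "\<sigma> permutes UNIV" "perm_act \<sigma> a = a" using that by (auto simp: G_def)
      have "perm_act (\<sigma> \<circ> ?\<tau>) a = perm_act \<sigma> (perm_act ?\<tau> a)"
        using perm_act_compose[OF \<sigma>(1) \<tau>] by simp
      also have "\<dots> = a" using swapG[OF aij] \<sigma> by (simp add: G_def)
      finally show ?thesis using permutes_compose[OF \<tau> \<sigma>(1)] by (simp add: G_def)
    qed
    have "bij_betw (\<lambda>\<sigma>. \<sigma> \<circ> ?\<tau>) G G"
      by (rule bij_betw_byWitness[where f' = "\<lambda>\<sigma>. \<sigma> \<circ> ?\<tau>"]) (use closed in \<open>auto simp: o_assoc[symmetric]\<close>)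
    then have "(\<Sum>\<sigma>\<in>G. P (F0 (perm_act (\<sigma> \<circ> ?\<tau>) y))) = (\<Sum>\<sigma>\<in>G. P (F0 (perm_act \<sigma> y)))"
      by (rule sum.reindex_bij_betw)
    moreover have "(\<Sum>\<sigma>\<in>G. P (F0 (perm_act \<sigma> (swapv i j y)))) = (\<Sum>\<sigma>\<in>G. P (F0 (perm_act (\<sigma> \<circ> ?\<tau>) y)))"
      by (rule sum.cong) (use perm_act_compose[OF _ \<tau>] in \<open>auto simp: swapv_eq_perm_act G_def\<close>)
    ultimately show ?thesis by (simp add: \<Phi>_def)
  qed
  have C2\<Phi>: "C2_dir (ball a r) \<Phi>" if "ball a r \<subseteq> U" for r
  proof -
    have "C2_dir (ball a r) (\<lambda>y. P (F0 (perm_act \<sigma> y)))" if "\<sigma> \<in> G" for \<sigma>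
      by (intro C2_dir_linear_comp[OF P(1)] C2_dir_precomp_linear[OF perm_act_linear C2F0])
        (use ballG[OF that] \<open>ball a r \<subseteq> U\<close> in blast)
    then show ?thesis unfolding \<Phi>_def
      by (intro C2_dir_linear_comp[OF bounded_linear_scaleR_right] C2_dir_sum)
  qed
  have d\<Phi>: "(\<Phi> has_derivative P) (at a)"
  proof -
    have "((\<lambda>y. P (F0 (perm_act \<sigma> y))) has_derivative P) (at a)" if "\<sigma> \<in> G" for \<sigma>
    proof -
      have "(F0 has_derivative (\<lambda>v. v - PT v)) (at (perm_act \<sigma> a))" using dF0 that by (simp add: G_def)
      from bounded_linear.has_derivative[OF P(1) has_derivative_compose[OF bounded_linear_imp_has_derivative[OF perm_act_linear] this]]
      show ?thesis by (simp add: linear_diff[OF lP] PPT PG[OF that])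
    qed
    then have "(\<Phi> has_derivative (\<lambda>v. (1 / real (card G)) *\<^sub>R (\<Sum>\<sigma>\<in>G. P v))) (at a)"
      unfolding \<Phi>_def by (intro has_derivative_scaleR_right has_derivative_sum)
    moreover have "(\<lambda>v. (1 / real (card G)) *\<^sub>R (\<Sum>\<sigma>\<in>G. P v)) = P"
      using cardG by (simp only: sum_constant_scaleR) (auto simp: fun_eq_iff)
    ultimately show ?thesis by (simp only:)
  qed
  \<comment> \<open>Replacing the \<open>S\<close>-component of \<open>y - a\<close> by
    \<open>\<Phi> y\<close> keeps the derivative at \<open>a\<close> equal to the identity, so
    \<open>\<Psi>\<close> is injective near \<open>a\<close>.\<close>
  define \<Psi> where "\<Psi> y = (y - a) - P (y - a) + \<Phi> y" for y
  obtain \<rho>0 where \<rho>0: "\<rho>0 > 0" "ball a \<rho>0 \<subseteq> U" using U open_contains_ball by blast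
  obtain U2 where U2: "open U2" "a \<in> U2" "inj_on \<Psi> U2"
  proof -
    have "C2_dir (ball a \<rho>0) (\<lambda>y. (y - a) - (P y - P a) + \<Phi> y)"
      by (intro C2_dir_add C2_dir_diff C2_dir_bounded_linear P(1) C2_dir_const C2\<Phi> \<rho>0 bounded_linear_ident)
    then have "C2_dir (ball a \<rho>0) \<Psi>" by (simp add: \<Psi>_def[abs_def] linear_diff[OF lP])
    from C2_dir_obtain_blinfun[OF open_ball this]
    obtain \<Psi>' where \<Psi>': "\<And>y. y \<in> ball a \<rho>0 \<Longrightarrow> (\<Psi> has_derivative blinfun_apply (\<Psi>' y)) (at y)" "continuous_on (ball a \<rho>0) \<Psi>'"
      by metis
    have a0: "a \<in> ball a \<rho>0" using \<rho>0 by simp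
    have "(\<Psi> has_derivative (\<lambda>v. (v - 0) - P (v - 0) + P v)) (at a)"
      unfolding \<Psi>_def by (intro has_derivative_add bounded_linear.has_derivative[OF P(1)] has_derivative_diff has_derivative_ident has_derivative_const d\<Phi>)
    then have "(\<Psi> has_derivative (\<lambda>v. v)) (at a)" by simp
    then have "blinfun_apply (\<Psi>' a) = (\<lambda>v. v)" using \<Psi>'(1)[OF a0] has_derivative_unique by blast
    then have id: "\<Psi>' a = id_blinfun" by (intro blinfun_eqI) simp
    obtain U2 V2 \<xi> where "open U2" "a \<in> U2" "homeomorphism U2 V2 \<Psi> \<xi>"
      by (rule inverse_function_theorem[OF open_ball \<Psi>' a0, of id_blinfun]) (auto simp: id intro!: blinfun_eqI)
    moreover from this(3) have "inj_on \<Psi> U2" unfolding homeomorphism_def by (metis inj_onI)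
    ultimately show ?thesis using that by blast
  qed
  obtain \<rho>s where \<rho>s: "\<rho>s > 0" "\<And>x i j. x \<in> ball a \<rho>s \<Longrightarrow> x $ i = x $ j \<Longrightarrow> a $ i = a $ j"
    using separating_radius_exists by metis
  obtain \<rho>1 where \<rho>1: "\<rho>1 > 0" "ball a \<rho>1 \<subseteq> U' \<inter> U2 \<inter> ball a \<delta>1 \<inter> ball a \<rho>s"
  proof -
    have "open (U' \<inter> U2 \<inter> ball a \<delta>1 \<inter> ball a \<rho>s)" "a \<in> U' \<inter> U2 \<inter> ball a \<delta>1 \<inter> ball a \<rho>s"
      using U' U2 \<delta>1 \<rho>s by auto
    then show ?thesis using that open_contains_ball by blast
  qed
  have \<rho>U: "ball a \<rho>1 \<subseteq> U" using \<rho>1(2) U'(3) by blast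
  \<comment> \<open>Tangent vectors agree at \<open>i\<close> and \<open>j\<close>, so
    \<open>y\<close> and its swap have the same tangential coordinate; a point of \<open>M\<close>
    near \<open>a\<close> is determined by that coordinate.\<close>
  have MC: "y $ i = y $ j" if y: "y \<in> M" "y \<in> ball a \<rho>1" and ij: "(i, j) \<in> R" for y i j
  proof -
    have aij: "a $ i = a $ j" using ij by (simp add: R_def)
    have sM: "swapv i j y \<in> M" using Mswap[OF aij y(1)] y(2) \<rho>1(2) by blast
    have sB: "swapv i j y \<in> ball a \<rho>1" using swapv_ball[OF aij] y(2) by blast
    have "PT (swapv i j y - a) = PT (y - a)"
    proof (rule PT_eqI)
      fix w assume w: "w \<in> T"
      then have sw: "swapv i j w = w" using ij by (intro swapv_fixed) (auto simp: R_def)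
      have "(swapv i j y - a) \<bullet> w = swapv i j y \<bullet> swapv i j w - a \<bullet> w" by (simp add: sw inner_diff_left)
      then have "(swapv i j y - a) \<bullet> w = (y - a) \<bullet> w" by (simp only: inner_swapv inner_diff_left)
      then show "PT (y - a) \<bullet> w = (swapv i j y - a) \<bullet> w" using PT(3)[OF w] by simp
    qed (rule PT(2))
    then have "swapv i j y = y" using c2[OF sM] c2[OF y(1)] sB y(2) \<rho>1(2) by (metis IntD1 subsetD)
    then have "swapv i j y $ i = y $ i" by simp
    then show ?thesis by (simp add: swapv_component)
  qed
  have M\<Phi>: "\<Phi> y = 0" if y: "y \<in> M" "y \<in> ball a \<rho>1" for y
  proof -
    have "F0 (perm_act \<sigma> y) = 0" if "\<sigma> \<in> G" for \<sigma>
      using MG[OF that y(1)] ballG[OF that y(2)] y(2) \<rho>1(2) \<rho>U MU by blast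
    then show ?thesis by (simp add: \<Phi>_def linear_0[OF lP])
  qed
  have lim0: "((\<lambda>y. \<zeta> (PT (y - a))) \<longlongrightarrow> \<zeta> (PT (a - a))) (nhds a)"
  proof -
    have "isCont \<zeta> (PT (a - a))" using \<zeta>(1) V by (simp add: linear_0[OF lPT] continuous_on_eq_continuous_at)
    moreover have "((\<lambda>y. PT (y - a)) \<longlongrightarrow> PT (a - a)) (nhds a)"
      by (intro bounded_linear.tendsto[OF PT(1)] tendsto_intros filterlim_ident)
    ultimately show ?thesis by (rule isCont_tendsto_compose)
  qed
  have "eventually (\<lambda>y. PT (y - a) \<in> V \<and> \<zeta> (PT (y - a)) \<in> ball a \<rho>1 \<and> y \<in> ball a \<rho>1) (nhds a)"
  proof (intro eventually_conj)
    have "((\<lambda>y. PT (y - a)) \<longlongrightarrow> PT (a - a)) (nhds a)"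
      by (intro bounded_linear.tendsto[OF PT(1)] tendsto_intros filterlim_ident)
    then show "eventually (\<lambda>y. PT (y - a) \<in> V) (nhds a)"
      by (rule topological_tendstoD) (use V in \<open>auto simp: linear_0[OF lPT]\<close>)
    show "eventually (\<lambda>y. \<zeta> (PT (y - a)) \<in> ball a \<rho>1) (nhds a)"
      by (rule topological_tendstoD[OF lim0]) (use \<rho>1 in \<open>auto simp: linear_0[OF lPT] \<zeta>(2)\<close>)
    show "eventually (\<lambda>y. y \<in> ball a \<rho>1) (nhds a)"
      by (rule eventually_nhds_in_open) (use \<rho>1 in auto)
  qed
  then obtain \<delta> where \<delta>: "\<delta> > 0" "\<And>y. y \<in> ball a \<delta> \<Longrightarrow> PT (y - a) \<in> V \<and> \<zeta> (PT (y - a)) \<in> ball a \<rho>1 \<and> y \<in> ball a \<rho>1"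
    unfolding eventually_nhds_metric by (metis dist_commute mem_ball)
  have \<delta>\<rho>: "ball a \<delta> \<subseteq> ball a \<rho>1" using \<delta>(2) by blast
  have normal: "M \<inter> ball a \<delta> = {y \<in> ball a \<delta>. (\<forall>i j. (i, j) \<in> R \<longrightarrow> y $ i = y $ j) \<and> \<Phi> y = 0}"
  proof (intro equalityI subsetI)
    fix y assume y: "y \<in> M \<inter> ball a \<delta>"
    then have "y \<in> M" "y \<in> ball a \<rho>1" using \<delta>\<rho> by auto
    with MC[OF this] M\<Phi>[OF this] y show "y \<in> {y \<in> ball a \<delta>. (\<forall>i j. (i, j) \<in> R \<longrightarrow> y $ i = y $ j) \<and> \<Phi> y = 0}"
      by blast
  next
    fix y assume "y \<in> {y \<in> ball a \<delta>. (\<forall>i j. (i, j) \<in> R \<longrightarrow> y $ i = y $ j) \<and> \<Phi> y = 0}"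
    then have yb: "y \<in> ball a \<delta>" and yR: "\<And>i j. (i, j) \<in> R \<Longrightarrow> y $ i = y $ j" and y0: "\<Phi> y = 0" by auto
    \<comment> \<open>The point of \<open>M\<close> with the tangential coordinate of
      \<open>y\<close>. The two differ by a vector of \<open>S\<close> and both are zeros of
      \<open>\<Phi>\<close>, so \<open>\<Psi>\<close> has equal values there.\<close>
    define z where "z = \<zeta> (PT (y - a))"
    have z: "z \<in> M" "PT (z - a) = PT (y - a)" "z \<in> ball a \<rho>1"
      using c1[OF PT(2)] \<delta>(2)[OF yb] unfolding z_def by blast+
    have "z - y \<in> S"
      unfolding S_def
    proof (intro CollectI conjI ballI allI impI)
      fix i j assume "(i, j) \<in> R" then show "(z - y) $ i = (z - y) $ j"
        using yR[of i j] MC[OF z(1,3), of i j] by simp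
    next
      fix t assume t: "t \<in> T"
      have "(z - y) \<bullet> t = PT (z - a) \<bullet> t - PT (y - a) \<bullet> t" using PT(3)[OF t] by (simp add: inner_diff_left)
      then show "t \<bullet> (z - y) = 0" using z(2) by (simp add: inner_commute)
    qed
    then have "P (z - y) = z - y" by (rule P_id)
    moreover have "P (z - a) - P (y - a) = P (z - y)" by (simp add: linear_diff[OF lP])
    ultimately have "\<Psi> z = \<Psi> y" unfolding \<Psi>_def using y0 M\<Phi>[OF z(1,3)] by (simp add: algebra_simps)
    then have "z = y" using U2(3) z(3) yb \<delta>\<rho> \<rho>1(2) unfolding inj_on_def by blast
    then show "y \<in> M \<inter> ball a \<delta>" using z(1) yb by simp
  qed
  have const: "coincide M y = R" if y: "y \<in> M" "y \<in> ball a \<delta>" for y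
  proof (intro equalityI subrelI)
    fix i j assume ij: "(i, j) \<in> R"
    obtain \<epsilon> where "\<epsilon> > 0" "ball y \<epsilon> \<subseteq> ball a \<delta>" using y(2) open_ball[of a \<delta>] openE by metis
    then show "(i, j) \<in> coincide M y" unfolding coincide_def using MC[OF _ _ ij] \<delta>\<rho> by blast
  next
    fix i j assume "(i, j) \<in> coincide M y"
    then obtain \<epsilon> where \<epsilon>: "\<epsilon> > 0" "\<And>z. z \<in> M \<Longrightarrow> z \<in> ball y \<epsilon> \<Longrightarrow> z $ i = z $ j" unfolding coincide_def by blast
    have yij: "y $ i = y $ j" using \<epsilon>(2)[OF y(1)] \<epsilon>(1) by simp
    then have aij: "a $ i = a $ j" using \<rho>s(2)[of y i j] y(2) \<delta>\<rho> \<rho>1(2) by blast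
    show "(i, j) \<in> R"
    proof (rule ccontr)
      assume n: "(i, j) \<notin> R"
      then have ij: "i \<noteq> j" using aij by (auto simp: R_def)
      \<comment> \<open>For a pair outside \<open>R\<close> this direction is tangent, so
        \<open>M\<close> contains points near \<open>y\<close> displaced by
        \<open>s *\<^sub>R e\<close> up to a vector of \<open>S\<close>. Vectors of \<open>S\<close>
        agree at \<open>i\<close> and \<open>j\<close>, hence the displacement separates these two
        coordinates.\<close>
      define e :: "'n rvec" where "e = axis i 1 - axis j 1"
      have eT: "e \<in> T" unfolding e_def by (rule Raxis[OF aij n])
      define t where "t = PT (y - a)"
      have t: "t \<in> V" "t \<in> T" "\<zeta> t = y" using c2[OF y(1)] y(2) \<delta>\<rho> \<rho>1(2) PT(2) unfolding t_def by blast+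
      have lin: "((\<lambda>s. t + s *\<^sub>R e) \<longlongrightarrow> t + 0 *\<^sub>R e) (nhds (0::real))" by (intro tendsto_intros filterlim_ident)
      have "isCont \<zeta> (t + 0 *\<^sub>R e)" using \<zeta>(1) V t by (simp add: continuous_on_eq_continuous_at)
      from isCont_tendsto_compose[OF this lin] have lz: "((\<lambda>s. \<zeta> (t + s *\<^sub>R e)) \<longlongrightarrow> y) (nhds 0)" by (simp add: t)
      have "eventually (\<lambda>s. t + s *\<^sub>R e \<in> V \<and> \<zeta> (t + s *\<^sub>R e) \<in> ball y \<epsilon> \<and> \<zeta> (t + s *\<^sub>R e) \<in> ball a \<delta>) (nhds 0)"
      proof (intro eventually_conj)
        show "eventually (\<lambda>s. t + s *\<^sub>R e \<in> V) (nhds 0)" by (rule topological_tendstoD[OF lin]) (use V t in auto)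
        show "eventually (\<lambda>s. \<zeta> (t + s *\<^sub>R e) \<in> ball y \<epsilon>) (nhds 0)" by (rule topological_tendstoD[OF lz]) (use \<epsilon> in auto)
        show "eventually (\<lambda>s. \<zeta> (t + s *\<^sub>R e) \<in> ball a \<delta>) (nhds 0)" by (rule topological_tendstoD[OF lz]) (use y in auto)
      qed
      then obtain r where r: "r > 0" "\<And>s. dist s 0 < r \<Longrightarrow> t + s *\<^sub>R e \<in> V \<and> \<zeta> (t + s *\<^sub>R e) \<in> ball y \<epsilon> \<and> \<zeta> (t + s *\<^sub>R e) \<in> ball a \<delta>"
        unfolding eventually_nhds_metric by blast
      define s where "s = r / 2"
      have s: "s > 0" "dist s 0 < r" using r(1) by (auto simp: s_def)
      define z where "z = \<zeta> (t + s *\<^sub>R e)"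
      have tT: "t + s *\<^sub>R e \<in> T" using T(1) t(2) eT by (simp add: subspace_add subspace_scale)
      have z: "z \<in> M" "PT (z - a) = t + s *\<^sub>R e" "z \<in> ball y \<epsilon>" "z \<in> ball a \<delta>"
        using c1[OF tT] r(2)[OF s(2)] unfolding z_def by blast+
      have "z - y - s *\<^sub>R e \<in> S"
        unfolding S_def
      proof (intro CollectI conjI ballI allI impI)
        fix k l assume kl: "(k, l) \<in> R"
        have "y $ k = y $ l" "z $ k = z $ l" using MC[OF y(1) _ kl] MC[OF z(1) _ kl] y(2) z(4) \<delta>\<rho> by auto
        moreover have "e $ k = e $ l" using kl eT by (simp add: R_def)
        ultimately show "(z - y - s *\<^sub>R e) $ k = (z - y - s *\<^sub>R e) $ l" by simp
      next
        fix u assume u: "u \<in> T"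
        have "(z - y) \<bullet> u = PT (z - a) \<bullet> u - PT (y - a) \<bullet> u" using PT(3)[OF u] by (simp add: inner_diff_left)
        also have "\<dots> = (s *\<^sub>R e) \<bullet> u" unfolding z(2) t_def by (simp add: inner_add_left)
        finally show "u \<bullet> (z - y - s *\<^sub>R e) = 0" by (simp add: inner_diff_right inner_diff_left inner_commute)
      qed
      from Sconst[OF this aij] have "s * (e $ i - e $ j) = 0"
        using \<epsilon>(2)[OF z(1,3)] yij by (auto simp: algebra_simps)
      then show False using s(1) ij by (simp add: e_def axis_def)
    qed
  qed
  show ?thesis
  proof (rule that[of \<delta> T R S P \<Phi>])
    show "C2_dir (ball a \<delta>) \<Phi>" by (rule C2\<Phi>) (use \<delta>\<rho> \<rho>U in blast)
    show "a $ i = a $ j" if "x \<in> ball a \<delta>" "x $ i = x $ j" for x i j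
      using \<rho>s(2)[of x i j] that \<delta>\<rho> \<rho>1(2) by blast
  qed (fact \<delta>(1) T R_def S_def P \<Phi>S d\<Phi> normal | erule (2) block | erule \<Phi>swap | erule (1) const)+
qed

section \<open>Dimension counts\<close>

lemma subspace_Sym: "subspace Sym"
  by (auto simp: subspace_def Sym_def vec_eq_iff transpose_component)

text \<open>The symmetrized matrix units \<open>E i j\<close> with \<open>i \<le> j\<close> are
  pairwise orthogonal and nonzero, hence a basis.\<close>

lemma dim_block_Sym:
  fixes R :: "('n::{finite,linorder} \<times> 'n) set"
  assumes "sym R"
  shows "dim {Z \<in> Sym. \<forall>i j. (i, j) \<notin> R \<longrightarrow> Z $ i $ j = (0::real)} = card {(i, j). i \<le> j \<and> (i, j) \<in> R}"
proof -
  define E :: "'n \<Rightarrow> 'n \<Rightarrow> 'n rmat"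
    where "E i j = (\<chi> p q. if p = i \<and> q = j \<or> p = j \<and> q = i then 1 else 0)" for i j
  define I where "I = {(i, j). i \<le> j \<and> (i, j) \<in> R}"
  define V where "V = {Z \<in> Sym. \<forall>i j. (i, j) \<notin> R \<longrightarrow> Z $ i $ j = (0::real)}"
  have Ec: "E i j $ p $ q = (if p = i \<and> q = j \<or> p = j \<and> q = i then 1 else 0)" for i j p q
    by (simp add: E_def)
  have sep: "E i j $ p $ q = 0" if "i \<le> j" "p \<le> q" "(p, q) \<noteq> (i, j)" for i j p q
    using that by (auto simp: Ec)
  have one: "E i j $ i $ j = 1" for i j by (simp add: Ec)
  have Esym: "E i j $ p $ q = E i j $ q $ p" for i j p q by (simp add: Ec)
  have inj: "inj_on (\<lambda>(i, j). E i j) I"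
  proof (rule inj_onI, clarify)
    fix i j p q assume *: "(i, j) \<in> I" "(p, q) \<in> I" "E i j = E p q"
    show "i = p \<and> j = q"
    proof (rule ccontr)
      assume "\<not> ?thesis"
      then have "E p q $ i $ j = 0" using * by (intro sep) (auto simp: I_def)
      then show False using *(3) one[of i j] by simp
    qed
  qed
  have orth: "orthogonal (E i j) (E p q)" if "(i, j) \<in> I" "(p, q) \<in> I" "(i, j) \<noteq> (p, q)" for i j p q
  proof -
    have "E p q $ i $ j = 0" using that by (intro sep) (auto simp: I_def)
    then have "E p q $ i $ j = 0" "E p q $ j $ i = 0" using Esym by metis+
    then have prod0: "E i j $ k $ l * E p q $ k $ l = 0" for k l
      unfolding Ec[of i j] by auto
    show ?thesis by (simp add: orthogonal_def inner_vec_def prod0)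
  qed
  have ind: "independent ((\<lambda>(i, j). E i j) ` I)"
  proof (rule pairwise_orthogonal_independent)
    show "pairwise orthogonal ((\<lambda>(i, j). E i j) ` I)"
    proof (rule pairwiseI)
      fix u v assume uv: "u \<in> (\<lambda>(i, j). E i j) ` I" "v \<in> (\<lambda>(i, j). E i j) ` I" "u \<noteq> v"
      from uv(1,2) obtain i j p q where "(i, j) \<in> I" "u = E i j" "(p, q) \<in> I" "v = E p q" by auto
      with uv(3) orth[of i j p q] show "orthogonal u v" by auto
    qed
    show "0 \<notin> (\<lambda>(i, j). E i j) ` I"
    proof
      assume "0 \<in> (\<lambda>(i, j). E i j) ` I"
      then obtain i j where "E i j = 0" by auto
      then show False using one[of i j] by simp
    qed
  qed
  have "span ((\<lambda>(i, j). E i j) ` I) = V"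
  proof (intro equalityI)
    have "subspace V" unfolding V_def
      by (auto simp: subspace_def Sym_def vec_eq_iff transpose_component)
    moreover have "E i j \<in> V" if "(i, j) \<in> I" for i j
      using that assms by (auto simp: V_def Sym_def vec_eq_iff transpose_component Ec I_def sym_def)
    ultimately show "span ((\<lambda>(i, j). E i j) ` I) \<subseteq> V" by (intro span_minimal) auto
  next
    show "V \<subseteq> span ((\<lambda>(i, j). E i j) ` I)"
    proof
      fix Z assume Z: "Z \<in> V"
      have Zsym: "Z $ p $ q = Z $ q $ p" for p q
        using Z by (auto simp: V_def Sym_def vec_eq_iff transpose_component)
      have "Z = (\<Sum>(i, j)\<in>I. Z $ i $ j *\<^sub>R E i j)"
      proof (simp only: vec_eq_iff, intro allI)
        fix p q :: 'n
        \<comment> \<open>The increasing representative of the entry \<open>(p, q)\<close>; only its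
          term survives in the sum.\<close>
        define c where "c = (min p q, max p q)"
        have cle: "fst c \<le> snd c" using linear[of p q] by (auto simp: c_def min_def max_def)
        have "(\<Sum>(i, j)\<in>I. Z $ i $ j *\<^sub>R E i j) $ p $ q = (\<Sum>x\<in>I. Z $ fst x $ snd x * E (fst x) (snd x) $ p $ q)"
          by (simp add: case_prod_beta)
        also have "\<dots> = (\<Sum>x\<in>I. if x = c then Z $ p $ q else 0)"
        proof (rule sum.cong[OF refl])
          fix x assume "x \<in> I"
          then have le: "fst x \<le> snd x" by (auto simp: I_def)
          have Ecc: "E i j $ p $ q = E i j $ fst c $ snd c" for i j
            using Esym[of i j p q] by (simp add: c_def min_def max_def)
          have Zc: "Z $ p $ q = Z $ fst c $ snd c"
            using Zsym[of p q] by (simp add: c_def min_def max_def)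
          show "Z $ fst x $ snd x * E (fst x) (snd x) $ p $ q = (if x = c then Z $ p $ q else 0)"
          proof (cases "x = c")
            case True
            then show ?thesis by (simp add: Ecc Zc one)
          next
            case False
            have "E (fst x) (snd x) $ fst c $ snd c = 0"
              by (rule sep[OF le cle]) (use False in \<open>auto simp: prod_eq_iff\<close>)
            then show ?thesis using False by (simp add: Ecc)
          qed
        qed
        also have "\<dots> = (if c \<in> I then Z $ p $ q else 0)" by simp
        also have "\<dots> = Z $ p $ q"
        proof (cases "c \<in> I")
          case False
          then have "c \<notin> R" using cle by (cases c) (auto simp: I_def)
          then have "(p, q) \<notin> R" using symD[OF assms] by (auto simp: c_def min_def max_def split: if_splits)
          then show ?thesis using Z False by (simp add: V_def)
        qed simp
        finally show "Z $ p $ q = (\<Sum>(i, j)\<in>I. Z $ i $ j *\<^sub>R E i j) $ p $ q" by simp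
      qed
      also have "\<dots> \<in> span ((\<lambda>(i, j). E i j) ` I)"
        by (intro span_sum) (clarify, rule span_scale, rule span_base, force)
      finally show "Z \<in> span ((\<lambda>(i, j). E i j) ` I)" .
    qed
  qed
  then have "dim V = card ((\<lambda>(i, j). E i j) ` I)"
    using ind by (metis dim_eq_card_independent dim_span)
  then show ?thesis using card_image[OF inj] by (simp add: V_def I_def)
qed

lemma dim_Sym: "dim (Sym :: ('n::{finite,linorder}) rmat set) = card {(i::'n, j). i \<le> j}"
  using dim_block_Sym[of "UNIV :: ('n \<times> 'n) set"] by (simp add: sym_def)

text \<open>Send an increasing pair of indices to the set of their two level sets; the fiber over
  \<open>{I, J}\<close> has \<open>card I * card J\<close> elements.\<close>

lemma card_pairs_vec_partition:
  fixes x :: "('n::{finite,linorder}) rvec"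
  shows "card {(i, j). i < j \<and> x $ i \<noteq> x $ j} =
    (\<Sum>p\<in>{p. p \<subseteq> vec_partition x \<and> card p = 2}. \<Prod>I\<in>p. card I)"
proof -
  define cls where "cls i = {j. x $ j = x $ i}" for i
  define A where "A = {(i, j). i < j \<and> x $ i \<noteq> x $ j}"
  define Q where "Q = {p. p \<subseteq> vec_partition x \<and> card p = 2}"
  have vp: "vec_partition x = range cls" by (auto simp: vec_partition_def cls_def)
  have cls_eq: "cls i = cls j \<longleftrightarrow> x $ i = x $ j" for i j by (auto simp: cls_def)
  have mem: "i \<in> cls k \<longleftrightarrow> cls i = cls k" for i k unfolding cls_eq by (simp add: cls_def)
  define f where "f = (\<lambda>(i, j). {cls i, cls j})"
  have "f ` A \<subseteq> Q" by (auto simp: f_def A_def Q_def vp cls_eq card_insert_if)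
  moreover have "finite Q" unfolding Q_def by simp
  ultimately have "card A = (\<Sum>p\<in>Q. card {z. z \<in> A \<and> f z = p})"
    using sum.group[of A Q f "\<lambda>_. 1::nat"] by simp
  also have "\<dots> = (\<Sum>p\<in>Q. \<Prod>I\<in>p. card I)"
  proof (rule sum.cong[OF refl])
    fix p assume "p \<in> Q"
    then have sub: "p \<subseteq> range cls" and "card p = 2" by (auto simp: Q_def vp)
    then obtain I J where IJ: "p = {I, J}" "I \<noteq> J" by (meson card_2_iff)
    then obtain k l where p: "p = {cls k, cls l}" and kl: "cls k \<noteq> cls l" using sub by auto
    have disj: "cls k \<inter> cls l = {}" using kl mem by (metis disjoint_iff)
    \<comment> \<open>Sorting a pair of \<open>I \<times> J\<close> can be undone because the
      classes are disjoint: membership tells which index came from which class.\<close>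
    define swp where "swp = (\<lambda>(u::'n, v). if u < v then (u, v) else (v, u))"
    have "bij_betw swp (cls k \<times> cls l) {z. z \<in> A \<and> f z = p}"
      unfolding bij_betw_def
    proof
      show "inj_on swp (cls k \<times> cls l)"
        using disj by (auto simp: inj_on_def swp_def split: if_splits)
      show "swp ` (cls k \<times> cls l) = {z. z \<in> A \<and> f z = p}"
      proof (intro equalityI subsetI)
        fix z assume "z \<in> swp ` (cls k \<times> cls l)"
        then obtain u v where uv: "cls u = cls k" "cls v = cls l" and z: "z = swp (u, v)" by (auto simp: mem)
        have "u \<noteq> v" using uv kl by metis
        moreover have "x $ u \<noteq> x $ v" using uv kl cls_eq by metis
        ultimately show "z \<in> {z. z \<in> A \<and> f z = p}"
          unfolding z swp_def p using uv by (auto simp: A_def f_def)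
      next
        fix z assume "z \<in> {z. z \<in> A \<and> f z = p}"
        then obtain i j where z: "z = (i, j)" and ij: "i < j" "{cls i, cls j} = {cls k, cls l}"
          by (auto simp: A_def f_def p)
        then consider "cls i = cls k" "cls j = cls l" | "cls i = cls l" "cls j = cls k"
          by (auto simp: doubleton_eq_iff)
        then show "z \<in> swp ` (cls k \<times> cls l)"
        proof cases
          case 1
          then have "(i, j) \<in> cls k \<times> cls l" by (simp add: mem)
          moreover have "z = swp (i, j)" using z ij by (simp add: swp_def)
          ultimately show ?thesis by blast
        next
          case 2
          then have "(j, i) \<in> cls k \<times> cls l" by (simp add: mem)
          moreover have "z = swp (j, i)" using z ij by (auto simp: swp_def)
          ultimately show ?thesis by blast
        qed
      qed
    qed
    then have "card {z. z \<in> A \<and> f z = p} = card (cls k \<times> cls l)" by (rule bij_betw_same_card[symmetric])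
    then show "card {z. z \<in> A \<and> f z = p} = (\<Prod>I\<in>p. card I)"
      using kl by (simp add: p card_cartesian_product)
  qed
  finally show ?thesis by (simp add: A_def Q_def)
qed

text \<open>Around the point supplied by the definition all points of \<open>M\<close> have the same
  coordinate partition, so each coincidence at that point persists.\<close>

lemma characteristic_perm_coincide:
  assumes "characteristic_perm M \<sigma>"
  obtains y where "y \<in> M" "coincide M y = {(i, j). y $ i = y $ j}" "vec_partition y = perm_partition \<sigma>"
proof -
  obtain y \<delta> where y: "y \<in> M" "\<delta> > 0" "M \<inter> ball y \<delta> \<subseteq> Delta \<sigma>"
    using assms unfolding characteristic_perm_def by blast
  have vp: "vec_partition z = perm_partition \<sigma>" if "z \<in> M" "z \<in> ball y \<delta>" for z
    using y(3) that by (auto simp: Delta_def)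
  have yy: "vec_partition y = perm_partition \<sigma>" using vp y by simp
  have "coincide M y = {(i, j). y $ i = y $ j}"
  proof (intro equalityI subrelI)
    fix i j assume "(i, j) \<in> coincide M y"
    then obtain \<epsilon> where "\<epsilon> > 0" "\<forall>z\<in>M \<inter> ball y \<epsilon>. z $ i = z $ j" by (auto simp: coincide_def)
    then show "(i, j) \<in> {(i, j). y $ i = y $ j}" using y by auto
  next
    fix i j assume ij: "(i, j) \<in> {(i, j). y $ i = y $ j}"
    have "z $ i = z $ j" if z: "z \<in> M" "z \<in> ball y \<delta>" for z
    proof -
      have "{k. y $ k = y $ i} \<in> vec_partition z" unfolding vp[OF z] yy[symmetric] by (auto simp: vec_partition_def)
      then obtain m where m: "{k. y $ k = y $ i} = {k. z $ k = z $ m}" by (auto simp: vec_partition_def)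
      have "i \<in> {k. y $ k = y $ i}" "j \<in> {k. y $ k = y $ i}" using ij by auto
      then show ?thesis unfolding m by simp
    qed
    then show "(i, j) \<in> coincide M y" using y(2) by (auto simp: coincide_def)
  qed
  then show ?thesis using that y(1) yy by blast
qed

text \<open>The normal form makes the relation locally constant; connectedness of \<open>M\<close>
  does the rest.\<close>

lemma coincide_constant:
  fixes M :: "('n::{finite,linorder}) rvec set"
  assumes M: "locally_symmetric_C2_submanifold M d" and "y \<in> M" "z \<in> M"
  shows "coincide M y = coincide M z"
proof (rule connected_local_const[of M])
  show "connected M" using M by (simp add: locally_symmetric_C2_submanifold_def)
  show "\<forall>a\<in>M. \<forall>\<^sub>F b in at a within M. coincide M a = coincide M b"
  proof
    fix a assume a: "a \<in> M"
    have "C2_submanifold_of UNIV M d" "locally_symmetric M"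
      using M by (auto simp: locally_symmetric_C2_submanifold_def)
    then obtain \<delta> R where \<delta>: "\<delta> > 0" "\<And>y. y \<in> M \<Longrightarrow> y \<in> ball a \<delta> \<Longrightarrow> coincide M y = R"
      using local_normal_form[of M d a] a by metis
    then show "\<forall>\<^sub>F b in at a within M. coincide M a = coincide M b"
      unfolding eventually_at using a by (intro exI[of _ \<delta>]) (auto simp: dist_commute)
  qed
qed (fact assms)+

section \<open>Lifting the normal form to symmetric matrices\<close>

lemma has_derivative_vec:
  fixes f :: "'a::real_normed_vector \<Rightarrow> 'b::euclidean_space^'n::finite"
  assumes "\<And>i. ((\<lambda>x. f x $ i) has_derivative (\<lambda>h. f' h $ i)) F"
  shows "(f has_derivative f') F"
proof -
  have bl: "bounded_linear (axis i :: 'b \<Rightarrow> 'b^'n)" for i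
    unfolding linear_conv_bounded_linear[symmetric]
    by (rule linearI) (auto simp: vec_eq_iff axis_def)
  have eq: "(\<Sum>i\<in>UNIV. axis i (v $ i)) = v" for v :: "'b^'n"
    by (simp add: vec_eq_iff axis_def if_distrib cong: if_cong)
  have "((\<lambda>x. \<Sum>i\<in>UNIV. axis i (f x $ i)) has_derivative (\<lambda>h. \<Sum>i\<in>UNIV. axis i (f' h $ i))) F"
    by (intro has_derivative_sum bounded_linear.has_derivative[OF bl] assms)
  then show ?thesis by (simp only: eq)
qed

section \<open>Block means, cofactors and matrix polynomials\<close>

definition blk :: "real^'n::finite \<Rightarrow> 'n \<Rightarrow> 'n set" where
  "blk a i = {j. a $ j = a $ i}"

definition block_mean :: "real^'n::finite \<Rightarrow> 'n \<Rightarrow> real^'n \<Rightarrow> real" where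
  "block_mean a i x = (\<Sum>j\<in>blk a i. x $ j) / real (card (blk a i))"

text \<open>The factors are the eigenvalues outside the block of \<open>i\<close>, so the value at a matrix with
eigenvalues \<open>x\<close> vanishes off the eigenspaces of the block.\<close>

definition cofactor :: "real^'n::finite \<Rightarrow> 'n \<Rightarrow> real^'n \<Rightarrow> real poly" where
  "cofactor a i x = (\<Prod>j\<in>- blk a i. [:- (x $ j), 1:])"

primrec mpow :: "real^'n^'n \<Rightarrow> nat \<Rightarrow> real^'n^'n" where
  "mpow S 0 = mat 1"
| "mpow S (Suc m) = S ** mpow S m"

text \<open>Summing up to the fixed bound \<open>CARD('n)\<close> instead of the degree gives a
  number of terms that does not vary with \<open>q\<close>; cofactors have at most this
  degree.\<close>

definition polym :: "real poly \<Rightarrow> real^'n^'n::finite \<Rightarrow> real^'n^'n" where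
  "polym q S = (\<Sum>m\<le>CARD('n). coeff q m *\<^sub>R mpow S m)"

lemma card_blk_pos: "card (blk a i) > 0"
  by (auto simp: card_gt_0_iff blk_def)

lemma bij_transpose_blk:
  assumes "a $ p = a $ q"
  shows "bij_betw (Transposition.transpose p q) (blk a i) (blk a i)"
    "bij_betw (Transposition.transpose p q) (- blk a i) (- blk a i)"
proof -
  have "a $ Transposition.transpose p q j = a $ j" for j
    using assms by (auto simp: Transposition.transpose_def)
  then show "bij_betw (Transposition.transpose p q) (blk a i) (blk a i)"
    "bij_betw (Transposition.transpose p q) (- blk a i) (- blk a i)"
    by (intro bij_betw_byWitness[where f' = "Transposition.transpose p q"]; auto simp: blk_def)+
qed

lemma block_mean_swapv: "a $ p = a $ q \<Longrightarrow> block_mean a i (swapv p q x) = block_mean a i x"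
  unfolding block_mean_def swapv_component
  using sum.reindex_bij_betw[OF bij_transpose_blk(1), of a p q "\<lambda>j. x $ j" i] by simp

lemma cofactor_swapv: "a $ p = a $ q \<Longrightarrow> cofactor a i (swapv p q x) = cofactor a i x"
  unfolding cofactor_def swapv_component
  using prod.reindex_bij_betw[OF bij_transpose_blk(2), of a p q "\<lambda>j. [:- (x $ j), 1:]" i] by simp

lemma block_mean_cong: "a $ i = a $ j \<Longrightarrow> block_mean a i = block_mean a j"
  by (simp add: block_mean_def blk_def fun_eq_iff)

lemma cofactor_cong: "a $ i = a $ j \<Longrightarrow> cofactor a i = cofactor a j"
  by (simp add: cofactor_def blk_def fun_eq_iff)

lemma block_mean_linear: "bounded_linear (block_mean a i)"
  unfolding linear_conv_bounded_linear[symmetric]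
  by (rule linearI) (simp_all add: block_mean_def sum.distrib sum_distrib_left add_divide_distrib)

lemma block_mean_const:
  assumes "\<And>j. a $ j = a $ i \<Longrightarrow> x $ j = c"
  shows "block_mean a i x = c"
proof -
  have "(\<Sum>j\<in>blk a i. x $ j) = (\<Sum>j\<in>blk a i. c)" by (rule sum.cong) (use assms in \<open>auto simp: blk_def\<close>)
  then show ?thesis using card_blk_pos[of a i] by (auto simp: block_mean_def)
qed

lemma degree_cofactor: "degree (cofactor a i (x :: real^'n::finite)) \<le> CARD('n)"
proof -
  have "degree (cofactor a i x) \<le> (\<Sum>j\<in>- blk a i. (degree \<circ> (\<lambda>j. [:- (x $ j), 1:])) j)"
    unfolding cofactor_def by (rule degree_prod_sum_le) simp
  also have "\<dots> = card (- blk a i)" by simp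
  also have "\<dots> \<le> CARD('n)" by (rule card_mono) auto
  finally show ?thesis .
qed

lemma poly_cofactor: "poly (cofactor a i x) t = (\<Prod>j\<in>- blk a i. t - x $ j)"
  by (simp add: cofactor_def poly_prod)

lemma diagm_mult: "diagm u ** diagm v = diagm (\<chi> l. u $ l * v $ l)"
  by (auto simp: vec_eq_iff mult_diagm_component diagm_component)

lemma conj_diagm_mult:
  fixes U :: "real^'n^'n"
  assumes "orthogonal_matrix U"
  shows "(U ** diagm u ** transpose U) ** (U ** diagm v ** transpose U) = U ** diagm (\<chi> l. u $ l * v $ l) ** transpose U"
proof -
  have "(U ** diagm u ** transpose U) ** (U ** diagm v ** transpose U) = U ** (diagm u ** diagm v) ** transpose U"
    using assms by (simp add: matrix_mul_assoc orthogonal_matrix_simps)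
  then show ?thesis by (simp add: diagm_mult)
qed

lemma mpow_conj_diagm:
  fixes U :: "real^'n^'n"
  assumes U: "orthogonal_matrix U"
  shows "mpow (U ** diagm x ** transpose U) m = U ** diagm (\<chi> l. x $ l ^ m) ** transpose U"
proof (induction m)
  case 0
  have "diagm (\<chi> l. 1) = (mat 1 :: real^'n^'n)" by (simp add: vec_eq_iff diagm_component mat_def)
  then show ?case using U by (simp add: orthogonal_matrix_simps)
next
  case (Suc m)
  show ?case by (simp only: mpow.simps Suc conj_diagm_mult[OF U]) simp
qed

lemma polym_conj_diagm:
  fixes U :: "real^'n^'n"
  assumes U: "orthogonal_matrix U" and q: "degree q \<le> CARD('n)"
  shows "polym q (U ** diagm x ** transpose U) = U ** diagm (\<chi> l. poly q (x $ l)) ** transpose U"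
proof -
  have pq: "poly q t = (\<Sum>m\<le>CARD('n). coeff q m * t ^ m)" for t
    unfolding poly_altdef by (rule sum.mono_neutral_left) (use q in \<open>auto simp: coeff_eq_0\<close>)
  have "polym q (U ** diagm x ** transpose U) $ i $ j = (U ** diagm (\<chi> l. poly q (x $ l)) ** transpose U) $ i $ j" for i j
  proof -
    have "polym q (U ** diagm x ** transpose U) $ i $ j = (\<Sum>m\<le>CARD('n). \<Sum>l\<in>UNIV. coeff q m * (U $ i $ l * x $ l ^ m * U $ j $ l))"
      by (simp add: polym_def mpow_conj_diagm[OF U] conj_diagm_component sum_distrib_left)
    also have "\<dots> = (\<Sum>l\<in>UNIV. \<Sum>m\<le>CARD('n). coeff q m * (U $ i $ l * x $ l ^ m * U $ j $ l))" by (rule sum.swap)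
    also have "\<dots> = (U ** diagm (\<chi> l. poly q (x $ l)) ** transpose U) $ i $ j"
      by (simp add: conj_diagm_component pq sum_distrib_left sum_distrib_right mult_ac)
    finally show ?thesis .
  qed
  then show ?thesis by (simp add: vec_eq_iff)
qed

lemma conj_diagm_shift:
  fixes U :: "real^'n^'n"
  assumes U: "orthogonal_matrix U"
  shows "U ** diagm (\<chi> l. x $ l - c) ** transpose U = U ** diagm x ** transpose U - c *\<^sub>R mat 1"
proof -
  have "diagm (\<chi> l. x $ l - c) = diagm x - c *\<^sub>R mat 1" by (simp add: vec_eq_iff diagm_component mat_def)
  then show ?thesis using U by (simp add: matrix_diff_distrib matrix_scaleR_mult orthogonal_matrix_simps)
qed

lemma C2_dir_vec_nth: "C2_dir U (\<lambda>x::real^'n::finite. x $ i)"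
  by (rule C2_dir_bounded_linear) (rule bounded_linear_vec_nth)

lemma C2_dir_coeff_prod:
  fixes p :: "'i \<Rightarrow> 'a::euclidean_space \<Rightarrow> real poly"
  assumes "\<And>j m. j \<in> J \<Longrightarrow> C2_dir U (\<lambda>x. coeff (p j x) m)"
  shows "C2_dir U (\<lambda>x. coeff (\<Prod>j\<in>J. p j x) m)"
  using assms
proof (induction J arbitrary: m rule: infinite_finite_induct)
  case (insert j J)
  then show ?case by (simp add: coeff_mult) (intro C2_dir_sum C2_dir_mult; simp)
qed (auto simp: coeff_1)

lemma C2_dir_coeff_cofactor: "C2_dir U (\<lambda>x. coeff (cofactor a i x) m)"
  unfolding cofactor_def
proof (rule C2_dir_coeff_prod)
  fix j m
  show "C2_dir U (\<lambda>x. coeff [:- (x $ j), 1:] m)"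
  proof (cases m)
    case 0
    then show ?thesis using C2_dir_cmult[OF C2_dir_vec_nth, of U "-1" j] by simp
  qed (simp add: C2_dir_const)
qed

lemma C2_dir_matrix_mult:
  fixes A B :: "'a::euclidean_space \<Rightarrow> real^'n::finite^'n"
  assumes "\<And>k l. C2_dir U (\<lambda>x. A x $ k $ l)" "\<And>k l. C2_dir U (\<lambda>x. B x $ k $ l)"
  shows "C2_dir U (\<lambda>x. (A x ** B x) $ k $ l)"
  unfolding matrix_mult_component by (intro C2_dir_sum C2_dir_mult assms)

lemma C2_dir_symm: "C2_dir U (\<lambda>X. symm X $ k $ l)"
  by (rule C2_dir_bounded_linear)
    (rule bounded_linear_compose[OF bounded_linear_vec_nth bounded_linear_compose[OF bounded_linear_vec_nth bounded_linear_symm]])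

lemma C2_dir_mpow_symm: "C2_dir U (\<lambda>X. mpow (symm X) m $ k $ l)"
proof (induction m arbitrary: k l)
  case (Suc m)
  then show ?case by (simp only: mpow.simps) (intro C2_dir_matrix_mult C2_dir_symm)
qed (simp add: C2_dir_const)

definition class_mean :: "('n::finite \<times> 'n) set \<Rightarrow> ('n \<Rightarrow> real) \<Rightarrow> 'n \<Rightarrow> real" where
  "class_mean R z i = (\<Sum>l\<in>R `` {i}. z l) / real (card (R `` {i}))"

text \<open>Averaging over the classes is self-adjoint and fixes functions that are constant on
  them.\<close>

lemma sum_class_mean:
  fixes R :: "('n::finite \<times> 'n) set"
  assumes R: "equiv UNIV R" and t: "\<And>i j. (i, j) \<in> R \<Longrightarrow> t i = t j"
  shows "(\<Sum>i\<in>UNIV. t i * class_mean R z i) = (\<Sum>i\<in>UNIV. t i * z i)"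
proof -
  define c where "c i = real (card (R `` {i}))" for i
  have cpos: "c i > 0" for i
    unfolding c_def using R by (auto simp: card_gt_0_iff equiv_def refl_on_def)
  have ceq: "c i = c j" if "(i, j) \<in> R" for i j
    unfolding c_def using equiv_class_eq[OF R that] by simp
  have "(\<Sum>i\<in>UNIV. t i * class_mean R z i) = (\<Sum>i\<in>UNIV. \<Sum>l\<in>UNIV. if (i, l) \<in> R then t i * z l / c i else 0)"
  proof (rule sum.cong[OF refl])
    fix i
    have "t i * class_mean R z i = (\<Sum>l\<in>R `` {i}. t i * z l / c i)"
      by (simp add: class_mean_def c_def sum_distrib_left sum_divide_distrib)
    also have "\<dots> = (\<Sum>l\<in>UNIV. if (i, l) \<in> R then t i * z l / c i else 0)"
      by (rule sum.mono_neutral_cong_left) auto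
    finally show "t i * class_mean R z i = (\<Sum>l\<in>UNIV. if (i, l) \<in> R then t i * z l / c i else 0)" .
  qed
  also have "\<dots> = (\<Sum>l\<in>UNIV. \<Sum>i\<in>UNIV. if (i, l) \<in> R then t i * z l / c i else 0)" by (rule sum.swap)
  also have "\<dots> = (\<Sum>l\<in>UNIV. t l * z l)"
  proof (rule sum.cong[OF refl])
    fix l
    have "(\<Sum>i\<in>UNIV. if (i, l) \<in> R then t i * z l / c i else 0) = (\<Sum>i\<in>R `` {l}. t l * z l / c l)"
    proof (rule sum.mono_neutral_cong_right)
      show "\<forall>i\<in>UNIV - R `` {l}. (if (i, l) \<in> R then t i * z l / c i else 0) = 0"
        using R by (auto simp: equiv_def sym_def)
      fix i assume "i \<in> R `` {l}"
      then have il: "(i, l) \<in> R" using R by (auto simp: equiv_def sym_def)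
      then show "(if (i, l) \<in> R then t i * z l / c i else 0) = t l * z l / c l"
        using t[OF il] ceq[OF il] by simp
    qed auto
    also have "\<dots> = t l * z l" using cpos[of l] by (auto simp: c_def)
    finally show "(\<Sum>i\<in>UNIV. if (i, l) \<in> R then t i * z l / c i else 0) = t l * z l" .
  qed
  finally show ?thesis .
qed

definition diagv :: "real^'n^'n::finite \<Rightarrow> real^'n" where
  "diagv K = (\<chi> l. K $ l $ l)"

text \<open>Keeps the part of \<open>Z\<close> inside the classes of \<open>R\<close> and replaces the mean of the diagonal over each
class by \<open>v\<close>.\<close>

definition block_combine :: "('n::finite \<times> 'n) set \<Rightarrow> ('n \<Rightarrow> 'n \<Rightarrow> real) \<Rightarrow> real^'n \<Rightarrow> real^'n^'n" where
  "block_combine R Z v = (\<chi> i j. if (i, j) \<in> R then Z i j - (if i = j then class_mean R (\<lambda>l. Z l l) i - v $ i else 0) else 0)"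

lemma block_combine_component:
  "block_combine R Z v $ i $ j = (if (i, j) \<in> R then Z i j - (if i = j then class_mean R (\<lambda>l. Z l l) i - v $ i else 0) else 0)"
  by (simp add: block_combine_def)

text \<open>\<open>transpose W\<close> preserves norms, and an entrywise error of total size below 1
  cannot send a nonzero vector to 0. It serves to invert the part of a change of basis that stays
  inside the blocks.\<close>

lemma near_identity_surjective:
  fixes W B :: "real^'n::finite^'n"
  assumes W: "orthogonal_matrix W" and close: "(\<Sum>i\<in>UNIV. \<Sum>j\<in>UNIV. \<bar>W $ i $ j - B $ i $ j\<bar>) < 1"
  shows "\<exists>v. transpose B *v v = w"
proof -
  have "inj ((*v) (transpose B))"
  proof (rule injI, rule ccontr)
    fix x y assume eq: "transpose B *v x = transpose B *v y" and ne: "x \<noteq> y"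
    define v where "v = x - y"
    have v0: "norm v > 0" using ne by (simp add: v_def)
    have Bv: "transpose B *v v = 0" using eq by (simp add: v_def matrix_vector_mult_diff_distrib)
    have "norm v = norm (transpose W *v v)"
      using W by (metis orthogonal_matrix_transpose orthogonal_transformation_matrix
          matrix_of_matrix_vector_mul matrix_vector_mul_linear orthogonal_transformation_norm)
    also have "transpose W *v v = (\<chi> j. \<Sum>i\<in>UNIV. (W $ i $ j - B $ i $ j) * v $ i)"
    proof -
      have "(transpose W *v v) $ j = (\<Sum>i\<in>UNIV. (W $ i $ j - B $ i $ j) * v $ i)" for j
      proof -
        have "(transpose B *v v) $ j = 0" using Bv by simp
        then show ?thesis by (simp add: matrix_vector_mult_def transpose_component left_diff_distrib sum_subtractf)
      qed
      then show ?thesis by (simp add: vec_eq_iff)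
    qed
    also have "norm \<dots> \<le> (\<Sum>j\<in>UNIV. \<bar>\<Sum>i\<in>UNIV. (W $ i $ j - B $ i $ j) * v $ i\<bar>)"
      by (rule order_trans[OF norm_le_l1_cart]) simp
    also have "\<dots> \<le> (\<Sum>j\<in>UNIV. \<Sum>i\<in>UNIV. \<bar>W $ i $ j - B $ i $ j\<bar> * norm v)"
      by (intro sum_mono order_trans[OF sum_abs]) (simp add: abs_mult mult_left_mono component_le_norm_cart)
    also have "\<dots> = (\<Sum>i\<in>UNIV. \<Sum>j\<in>UNIV. \<bar>W $ i $ j - B $ i $ j\<bar>) * norm v"
      by (subst sum.swap) (simp add: sum_distrib_right)
    also have "\<dots> < 1 * norm v" using close v0 by (rule mult_strict_right_mono)
    finally show False by simp
  qed
  then have "surj ((*v) (transpose B))"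
    using linear_injective_imp_surjective[OF matrix_vector_mul_linear] by blast
  then show ?thesis by (metis surjD)
qed

section \<open>The local defining map on symmetric matrices\<close>

text \<open>The normal form at an ordered point \<open>a\<close>, together with a diagonalizer
  \<open>V\<close>; as \<open>V\<close> varies, \<open>X0\<close> below runs through all symmetric
  matrices with eigenvalues \<open>a\<close>.\<close>

locale spectral_lift =
  fixes a :: "('n::{finite,linorder}) rvec" and V :: "('n::{finite,linorder}) rmat"
    and T :: "('n::{finite,linorder}) rvec set" and R :: "('n::{finite,linorder} \<times> 'n) set"
    and S :: "('n::{finite,linorder}) rvec set"
    and P \<Phi> :: "('n::{finite,linorder}) rvec \<Rightarrow> ('n::{finite,linorder}) rvec" and \<delta> :: real
  assumes cone: "a \<in> nonincr_cone" and V: "orthogonal_matrix V" and \<delta>: "\<delta> > 0" and T: "subspace T"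
    and R_def: "R = {(i, j). a $ i = a $ j \<and> (\<forall>t\<in>T. t $ i = t $ j)}"
    and S_def: "S = {w. (\<forall>i j. (i, j) \<in> R \<longrightarrow> w $ i = w $ j) \<and> (\<forall>t\<in>T. t \<bullet> w = 0)}"
    and block: "\<And>i j p. (i, j) \<in> R \<Longrightarrow> i \<noteq> j \<Longrightarrow> a $ p = a $ i \<Longrightarrow> (p, i) \<in> R"
    and sep: "\<And>x i j. x \<in> ball a \<delta> \<Longrightarrow> x $ i = x $ j \<Longrightarrow> a $ i = a $ j"
    and P: "bounded_linear P" "\<And>v. P v \<in> S" "\<And>v w. w \<in> S \<Longrightarrow> P v \<bullet> w = v \<bullet> w"
    and C2\<Phi>: "C2_dir (ball a \<delta>) \<Phi>" and \<Phi>S: "\<And>y. \<Phi> y \<in> S" and d\<Phi>: "(\<Phi> has_derivative P) (at a)"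
    and \<Phi>swap: "\<And>i j y. a $ i = a $ j \<Longrightarrow> \<Phi> (swapv i j y) = \<Phi> y"
begin

lemma equivR: "equiv UNIV R"
  unfolding equiv_def R_def by (auto simp: refl_on_def sym_def trans_def)

lemma R_imp: "(i, j) \<in> R \<Longrightarrow> a $ i = a $ j"
  by (simp add: R_def)

lemma R_refl: "(i, i) \<in> R"
  by (simp add: R_def)

lemma R_sym: "(i, j) \<in> R \<Longrightarrow> (j, i) \<in> R"
  by (auto simp: R_def)

lemma R_trans: "(i, j) \<in> R \<Longrightarrow> (j, k) \<in> R \<Longrightarrow> (i, k) \<in> R"
  by (auto simp: R_def)

lemma S_const: "w \<in> S \<Longrightarrow> (i, j) \<in> R \<Longrightarrow> w $ i = w $ j"
  by (simp add: S_def)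

lemma subspace_S: "subspace S"
  unfolding S_def by (auto simp: subspace_def inner_add_right)

definition X0 :: "'n rmat" where
  "X0 = V ** diagm a ** transpose V"

lemma X0_Sym: "X0 \<in> Sym"
  by (simp add: Sym_def vec_eq_iff transpose_component X0_def conj_diagm_component mult_ac)

lemma eigvals_X0: "eigvals (symm X0) = a"
  using eigvals_unique[OF V cone] symm_Sym[OF X0_Sym] by (simp add: X0_def)

lemma eigvals_X0': "eigvals X0 = a"
  using eigvals_X0 symm_Sym[OF X0_Sym] by simp

definition ev :: "'n rmat \<Rightarrow> 'n rvec" where
  "ev X = eigvals (symm X)"

definition lift_dom :: "'n rmat set" where
  "lift_dom = {X. ev X \<in> ball a \<delta>}"

lemma ev_X0: "ev X0 = a" by (simp add: ev_def eigvals_X0)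

lemma open_lift_dom: "open lift_dom"
  unfolding lift_dom_def ev_def
  using open_vimage[OF open_ball continuous_on_eigvals_symm, of a \<delta>] by (simp add: vimage_def)

lemma X0_lift_dom: "X0 \<in> lift_dom"
  using \<delta> by (simp add: lift_dom_def ev_X0)

definition Kf :: "'n rmat \<Rightarrow> 'n rmat" where
  "Kf H = transpose V ** symm H ** V"

text \<open>The matrix \<open>q(X)\<close> of the block of \<open>i\<close>, written in the fixed
  eigenbasis of \<open>X0\<close>.\<close>

definition Af :: "'n \<Rightarrow> 'n rmat \<Rightarrow> 'n rmat" where
  "Af i X = transpose V ** polym (cofactor a i (ev X)) (symm X) ** V"

definition Df :: "'n \<Rightarrow> 'n rmat \<Rightarrow> 'n rmat" where
  "Df i X = Kf X - block_mean a i (ev X) *\<^sub>R mat 1"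

text \<open>The eigenvalue of \<open>q(X0)\<close> on the block. Dividing by it makes the derivative
  at \<open>X0\<close> the plain block of the direction minus its mean.\<close>

definition qb :: "'n \<Rightarrow> real" where
  "qb i = poly (cofactor a i a) (a $ i)"

definition Zf :: "'n rmat \<Rightarrow> 'n \<Rightarrow> 'n \<Rightarrow> real" where
  "Zf X i j = (Af i X ** Df i X) $ i $ j / qb i"

definition Psi :: "'n rmat \<Rightarrow> 'n rmat" where
  "Psi X = block_combine R (Zf X) (\<Phi> (ev X))"

text \<open>Requiring diagonals orthogonal to \<open>T\<close> shrinks the target until the
  derivative is onto: the class means of such diagonals form exactly \<open>S\<close>, where
  \<open>\<Phi>\<close> takes its values.\<close>

definition Wsp :: "'n rmat set" where
  "Wsp = {Z \<in> Sym. (\<forall>i j. (i, j) \<notin> R \<longrightarrow> Z $ i $ j = 0) \<and> (\<forall>t\<in>T. t \<bullet> diagv Z = 0)}"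

lemma qb_nonzero: "qb i \<noteq> 0"
  by (auto simp: qb_def poly_cofactor blk_def)

lemma Af_Df_diagonal:
  assumes U: "orthogonal_matrix U" "symm X = U ** diagm (ev X) ** transpose U"
  defines "W \<equiv> transpose V ** U"
  shows "Af i X = W ** diagm (\<chi> l. poly (cofactor a i (ev X)) (ev X $ l)) ** transpose W"
    "Df i X = W ** diagm (\<chi> l. ev X $ l - block_mean a i (ev X)) ** transpose W"
    "Af i X ** Df i X = W ** diagm (\<chi> l. poly (cofactor a i (ev X)) (ev X $ l) * (ev X $ l - block_mean a i (ev X))) ** transpose W"
proof -
  have W: "orthogonal_matrix W" unfolding W_def using U V by (simp add: orthogonal_matrix_mul)
  have tW: "transpose W = transpose U ** V" by (simp add: W_def matrix_transpose_mul)
  show A: "Af i X = W ** diagm (\<chi> l. poly (cofactor a i (ev X)) (ev X $ l)) ** transpose W"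
    unfolding Af_def tW by (subst U(2)) (simp add: polym_conj_diagm[OF U(1) degree_cofactor] W_def matrix_mul_assoc)
  have "Kf X = W ** diagm (ev X) ** transpose W"
    unfolding Kf_def tW by (subst U(2)) (simp add: W_def matrix_mul_assoc)
  then show D: "Df i X = W ** diagm (\<chi> l. ev X $ l - block_mean a i (ev X)) ** transpose W"
    unfolding Df_def conj_diagm_shift[OF W] by simp
  show "Af i X ** Df i X = W ** diagm (\<chi> l. poly (cofactor a i (ev X)) (ev X $ l) * (ev X $ l - block_mean a i (ev X))) ** transpose W"
    unfolding A D conj_diagm_mult[OF W] by simp
qed

lemma spectral_C2_dom:
  assumes "C2_dir (ball a \<delta>) F" "\<And>i j x. a $ i = a $ j \<Longrightarrow> F (swapv i j x) = F x"
  shows "C2_dir lift_dom (\<lambda>X. F (ev X) :: real)"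
  unfolding lift_dom_def ev_def by (rule spectral_transfer(1)[OF sep]) (use assms in auto)

lemma C2_Af: "C2_dir lift_dom (\<lambda>X. Af i X $ p $ q)"
proof -
  have "C2_dir lift_dom (\<lambda>X. coeff (cofactor a i (ev X)) m)" for m
    by (rule spectral_C2_dom[OF C2_dir_coeff_cofactor]) (simp add: cofactor_swapv)
  then have "C2_dir lift_dom (\<lambda>X. polym (cofactor a i (ev X)) (symm X) $ k $ l)" for k l
    unfolding polym_def by (simp add: sum_component) (intro C2_dir_sum C2_dir_mult C2_dir_mpow_symm)
  then show ?thesis unfolding Af_def by (intro C2_dir_matrix_mult C2_dir_const)
qed

lemma C2_Kf: "C2_dir U (\<lambda>X. Kf X $ p $ q)"
  unfolding Kf_def by (intro C2_dir_matrix_mult C2_dir_const C2_dir_symm)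

lemma C2_Df: "C2_dir lift_dom (\<lambda>X. Df i X $ p $ q)"
proof -
  have "C2_dir lift_dom (\<lambda>X. Kf X $ p $ q - block_mean a i (ev X) * (mat 1 :: 'n rmat) $ p $ q)"
    by (intro C2_dir_diff C2_Kf C2_dir_mult C2_dir_const spectral_C2_dom[OF C2_dir_bounded_linear[OF block_mean_linear]])
      (simp add: block_mean_swapv)
  then show ?thesis by (simp add: Df_def)
qed

lemma C2_Psi: "C2_dir lift_dom Psi"
proof (intro C2_dir_vec)
  fix i j
  have Z: "C2_dir lift_dom (\<lambda>X. Zf X p q)" for p q
  proof -
    have "C2_dir lift_dom (\<lambda>X. 1 / qb p * (Af p X ** Df p X) $ p $ q)"
      by (intro C2_dir_cmult C2_dir_matrix_mult C2_Af C2_Df)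
    then show ?thesis by (simp add: Zf_def)
  qed
  have "C2_dir lift_dom (\<lambda>X. class_mean R (\<lambda>l. Zf X l l) i)"
    using C2_dir_cmult[OF C2_dir_sum[of "R `` {i}" lift_dom "\<lambda>l X. Zf X l l", OF Z], of "1 / real (card (R `` {i}))"]
    by (simp add: class_mean_def)
  moreover have "C2_dir lift_dom (\<lambda>X. \<Phi> (ev X) $ i)"
    by (rule spectral_C2_dom[of "\<lambda>x. \<Phi> x $ i"])
      (use C2_dir_linear_comp[OF bounded_linear_vec_nth C2\<Phi>] \<Phi>swap in auto)
  ultimately have "C2_dir lift_dom (\<lambda>X. Zf X i j - (if i = j then class_mean R (\<lambda>l. Zf X l l) i - \<Phi> (ev X) $ i else 0))"
    by (cases "i = j") (auto intro!: C2_dir_diff Z)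
  then show "C2_dir lift_dom (\<lambda>X. Psi X $ i $ j)"
    by (cases "(i, j) \<in> R") (simp_all add: Psi_def block_combine_component C2_dir_const)
qed

text \<open>Vectors of \<open>T\<close> are constant on the classes of \<open>R\<close>, so they see
  only class means of a diagonal, and these have been replaced by entries of
  \<open>v \<in> S\<close>.\<close>

lemma block_combine_in_Wsp:
  assumes Z: "\<And>i j. (i, j) \<in> R \<Longrightarrow> Z i j = Z j i" and v: "v \<in> S"
  shows "block_combine R Z v \<in> Wsp"
  unfolding Wsp_def
proof (intro CollectI conjI ballI allI impI)
  show "block_combine R Z v \<in> Sym"
    unfolding Sym_def
  proof (simp add: vec_eq_iff transpose_component, intro allI)
    fix i j
    show "block_combine R Z v $ j $ i = block_combine R Z v $ i $ j"
      using Z[of i j] R_sym[of i j] R_sym[of j i] by (auto simp: block_combine_component)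
  qed
  fix i j assume "(i, j) \<notin> R" then show "block_combine R Z v $ i $ j = 0" by (simp add: block_combine_component)
next
  fix t assume t: "t \<in> T"
  have "t \<bullet> diagv (block_combine R Z v) = (\<Sum>i\<in>UNIV. t $ i * Z i i) - (\<Sum>i\<in>UNIV. t $ i * class_mean R (\<lambda>l. Z l l) i) + t \<bullet> v"
    by (simp add: inner_vec_def diagv_def block_combine_component R_refl algebra_simps sum.distrib sum_subtractf)
  also have "(\<Sum>i\<in>UNIV. t $ i * class_mean R (\<lambda>l. Z l l) i) = (\<Sum>i\<in>UNIV. t $ i * Z i i)"
    by (rule sum_class_mean[OF equivR]) (use t in \<open>auto simp: R_def\<close>)
  also have "t \<bullet> v = 0" using v t by (simp add: S_def)
  finally show "t \<bullet> diagv (block_combine R Z v) = 0" by simp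
qed

lemma Psi_in_Wsp: "Psi X \<in> Wsp"
  unfolding Psi_def
proof (rule block_combine_in_Wsp[OF _ \<Phi>S])
  fix i j assume ij: "(i, j) \<in> R"
  note aij = R_imp[OF ij]
  obtain U where U: "orthogonal_matrix U" "symm X = U ** diagm (ev X) ** transpose U"
    using eigvals_decomposition[OF symm_in_Sym, of X] by (auto simp: ev_def)
  have "Af i X = Af j X" "Df i X = Df j X" "qb i = qb j"
    by (simp_all add: Af_def Df_def qb_def cofactor_cong[OF aij] block_mean_cong[OF aij] aij)
  moreover have "(Af i X ** Df i X) $ i $ j = (Af i X ** Df i X) $ j $ i"
    unfolding Af_Df_diagonal(3)[OF U] conj_diagm_component by (simp add: mult_ac)
  ultimately show "Zf X i j = Zf X j i" by (simp add: Zf_def)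
qed

lemma ev_has_derivative:
  assumes "C2_dir (ball a \<delta>) F" "\<And>i j x. a $ i = a $ j \<Longrightarrow> F (swapv i j x) = F x" and "(F has_derivative D) (at a)"
  shows "((\<lambda>X. F (ev X) :: real) has_derivative (\<lambda>H. D (diagv (Kf H)))) (at X0)"
  unfolding ev_def diagv_def Kf_def
  by (rule spectral_transfer(2)[OF sep assms(1,2)])
    (use assms(3) \<delta> V in \<open>simp_all add: eigvals_X0' symm_Sym[OF X0_Sym] X0_def[symmetric]\<close>)

lemma Kf_linear: "bounded_linear Kf"
  unfolding linear_conv_bounded_linear[symmetric] Kf_def
  by (intro linearI) (simp_all add: vec_eq_iff matrix_mult_component symm_component
      sum.distrib sum_distrib_left sum_distrib_right algebra_simps add_divide_distrib)

lemma Kf_sym: "Kf H $ i $ j = Kf H $ j $ i"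
proof -
  have "transpose (Kf H) = Kf H"
    using symm_in_Sym[of H] by (simp add: Kf_def Sym_def matrix_transpose_mul matrix_mul_assoc)
  then show ?thesis by (metis transpose_component)
qed

definition Zd :: "'n rmat \<Rightarrow> 'n \<Rightarrow> 'n \<Rightarrow> real" where
  "Zd H i j = Kf H $ i $ j - (if i = j then block_mean a i (diagv (Kf H)) else 0)"

lemma Zf_has_derivative:
  assumes aij: "a $ i = a $ j"
  shows "((\<lambda>X. Zf X i j) has_derivative (\<lambda>H. Zd H i j)) (at X0)"
proof -
  have dec: "symm X0 = V ** diagm (ev X0) ** transpose V"
    by (simp add: symm_Sym[OF X0_Sym] ev_X0 X0_def[symmetric])
  have VV: "transpose V ** V = mat 1" using V by (simp add: orthogonal_matrix_def)
  have A0: "Af i X0 $ p $ q = (if p = q then poly (cofactor a i a) (a $ p) else 0)" for p q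
    unfolding Af_Df_diagonal(1)[OF V dec] VV by (simp add: ev_X0 diagm_component transpose_mat)
  have D0: "Df i X0 $ p $ q = (if p = q then a $ p - a $ i else 0)" for p q
    unfolding Af_Df_diagonal(2)[OF V dec] VV
    using block_mean_const[of a i a "a $ i"] by (simp add: ev_X0 diagm_component transpose_mat)
  have "\<forall>k. \<exists>D. ((\<lambda>X. Af i X $ i $ k) has_derivative D) (at X0)"
    using C2_Af[of i i] X0_lift_dom unfolding C2_dir_def by meson
  then obtain A' where A': "\<And>k. ((\<lambda>X. Af i X $ i $ k) has_derivative A' k) (at X0)" by metis
  have D': "((\<lambda>X. Df i X $ k $ j) has_derivative (\<lambda>H. Kf H $ k $ j - block_mean a i (diagv (Kf H)) * (mat 1 :: 'n rmat) $ k $ j)) (at X0)" for k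
  proof -
    have 1: "((\<lambda>X. Kf X $ k $ j) has_derivative (\<lambda>H. Kf H $ k $ j)) (at X0)"
      by (rule bounded_linear_imp_has_derivative)
        (rule bounded_linear_compose[OF bounded_linear_vec_nth bounded_linear_compose[OF bounded_linear_vec_nth Kf_linear]])
    have 2: "((\<lambda>X. block_mean a i (ev X)) has_derivative (\<lambda>H. block_mean a i (diagv (Kf H)))) (at X0)"
      by (rule ev_has_derivative[OF C2_dir_bounded_linear[OF block_mean_linear] _ bounded_linear_imp_has_derivative[OF block_mean_linear]])
        (simp add: block_mean_swapv)
    show ?thesis unfolding Df_def
      using has_derivative_diff[OF 1 has_derivative_mult_left[OF 2]] by simp
  qed
  have "((\<lambda>X. \<Sum>k\<in>UNIV. Af i X $ i $ k * Df i X $ k $ j) has_derivative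
      (\<lambda>H. \<Sum>k\<in>UNIV. Af i X0 $ i $ k * (Kf H $ k $ j - block_mean a i (diagv (Kf H)) * (mat 1 :: 'n rmat) $ k $ j)
        + A' k H * Df i X0 $ k $ j)) (at X0)"
    by (intro has_derivative_sum has_derivative_mult A' D')
  moreover have "(\<Sum>k\<in>UNIV. Af i X0 $ i $ k * (Kf H $ k $ j - block_mean a i (diagv (Kf H)) * (mat 1 :: 'n rmat) $ k $ j)
        + A' k H * Df i X0 $ k $ j) = qb i * Zd H i j" for H
  proof -
    have "(\<Sum>k\<in>UNIV. Af i X0 $ i $ k * (Kf H $ k $ j - block_mean a i (diagv (Kf H)) * (mat 1 :: 'n rmat) $ k $ j)
        + A' k H * Df i X0 $ k $ j) = (\<Sum>k\<in>UNIV. if k = i then qb i * Zd H i j else 0)"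
    proof (rule sum.cong[OF refl])
      fix k
      have "Af i X0 $ i $ k = (if k = i then qb i else 0)" by (simp add: A0 qb_def)
      moreover have "Df i X0 $ k $ j = 0" using aij by (simp add: D0)
      ultimately show "Af i X0 $ i $ k * (Kf H $ k $ j - block_mean a i (diagv (Kf H)) * (mat 1 :: 'n rmat) $ k $ j)
        + A' k H * Df i X0 $ k $ j = (if k = i then qb i * Zd H i j else 0)"
        by (simp add: Zd_def mat_def)
    qed
    then show ?thesis by simp
  qed
  ultimately have "((\<lambda>X. (Af i X ** Df i X) $ i $ j) has_derivative (\<lambda>H. qb i * Zd H i j)) (at X0)"
    by (simp add: matrix_mult_component)
  from has_derivative_mult_right[OF this, of "1 / qb i"] show ?thesis
    using qb_nonzero[of i] by (simp add: Zf_def)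
qed

definition Psid :: "'n rmat \<Rightarrow> 'n rmat" where
  "Psid H = block_combine R (Zd H) (P (diagv (Kf H)))"

lemma Psi_has_derivative: "(Psi has_derivative Psid) (at X0)"
proof (intro has_derivative_vec)
  fix i j
  show "((\<lambda>X. Psi X $ i $ j) has_derivative (\<lambda>H. Psid H $ i $ j)) (at X0)"
  proof (cases "(i, j) \<in> R")
    case False
    then show ?thesis by (simp add: Psi_def Psid_def block_combine_component)
  next
    case True
    note Z = Zf_has_derivative[OF R_imp[OF True]]
    show ?thesis
    proof (cases "i = j")
      case False
      then show ?thesis using Z True by (simp add: Psi_def Psid_def block_combine_component)
    next
      case eq: True
      have "((\<lambda>X. 1 / real (card (R `` {i})) * (\<Sum>l\<in>R `` {i}. Zf X l l)) has_derivative
          (\<lambda>H. 1 / real (card (R `` {i})) * (\<Sum>l\<in>R `` {i}. Zd H l l))) (at X0)"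
        by (intro has_derivative_mult_right has_derivative_sum Zf_has_derivative refl)
      then have m: "((\<lambda>X. class_mean R (\<lambda>l. Zf X l l) i) has_derivative (\<lambda>H. class_mean R (\<lambda>l. Zd H l l) i)) (at X0)"
        by (simp add: class_mean_def)
      have p: "((\<lambda>X. \<Phi> (ev X) $ i) has_derivative (\<lambda>H. P (diagv (Kf H)) $ i)) (at X0)"
        by (rule ev_has_derivative[of "\<lambda>x. \<Phi> x $ i"])
          (use C2_dir_linear_comp[OF bounded_linear_vec_nth C2\<Phi>] \<Phi>swap bounded_linear.has_derivative[OF bounded_linear_vec_nth d\<Phi>] in auto)
      show ?thesis using has_derivative_diff[OF Z has_derivative_diff[OF m p]] eq True
        by (simp add: Psi_def Psid_def block_combine_component)
    qed
  qed
qed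

lemma class_mean_diff_const:
  assumes "\<And>l. (i, l) \<in> R \<Longrightarrow> b l = b i"
  shows "class_mean R (\<lambda>l. z l - b l) i = class_mean R z i - b i"
proof -
  have "(\<Sum>l\<in>R `` {i}. b l) = (\<Sum>l\<in>R `` {i}. b i)" by (rule sum.cong) (use assms in auto)
  moreover have "card (R `` {i}) > 0" using R_refl by (auto simp: card_gt_0_iff)
  ultimately show ?thesis
    by (simp only: class_mean_def sum_subtractf diff_divide_distrib) auto
qed

lemma class_mean_cong: "(i, j) \<in> R \<Longrightarrow> class_mean R z i = class_mean R z j"
  using equiv_class_eq[OF equivR] by (simp add: class_mean_def)

lemma Psid_image: "Psid ` Sym = Wsp"
proof (intro equalityI subsetI)
  fix Z assume "Z \<in> Psid ` Sym"
  then obtain H where H: "Z = Psid H" by blast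
  show "Z \<in> Wsp" unfolding H Psid_def
    by (rule block_combine_in_Wsp[OF _ P(2)]) (auto simp: Zd_def Kf_sym)
next
  fix Z assume Z: "Z \<in> Wsp"
  then have ZS: "Z \<in> Sym" and Z0: "\<And>i j. (i, j) \<notin> R \<Longrightarrow> Z $ i $ j = 0" and ZT: "\<And>t. t \<in> T \<Longrightarrow> t \<bullet> diagv Z = 0"
    by (auto simp: Wsp_def)
  define H where "H = V ** Z ** transpose V"
  have HS: "H \<in> Sym" using ZS by (simp add: H_def Sym_def matrix_transpose_mul matrix_mul_assoc)
  have KH: "Kf H = Z" unfolding Kf_def symm_Sym[OF HS] using V by (simp add: H_def matrix_mul_assoc orthogonal_matrix_simps)
  \<comment> \<open>For \<open>Z\<close> in the target the vector of diagonal class means lies in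
    \<open>S\<close> and is therefore what \<open>P\<close> returns. The block mean inside
    \<open>Zd\<close> cancels against its own class mean.\<close>
  define u where "u = (\<chi> i. class_mean R (\<lambda>l. Z $ l $ l) i)"
  have tu: "t \<bullet> u = t \<bullet> diagv Z" if "\<And>i j. (i, j) \<in> R \<Longrightarrow> t $ i = t $ j" for t
    using sum_class_mean[OF equivR, of "\<lambda>i. t $ i" "\<lambda>l. Z $ l $ l"] that
    by (simp add: inner_vec_def u_def diagv_def)
  have "P (diagv Z) = u"
  proof (rule orthogonal_projection_eqI[OF subspace_S, of P])
    have "u $ i = u $ j" if "(i, j) \<in> R" for i j using class_mean_cong[OF that] by (simp add: u_def)
    moreover have "t \<bullet> u = 0" if "t \<in> T" for t using tu[of t] ZT[OF that] that by (auto simp: R_def)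
    ultimately show "u \<in> S" by (simp add: S_def)
    show "u \<bullet> w = diagv Z \<bullet> w" if "w \<in> S" for w
      using tu[of w] S_const[OF that] by (simp add: inner_commute)
  qed (use P in auto)
  then have "Psid H $ i $ j = Z $ i $ j" for i j
  proof (cases "(i, j) \<in> R \<and> i = j")
    case True
    have "class_mean R (\<lambda>l. Z $ l $ l - block_mean a l (diagv Z)) i = class_mean R (\<lambda>l. Z $ l $ l) i - block_mean a i (diagv Z)"
      by (rule class_mean_diff_const) (use block_mean_cong R_imp in metis)
    then show ?thesis using True \<open>P (diagv Z) = u\<close>
      by (simp add: Psid_def block_combine_component Zd_def KH u_def R_refl)
  qed (use Z0 in \<open>auto simp: Psid_def block_combine_component Zd_def KH\<close>)
  then have "Psid H = Z" by (simp add: vec_eq_iff)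
  then show "Z \<in> Psid ` Sym" using HS by blast
qed

text \<open>Otherwise diagonalizers of matrices tending to \<open>X0\<close> would accumulate at a
  diagonalizer of \<open>X0\<close>, which relative to \<open>V\<close> has no entries between
  blocks. The bound 1 is the one required by \<open>near_identity_surjective\<close>.\<close>

lemma off_block_small:
  obtains \<rho> where "\<rho> > 0" "\<And>X U. X \<in> ball X0 \<rho> \<Longrightarrow> orthogonal_matrix U \<Longrightarrow> symm X = U ** diagm (ev X) ** transpose U \<Longrightarrow>
    (\<Sum>i\<in>UNIV. \<Sum>j\<in>UNIV. if a $ i = a $ j then 0 else \<bar>(transpose V ** U) $ i $ j\<bar>) < 1"
proof -
  define off where "off U = (\<Sum>i\<in>UNIV. \<Sum>j\<in>UNIV. if a $ i = a $ j then 0 else \<bar>(transpose V ** U) $ i $ j\<bar>)" for U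
  have "\<exists>\<rho>>0. \<forall>X U. X \<in> ball X0 \<rho> \<longrightarrow> orthogonal_matrix U \<longrightarrow> symm X = U ** diagm (ev X) ** transpose U \<longrightarrow> off U < 1"
  proof (rule ccontr)
    assume neg: "\<not> ?thesis"
    have "\<exists>X U. X \<in> ball X0 (1 / real (Suc n)) \<and> orthogonal_matrix U \<and> symm X = U ** diagm (ev X) ** transpose U \<and> \<not> off U < 1" for n
    proof -
      have "1 / real (Suc n) > 0" by simp
      with neg show ?thesis by blast
    qed
    then obtain X U where X: "\<And>n. X n \<in> ball X0 (1 / real (Suc n))" and U: "\<And>n. orthogonal_matrix (U n)"
      "\<And>n. symm (X n) = U n ** diagm (ev (X n)) ** transpose (U n)" and off: "\<And>n. \<not> off (U n) < 1" by metis
    have "X \<longlonglongrightarrow> X0"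
    proof -
      have "(\<lambda>n. dist (X n) X0) \<longlonglongrightarrow> 0"
        by (rule Lim_null_comparison[OF _ lim_inverse_n'[THEN LIMSEQ_Suc]])
          (use X in \<open>auto simp: dist_commute less_imp_le intro!: always_eventually\<close>)
      then show ?thesis using tendsto_dist_iff by blast
    qed
    then have Sl: "(\<lambda>n. symm (X n)) \<longlonglongrightarrow> symm X0" by (rule bounded_linear.tendsto[OF bounded_linear_symm])
    obtain r V' where r: "strict_mono r" and V': "orthogonal_matrix V'" and Ul: "(\<lambda>n. U (r n)) \<longlonglongrightarrow> V'"
      and X0': "symm X0 = V' ** diagm (eigvals (symm X0)) ** transpose V'"
      by (rule eigvals_subseq[OF Sl symm_in_Sym U(1) U(2)[unfolded ev_def]]) blast
    have eq: "V ** diagm a ** transpose V = V' ** diagm a ** transpose V'"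
      using X0' by (simp add: eigvals_X0' symm_Sym[OF X0_Sym] X0_def[symmetric])
    have "off V' = 0"
    proof -
      have "(transpose V ** V') $ i $ j = 0" if "a $ i \<noteq> a $ j" for i j
        using diagonalizers_block[OF V V' eq, of i j] that by blast
      then show ?thesis unfolding off_def by (intro sum.neutral ballI) simp
    qed
    moreover have "(\<lambda>n. off (U (r n))) \<longlonglongrightarrow> off V'"
      unfolding off_def
    proof (intro tendsto_sum)
      fix i j
      have "(\<lambda>n. \<bar>(transpose V ** U (r n)) $ i $ j\<bar>) \<longlonglongrightarrow> \<bar>(transpose V ** V') $ i $ j\<bar>"
        by (intro tendsto_rabs tendsto_vec_nth tendsto_matrix_mult tendsto_const Ul)
      then show "(\<lambda>n. if a $ i = a $ j then 0 else \<bar>(transpose V ** U (r n)) $ i $ j\<bar>) \<longlonglongrightarrow> (if a $ i = a $ j then 0 else \<bar>(transpose V ** V') $ i $ j\<bar>)"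
        by simp
    qed
    then have "1 \<le> off V'" by (rule LIMSEQ_le_const) (use off in \<open>auto simp: not_less\<close>)
    ultimately show False by simp
  qed
  then show ?thesis using that unfolding off_def by blast
qed

lemma same_order:
  assumes x: "x \<in> ball a \<delta>" and ne: "a $ l \<noteq> a $ j"
  shows "(x $ l - x $ j) * (a $ l - a $ j) > 0"
proof (rule ccontr)
  assume "\<not> ?thesis"
  moreover have "x $ l \<noteq> x $ j" using sep[OF x] ne by blast
  ultimately have neg: "(x $ l - x $ j) * (a $ l - a $ j) < 0" using ne by (simp add: not_less order_le_less)
  define A B where "A = a $ l - a $ j" and "B = x $ l - x $ j"
  have AB: "A \<noteq> 0" "B * A < 0" using ne neg by (auto simp: A_def B_def)
  then have sgn: "A > 0 \<and> B < 0 \<or> A < 0 \<and> B > 0" by (auto simp: mult_less_0_iff)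
  \<comment> \<open>The parameter at which coordinates \<open>l\<close> and \<open>j\<close> meet on
    the segment from \<open>a\<close> to \<open>x\<close>, if their order were reversed;
    \<open>sep\<close> forbids such a meeting in the ball.\<close>
  define s where "s = A / (A - B)"
  have s: "0 \<le> s" "s \<le> 1" using sgn by (auto simp: s_def field_simps divide_le_0_iff zero_le_divide_iff)
  have s0: "A + s * (B - A) = 0" using sgn by (auto simp: s_def field_simps)
  define y where "y = (1 - s) *\<^sub>R a + s *\<^sub>R x"
  have "y \<in> ball a \<delta>" unfolding y_def
    using convexD[OF convex_ball _ x, of a "1 - s" s] s \<delta> by simp
  moreover have "y $ l - y $ j = A + s * (B - A)" by (simp add: y_def A_def B_def algebra_simps)
  then have "y $ l = y $ j" using s0 by simp
  ultimately show False using sep ne by blast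
qed

text \<open>The compression of \<open>q(X) (X - c)\<close> to a block is a scalar \<open>c2\<close>.
  Suitable test vectors show that each eigenvalue of \<open>q(X) (X - c)\<close> belonging to the
  block is a positive multiple of \<open>c2\<close>, and \<open>q\<close> has constant sign there.
  So the deviations from the mean share one sign and, summing to 0, all vanish.\<close>

lemma Psi_zero_imp:
  assumes X: "X \<in> lift_dom" and U: "orthogonal_matrix U" "symm X = U ** diagm (ev X) ** transpose U"
    and off: "(\<Sum>i\<in>UNIV. \<Sum>j\<in>UNIV. if a $ i = a $ j then 0 else \<bar>(transpose V ** U) $ i $ j\<bar>) < 1"
    and zero: "Psi X = 0"
  shows "\<Phi> (ev X) = 0" and "\<And>i j. (i, j) \<in> R \<Longrightarrow> ev X $ i = ev X $ j"
proof -
  define x where "x = ev X"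
  have xb: "x \<in> ball a \<delta>" using X by (simp add: lift_dom_def x_def)
  have comp: "block_combine R (Zf X) (\<Phi> x) $ i $ j = 0" for i j
    using zero by (simp add: Psi_def x_def)
  have "\<Phi> x $ i = 0" for i
  proof -
    \<comment> \<open>The subtracted term is constant on the class, so the class mean of the
      vanishing diagonal of \<open>Psi X\<close> is just \<open>\<Phi> x $ i\<close>.\<close>
    have "class_mean R (\<lambda>l. Zf X l l - (class_mean R (\<lambda>l. Zf X l l) l - \<Phi> x $ l)) i
        = class_mean R (\<lambda>l. Zf X l l) i - (class_mean R (\<lambda>l. Zf X l l) i - \<Phi> x $ i)"
    proof (rule class_mean_diff_const)
      fix l assume "(i, l) \<in> R"
      from class_mean_cong[OF this, of "\<lambda>l. Zf X l l"] S_const[OF \<Phi>S this, of x]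
      show "class_mean R (\<lambda>l. Zf X l l) l - \<Phi> x $ l = class_mean R (\<lambda>l. Zf X l l) i - \<Phi> x $ i" by simp
    qed
    moreover have z: "Zf X l l - (class_mean R (\<lambda>l. Zf X l l) l - \<Phi> x $ l) = 0" for l
      using comp[of l l] by (simp add: block_combine_component R_refl)
    have "class_mean R (\<lambda>l. Zf X l l - (class_mean R (\<lambda>l. Zf X l l) l - \<Phi> x $ l)) i = 0"
      unfolding z by (simp add: class_mean_def)
    ultimately show ?thesis by linarith
  qed
  then show \<Phi>0: "\<Phi> (ev X) = 0" by (simp add: vec_eq_iff x_def)
  fix i j assume ij: "(i, j) \<in> R"
  have "x $ i = x $ j"
  proof (cases "i = j")
    case ne: False
    define B where "B = blk a i"
    have B: "p \<in> B \<longleftrightarrow> a $ p = a $ i" for p by (simp add: B_def blk_def)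
    have iB: "i \<in> B" and jB: "j \<in> B" using R_imp[OF ij] by (simp_all add: B)
    have BR: "(p, q) \<in> R" if "p \<in> B" "q \<in> B" for p q
    proof -
      have "(p, i) \<in> R" "(q, i) \<in> R" using block[OF ij ne] that unfolding B by blast+
      then show ?thesis using R_trans R_sym by blast
    qed
    define W where "W = transpose V ** U"
    have W: "orthogonal_matrix W" unfolding W_def using U V by (simp add: orthogonal_matrix_mul)
    define q where "q l = poly (cofactor a i x) (x $ l)" for l
    define c where "c = block_mean a i x"
    define y where "y l = q l * (x $ l - c)" for l
    define Y where "Y = Af i X ** Df i X"
    define c2 where "c2 = class_mean R (\<lambda>l. Zf X l l) i * qb i"
    have YW: "Y $ p $ r = (\<Sum>m\<in>UNIV. W $ p $ m * y m * W $ r $ m)" for p r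
      unfolding Y_def Af_Df_diagonal(3)[OF U] conj_diagm_component
      by (simp add: W_def y_def q_def c_def x_def)
    have Yc: "Y $ p $ r = (if p = r then c2 else 0)" if "p \<in> B" "r \<in> B" for p r
    proof -
      have ap: "a $ p = a $ i" using that by (simp add: B)
      have "Zf X p r = Y $ p $ r / qb i"
        by (simp add: Zf_def Y_def Af_def Df_def qb_def cofactor_cong[OF ap] block_mean_cong[OF ap] ap)
      moreover have "Zf X p r = (if p = r then class_mean R (\<lambda>l. Zf X l l) i else 0)"
        using comp[of p r] BR[OF that] class_mean_cong[OF BR[OF that(1) iB], of "\<lambda>l. Zf X l l"] \<Phi>0
        by (auto simp: block_combine_component x_def)
      ultimately show ?thesis using qb_nonzero[of i] by (auto simp: c2_def field_simps)
    qed
    have y0: "y m = 0" if "m \<notin> B" for m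
      using that by (auto simp: y_def q_def poly_cofactor B_def)
    define Bm where "Bm = (\<chi> p m. if a $ p = a $ m then W $ p $ m else 0)"
    have "(\<Sum>p\<in>UNIV. \<Sum>m\<in>UNIV. \<bar>W $ p $ m - Bm $ p $ m\<bar>) = (\<Sum>p\<in>UNIV. \<Sum>m\<in>UNIV. if a $ p = a $ m then 0 else \<bar>W $ p $ m\<bar>)"
      by (intro sum.cong refl) (simp add: Bm_def)
    then have close: "(\<Sum>p\<in>UNIV. \<Sum>m\<in>UNIV. \<bar>W $ p $ m - Bm $ p $ m\<bar>) < 1" using off unfolding W_def[symmetric] by simp
    have "\<exists>s>0. y l = c2 * s" if l: "l \<in> B" for l
    proof -
      \<comment> \<open>Chosen so that \<open>u\<close>, the vector \<open>v\<close> restricted to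
        the block and expressed in the eigenbasis of \<open>X\<close>, has in-block part
        \<open>axis l 1\<close>. Its components outside the block do not matter, since
        \<open>y\<close> vanishes there; hence the quadratic form picks out
        \<open>y l\<close>.\<close>
      obtain v where v: "transpose Bm *v v = axis l 1" using near_identity_surjective[OF W close] by blast
      define u where "u m = (\<Sum>p\<in>B. W $ p $ m * v $ p)" for m
      have u: "u m = (if m = l then 1 else 0)" if m: "m \<in> B" for m
      proof -
        have "(transpose Bm *v v) $ m = (\<Sum>p\<in>UNIV. (if p \<in> B then W $ p $ m * v $ p else 0))"
          unfolding matrix_vector_mult_def vec_lambda_beta
          by (rule sum.cong) (use m in \<open>auto simp: transpose_component Bm_def B\<close>)
        also have "\<dots> = u m" by (simp add: u_def sum.If_cases)
        finally show ?thesis unfolding v by (auto simp: axis_def)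
      qed
      have "y l = (\<Sum>m\<in>UNIV. if m = l then y l else 0)" by simp
      also have "\<dots> = (\<Sum>m\<in>UNIV. y m * (u m * u m))"
      proof (rule sum.cong[OF refl])
        fix m show "(if m = l then y l else 0) = y m * (u m * u m)"
          using u[of m] y0[of m] l by (cases "m \<in> B") auto
      qed
      also have "\<dots> = (\<Sum>m\<in>UNIV. \<Sum>p\<in>B. \<Sum>r\<in>B. v $ p * v $ r * (W $ p $ m * y m * W $ r $ m))"
        by (simp add: u_def sum_product sum_distrib_left mult_ac)
      also have "\<dots> = (\<Sum>p\<in>B. \<Sum>m\<in>UNIV. \<Sum>r\<in>B. v $ p * v $ r * (W $ p $ m * y m * W $ r $ m))"
        by (rule sum.swap)
      also have "\<dots> = (\<Sum>p\<in>B. \<Sum>r\<in>B. \<Sum>m\<in>UNIV. v $ p * v $ r * (W $ p $ m * y m * W $ r $ m))"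
        by (intro sum.cong refl sum.swap)
      also have "\<dots> = (\<Sum>p\<in>B. \<Sum>r\<in>B. if r = p then v $ p * v $ p * c2 else 0)"
        by (intro sum.cong refl) (auto simp: sum_distrib_left[symmetric] YW[symmetric] Yc)
      also have "\<dots> = c2 * (\<Sum>p\<in>B. v $ p * v $ p)"
        by (simp add: sum_distrib_left mult_ac)
      finally have yl: "y l = c2 * (\<Sum>p\<in>B. v $ p * v $ p)" .
      have "(\<Sum>p\<in>B. v $ p * v $ p) \<noteq> 0"
      proof
        assume "(\<Sum>p\<in>B. v $ p * v $ p) = 0"
        then have "v $ p = 0" if "p \<in> B" for p using that by (simp add: sum_nonneg_eq_0_iff)
        then have "u l = 0" by (simp add: u_def)
        then show False using u[OF l] by simp
      qed
      moreover have "(\<Sum>p\<in>B. v $ p * v $ p) \<ge> 0" by (intro sum_nonneg) simp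
      ultimately show ?thesis using yl by (metis order_le_less)
    qed
    then obtain s where s: "\<And>l. l \<in> B \<Longrightarrow> s l > 0" "\<And>l. l \<in> B \<Longrightarrow> y l = c2 * s l" by metis
    \<comment> \<open>Eigenvalues of different blocks keep their order from \<open>a\<close> to
      \<open>x\<close>, so corresponding factors of the two cofactor values have equal
      signs.\<close>
    have qpos: "q l * qb i > 0" if "l \<in> B" for l
    proof -
      have "q l * qb i = (\<Prod>j\<in>- blk a i. (x $ l - x $ j) * (a $ i - a $ j))"
        by (simp add: q_def qb_def poly_cofactor prod.distrib)
      also have "\<dots> > 0"
      proof (rule prod_pos)
        fix k assume "k \<in> - blk a i"
        then have "a $ l \<noteq> a $ k" using that by (auto simp: blk_def B)
        from same_order[OF xb this] show "(x $ l - x $ k) * (a $ i - a $ k) > 0" using that by (simp add: B)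
      qed
      finally show ?thesis .
    qed
    have sum0: "(\<Sum>l\<in>B. x $ l - c) = 0"
      using card_blk_pos[of a i] by (simp add: sum_subtractf c_def block_mean_def B_def)
    have "c2 = 0"
    proof (rule ccontr)
      assume c2: "c2 \<noteq> 0"
      have "(x $ l - c) * (c2 * qb i) > 0" if l: "l \<in> B" for l
      proof -
        have "(q l * qb i) * ((x $ l - c) * (c2 * qb i)) = (y l * c2) * (qb i * qb i)"
          by (simp add: y_def mult_ac)
        also have "\<dots> = (c2 * c2) * s l * (qb i * qb i)" by (simp add: s(2)[OF l])
        also have "\<dots> > 0" using c2 s(1)[OF l] qb_nonzero[of i] by (auto simp: zero_less_mult_iff)
        finally show ?thesis using qpos[OF l] zero_less_mult_pos by blast
      qed
      then have "(\<Sum>l\<in>B. (x $ l - c) * (c2 * qb i)) > 0"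
        using iB by (intro sum_pos) auto
      then show False using sum0 by (simp add: sum_distrib_right[symmetric])
    qed
    then have "x $ l = c" if "l \<in> B" for l
      using s(2)[OF that] qpos[OF that] by (auto simp: y_def)
    then show ?thesis using iB jB by simp
  qed simp
  then show "ev X $ i = ev X $ j" by (simp add: x_def)
qed

text \<open>On a nontrivial class, which is a whole block of \<open>a\<close>, all eigenvalues equal
  their mean, and at the other eigenvalues the cofactor vanishes; so \<open>q(X) (X - c)\<close> is
  the zero matrix.\<close>

lemma Psi_zero:
  assumes "\<Phi> (ev X) = 0" and xR: "\<And>i j. (i, j) \<in> R \<Longrightarrow> ev X $ i = ev X $ j"
  shows "Psi X = 0"
proof -
  obtain U where U: "orthogonal_matrix U" "symm X = U ** diagm (ev X) ** transpose U"
    using eigvals_decomposition[OF symm_in_Sym, of X] by (auto simp: ev_def)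
  have Z0: "Zf X p r = 0" if pq: "(p, q) \<in> R" "p \<noteq> q" for p q r
  proof -
    have c: "ev X $ l = ev X $ p" if "a $ l = a $ p" for l
      using xR[OF block[OF pq that]] .
    have bm: "block_mean a p (ev X) = ev X $ p" by (rule block_mean_const) (rule c)
    have cf: "poly (cofactor a p (ev X)) (ev X $ l) * (ev X $ l - ev X $ p) = 0" for l
    proof (cases "a $ l = a $ p")
      case True
      then show ?thesis using c[OF True] by simp
    next
      case False
      then have "poly (cofactor a p (ev X)) (ev X $ l) = 0" by (auto simp: poly_cofactor blk_def)
      then show ?thesis by simp
    qed
    have "(Af p X ** Df p X) $ p $ r = 0"
      unfolding Af_Df_diagonal(3)[OF U] conj_diagm_component bm vec_lambda_beta cf by simp
    then show ?thesis by (simp add: Zf_def)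
  qed
  have "Psi X $ i $ j = 0" for i j
  proof (cases "\<exists>q. (i, q) \<in> R \<and> i \<noteq> q")
    case True
    then obtain q where q: "(i, q) \<in> R" "i \<noteq> q" by blast
    have "Zf X l l = 0" if "(i, l) \<in> R" for l
    proof (cases "l = i")
      case True then show ?thesis using Z0[OF q] by simp
    next
      case False then show ?thesis using Z0[OF R_sym[OF that]] by simp
    qed
    then have "class_mean R (\<lambda>l. Zf X l l) i = 0" by (simp add: class_mean_def)
    then show ?thesis using Z0[OF q] assms(1) by (auto simp: Psi_def block_combine_component)
  next
    case False
    \<comment> \<open>A singleton class imposes no coincidence: the diagonal entry cancels with its
      own mean and only \<open>\<Phi>\<close> remains.\<close>
    then have Ri: "R `` {i} = {i}" using R_refl by auto
    show ?thesis
    proof (cases "i = j")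
      case True
      then show ?thesis using Ri assms(1) by (simp add: Psi_def block_combine_component class_mean_def)
    next
      case ne: False
      then have "(i, j) \<notin> R" using False by blast
      then show ?thesis by (simp add: Psi_def block_combine_component)
    qed
  qed
  then show ?thesis by (simp add: vec_eq_iff)
qed

lemma subspace_Wsp: "subspace Wsp"
  unfolding Wsp_def
  by (auto simp: subspace_def Sym_def vec_eq_iff transpose_component diagv_def inner_vec_def
      distrib_left sum.distrib sum_distrib_left[symmetric] mult.left_commute)

text \<open>Among symmetric matrices supported on \<open>R\<close>, the target is the orthogonal
  complement of the image of \<open>T\<close> under \<open>diagm\<close>.\<close>

lemma dim_Wsp: "dim Wsp + dim T = card {(i, j). i \<le> j \<and> (i, j) \<in> R}"
proof -
  define VR where "VR = {Z \<in> Sym. \<forall>i j. (i, j) \<notin> R \<longrightarrow> Z $ i $ j = (0::real)}"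
  have symR: "sym R" using equivR by (simp add: equiv_def)
  have lin: "linear (diagm :: 'n rvec \<Rightarrow> 'n rmat)"
    by (rule linearI) (auto simp: vec_eq_iff diagm_component)
  have inj: "inj (diagm :: 'n rvec \<Rightarrow> 'n rmat)"
    by (rule injI) (metis diagm_component vec_eq_iff)
  have ip: "orthogonal (diagm t) Z \<longleftrightarrow> t \<bullet> diagv Z = 0" for t and Z :: "'n rmat"
    by (simp add: orthogonal_def inner_vec_def diagm_component diagv_def if_distrib if_distribR cong: if_cong)
  have "Wsp = {Z \<in> VR. \<forall>x\<in>diagm ` T. orthogonal x Z}"
    by (auto simp: Wsp_def VR_def ip)
  moreover have "dim {Z \<in> VR. \<forall>x\<in>diagm ` T. orthogonal x Z} + dim (diagm ` T) = dim VR"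
  proof (rule dim_subspace_orthogonal_to_vectors)
    show "subspace (diagm ` T)" by (rule linear_subspace_image[OF lin T])
    show "subspace VR" unfolding VR_def
      by (auto simp: subspace_def Sym_def vec_eq_iff transpose_component)
    show "diagm ` T \<subseteq> VR"
      using R_refl by (auto simp: VR_def Sym_def vec_eq_iff transpose_component diagm_component)
  qed
  moreover have "dim (diagm ` T) = dim T"
    by (rule dim_image_eq[OF lin]) (use inj inj_on_subset in blast)
  moreover have "dim VR = card {(i, j). i \<le> j \<and> (i, j) \<in> R}"
    unfolding VR_def by (rule dim_block_Sym[OF symR])
  ultimately show ?thesis by simp
qed

lemma spectral_chart:
  assumes M: "M \<inter> ball a \<delta> = {y \<in> ball a \<delta>. (\<forall>i j. (i, j) \<in> R \<longrightarrow> y $ i = y $ j) \<and> \<Phi> y = 0}"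
  shows "\<exists>U. open U \<and> X0 \<in> U \<and> C2_on U Psi \<and> spectral_preimage M \<inter> U = {X \<in> U \<inter> Sym. Psi X = 0}"
proof -
  obtain \<rho> where \<rho>: "\<rho> > 0" "\<And>X U. X \<in> ball X0 \<rho> \<Longrightarrow> orthogonal_matrix U \<Longrightarrow> symm X = U ** diagm (ev X) ** transpose U \<Longrightarrow>
    (\<Sum>i\<in>UNIV. \<Sum>j\<in>UNIV. if a $ i = a $ j then 0 else \<bar>(transpose V ** U) $ i $ j\<bar>) < 1"
    by (rule off_block_small) blast
  define U where "U = lift_dom \<inter> ball X0 \<rho>"
  have op: "open U" unfolding U_def using open_lift_dom by auto
  have "X \<in> spectral_preimage M \<longleftrightarrow> Psi X = 0" if X: "X \<in> U" "X \<in> Sym" for X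
  proof -
    have ev: "ev X = eigvals X" by (simp add: ev_def symm_Sym[OF X(2)])
    have dom: "X \<in> lift_dom" "X \<in> ball X0 \<rho>" using X(1) by (auto simp: U_def)
    then have evb: "ev X \<in> ball a \<delta>" by (simp add: lift_dom_def)
    have "X \<in> spectral_preimage M \<longleftrightarrow> ev X \<in> M" using X(2) by (simp add: spectral_preimage_def ev)
    also have "\<dots> \<longleftrightarrow> (\<forall>i j. (i, j) \<in> R \<longrightarrow> ev X $ i = ev X $ j) \<and> \<Phi> (ev X) = 0"
      using M evb by blast
    also have "\<dots> \<longleftrightarrow> Psi X = 0"
    proof
      assume "Psi X = 0"
      obtain Q where Q: "orthogonal_matrix Q" "symm X = Q ** diagm (ev X) ** transpose Q"
        using eigvals_decomposition[OF symm_in_Sym, of X] by (auto simp: ev_def)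
      from Psi_zero_imp[OF dom(1) Q \<rho>(2)[OF dom(2) Q] \<open>Psi X = 0\<close>]
      show "(\<forall>i j. (i, j) \<in> R \<longrightarrow> ev X $ i = ev X $ j) \<and> \<Phi> (ev X) = 0" by blast
    qed (use Psi_zero[of X] in blast)
    finally show ?thesis .
  qed
  then have "spectral_preimage M \<inter> U = {X \<in> U \<inter> Sym. Psi X = 0}"
    by (auto simp: spectral_preimage_def)
  moreover have "C2_on U Psi" unfolding C2_on_iff_C2_dir[OF op]
    by (rule C2_dir_subset[OF C2_Psi]) (simp add: U_def)
  moreover have "X0 \<in> U" using X0_lift_dom \<rho>(1) by (simp add: U_def)
  ultimately show ?thesis using op by blast
qed

end

section \<open>Assembling the charts and the dimension formula\<close>

lemma card_upper_pairs:
  fixes R :: "('n::{finite,linorder} \<times> 'n) set"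
  assumes "\<And>i. (i, i) \<in> R"
  shows "card {(i::'n, j). i \<le> j} = card {(i, j). i \<le> j \<and> (i, j) \<in> R} + card {(i, j). i < j \<and> (i, j) \<notin> R}"
proof -
  have "{(i::'n, j). i \<le> j} = {(i, j). i \<le> j \<and> (i, j) \<in> R} \<union> {(i, j). i < j \<and> (i, j) \<notin> R}"
    using assms by (auto simp: order_le_less)
  moreover have "{(i, j). i \<le> j \<and> (i, j) \<in> R} \<inter> {(i, j). i < j \<and> (i, j) \<notin> R} = {}" by auto
  ultimately show ?thesis by (simp add: card_Un_disjoint)
qed

text \<open>The codimension is the dimension of the chart's target: the pairs
  \<open>i \<le> j\<close> inside the classes, minus \<open>d\<close>. Taking this away from all
  pairs \<open>i \<le> j\<close> leaves \<open>d\<close> plus the pairs in different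
  classes.\<close>

proposition spectral_preimage_submanifold:
  fixes M :: "('n::{finite,linorder}) rvec set"
  assumes M: "locally_symmetric_C2_submanifold M d" and y0: "y0 \<in> M"
  shows "C2_submanifold_of Sym (spectral_preimage M) (d + card {(i, j). i < j \<and> (i, j) \<notin> coincide M y0})"
proof -
  let ?R = "coincide M y0" and ?Rc = "{(i, j). i < j \<and> (i, j) \<notin> coincide M y0}"
  have sub: "C2_submanifold_of UNIV M d" and sym: "locally_symmetric M"
    using M by (auto simp: locally_symmetric_C2_submanifold_def)
  \<comment> \<open>The dimension facts stand outside the condition on \<open>X0\<close>, as they
    are needed before any matrix of the preimage is given.\<close>
  have chart: "d \<le> card {(i, j). i \<le> j \<and> (i, j) \<in> ?R} \<and> (\<forall>i. (i, i) \<in> ?R) \<and>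
      (X0 \<in> Sym \<longrightarrow> eigvals X0 = a \<longrightarrow> (\<exists>U (W :: 'n rmat set) F F'. open U \<and> X0 \<in> U \<and> subspace W \<and>
        dim W = card {(i, j). i \<le> j \<and> (i, j) \<in> ?R} - d \<and>
        C2_on U F \<and> (\<forall>y\<in>U. F y \<in> W) \<and> spectral_preimage M \<inter> U = {y \<in> U \<inter> Sym. F y = 0} \<and>
        (F has_derivative F') (at X0) \<and> F' ` Sym = W))" if a: "a \<in> M" "a \<in> nonincr_cone" for a and X0 :: "'n rmat"
  proof -
    obtain T R S P \<Phi> \<delta> where nf: "\<delta> > 0" "subspace T" "dim T = d"
      "R = {(i, j). a $ i = a $ j \<and> (\<forall>t\<in>T. t $ i = t $ j)}"
      "S = {w. (\<forall>i j. (i, j) \<in> R \<longrightarrow> w $ i = w $ j) \<and> (\<forall>t\<in>T. t \<bullet> w = 0)}"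
      "\<And>i j p. (i, j) \<in> R \<Longrightarrow> i \<noteq> j \<Longrightarrow> a $ p = a $ i \<Longrightarrow> (p, i) \<in> R"
      "\<And>x i j. x \<in> ball a \<delta> \<Longrightarrow> x $ i = x $ j \<Longrightarrow> a $ i = a $ j"
      "bounded_linear P" "\<And>v. P v \<in> S" "\<And>v w. w \<in> S \<Longrightarrow> P v \<bullet> w = v \<bullet> w"
      "C2_dir (ball a \<delta>) \<Phi>" "\<And>y. \<Phi> y \<in> S" "(\<Phi> has_derivative P) (at a)"
      "\<And>i j y. a $ i = a $ j \<Longrightarrow> \<Phi> (swapv i j y) = \<Phi> y"
      and normal: "M \<inter> ball a \<delta> = {y \<in> ball a \<delta>. (\<forall>i j. (i, j) \<in> R \<longrightarrow> y $ i = y $ j) \<and> \<Phi> y = 0}"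
      and const: "\<And>y. y \<in> M \<Longrightarrow> y \<in> ball a \<delta> \<Longrightarrow> coincide M y = R"
      by (rule local_normal_form[OF sub sym a(1)]) (rule that; assumption)
    have RR: "R = ?R" using const[OF a(1)] nf(1) coincide_constant[OF M a(1) y0] by simp
    have lift: "spectral_lift a V T R S P \<Phi> \<delta>" if "orthogonal_matrix V" for V
      unfolding spectral_lift_def using that a(2) nf by (intro conjI allI impI) assumption+
    have dimd: "d \<le> card {(i, j). i \<le> j \<and> (i, j) \<in> R}" and refl: "(i, i) \<in> R" for i
      using spectral_lift.dim_Wsp[OF lift[OF orthogonal_matrix_id]] nf(3) nf(4) by auto
    have "\<exists>U (W :: 'n rmat set) F F'. open U \<and> X0 \<in> U \<and> subspace W \<and>
        dim W = card {(i, j). i \<le> j \<and> (i, j) \<in> R} - d \<and>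
        C2_on U F \<and> (\<forall>y\<in>U. F y \<in> W) \<and> spectral_preimage M \<inter> U = {y \<in> U \<inter> Sym. F y = 0} \<and>
        (F has_derivative F') (at X0) \<and> F' ` Sym = W" if X0: "X0 \<in> Sym" "eigvals X0 = a"
    proof -
      obtain V where V: "orthogonal_matrix V" "X0 = V ** diagm (eigvals X0) ** transpose V"
        using eigvals_decomposition[OF X0(1)] by metis
      interpret L: spectral_lift a V T R S P \<Phi> \<delta> by (rule lift[OF V(1)])
      have X0_eq: "L.X0 = X0" using V(2) X0(2) by (simp add: L.X0_def)
      obtain U where U: "open U" "X0 \<in> U" "C2_on U L.Psi" "spectral_preimage M \<inter> U = {X \<in> U \<inter> Sym. L.Psi X = 0}"
        using L.spectral_chart[OF normal] unfolding X0_eq by blast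
      have "dim L.Wsp = card {(i, j). i \<le> j \<and> (i, j) \<in> R} - d" using L.dim_Wsp nf(3) by simp
      moreover have "(L.Psi has_derivative L.Psid) (at X0)" using L.Psi_has_derivative unfolding X0_eq .
      ultimately show ?thesis
        by (intro exI[of _ U] exI[of _ L.Wsp] exI[of _ L.Psi] exI[of _ L.Psid] conjI ballI
            U L.subspace_Wsp L.Psi_in_Wsp L.Psid_image)
    qed
    then show ?thesis using dimd refl unfolding RR by blast
  qed
  obtain a1 where a1: "a1 \<in> M" "a1 \<in> nonincr_cone" using sym unfolding locally_symmetric_def by blast
  note c1 = chart[OF a1]
  have dS: "dim (Sym :: 'n rmat set) = card {(i, j). i \<le> j \<and> (i, j) \<in> ?R} + card ?Rc"
    unfolding dim_Sym by (rule card_upper_pairs) (use c1 in blast)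
  have le: "d + card ?Rc \<le> dim (Sym :: 'n rmat set)" using c1 dS by simp
  have codim: "card {(i, j). i \<le> j \<and> (i, j) \<in> ?R} - d = dim (Sym :: 'n rmat set) - (d + card ?Rc)"
    using dS by simp
  show ?thesis
    unfolding C2_submanifold_of_def
  proof (intro conjI ballI subspace_Sym le)
    show "spectral_preimage M \<subseteq> Sym" by (auto simp: spectral_preimage_def)
    fix X assume "X \<in> spectral_preimage M"
    then have X: "X \<in> Sym" "eigvals X \<in> M" by (auto simp: spectral_preimage_def)
    from chart[OF X(2) eigvals_in_cone[OF X(1)], of X] X(1)
    show "\<exists>U (W :: 'n rmat set) F F'. open U \<and> X \<in> U \<and> subspace W \<and>
        dim W = dim (Sym :: 'n rmat set) - (d + card ?Rc) \<and>
        C2_on U F \<and> (\<forall>y\<in>U. F y \<in> W) \<and> spectral_preimage M \<inter> U = {y \<in> U \<inter> Sym. F y = 0} \<and>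
        (F has_derivative F') (at X) \<and> F' ` Sym = W"
      unfolding codim by blast
  qed
qed

theorem theorem4p21:
  fixes M :: "(real^'n::{finite,linorder}) set" and d :: nat
  assumes "locally_symmetric_C2_submanifold M d"
  shows "(\<exists>e. C2_submanifold_of Sym (spectral_preimage M) e) \<and>
    (\<forall>\<sigma>. characteristic_perm M \<sigma> \<longrightarrow>
       C2_submanifold_of Sym (spectral_preimage M)
         (d + (\<Sum>p\<in>{p. p \<subseteq> perm_partition \<sigma> \<and> card p = 2}. \<Prod>I\<in>p. card I)))"
proof (intro conjI allI impI)
  obtain a where "a \<in> M"
    using assms unfolding locally_symmetric_C2_submanifold_def locally_symmetric_def by blast
  then show "\<exists>e. C2_submanifold_of Sym (spectral_preimage M) e"
    using spectral_preimage_submanifold[OF assms] by blast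
next
  fix \<sigma> assume "characteristic_perm M \<sigma>"
  then obtain y where y: "y \<in> M" "coincide M y = {(i, j). y $ i = y $ j}" "vec_partition y = perm_partition \<sigma>"
    by (rule characteristic_perm_coincide)
  \<comment> \<open>At this \<open>y\<close> the persisting coincidences are exactly the equal
    coordinates, so the counted pairs join two different orbits, each taken once through
    \<open>i < j\<close>.\<close>
  have "card {(i, j). i < j \<and> (i, j) \<notin> coincide M y} = (\<Sum>p\<in>{p. p \<subseteq> perm_partition \<sigma> \<and> card p = 2}. \<Prod>I\<in>p. card I)"
    using card_pairs_vec_partition[of y] by (simp add: y(2,3))
  then show "C2_submanifold_of Sym (spectral_preimage M)
         (d + (\<Sum>p\<in>{p. p \<subseteq> perm_partition \<sigma> \<and> card p = 2}. \<Prod>I\<in>p. card I))"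
    using spectral_preimage_submanifold[OF assms y(1)] by simp
qed

end
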